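(* Let $s:\mathbf{R}\to\mathbf{R}$ be strictly increasing and absolutely continuous with $s'(x)\in\{0,1\}$ for a.e. $x$, assume that the set $G=\{x\in\mathbf{R}: s'(x)=1\}$ (defined up to Lebesgue-null sets) has an open version, again denoted $G$, and put $F=\mathbf{R}\setminus G$. Let $\alpha>0$ and $f\in H^1(\mathbf{R})$. Call $u$ a solution if $u\in H^1(\mathbf{R})$, a version of $u'$ is absolutely continuous on $G$, and $$\tfrac12u''(x)=\alpha u(x)\ \text{ for a.e. } x\in G,\qquad u'(x)=f'(x)\ \text{ for a.e. } x\in F.$$ Then the set of all solutions is exactly $$\{P_{\mathcal{G}^{(s)}_\alpha}f+h:\ h\in\mathcal{H}^{(s),\alpha}_F\},$$ where $P_{\mathcal{G}^{(s)}_\alpha}f$ is the $\mathcal{E}_\alpha$-orthogonal projection of $f$ onto the $\mathcal{E}_\alpha$-orthogonal complement $\mathcal{G}^{(s)}_\alpha$ of $\mathcal{F}^{(s)}$ in $H^1(\mathbf{R})$, and $\mathcal{H}^{(s),\alpha}_F$ is the $\mathcal{E}_\alpha$-orthogonal complement in $\mathcal{F}^{(s)}$ of $\mathcal{F}^{(s)}_G=\{u\in\mathcal{F}^{(s)}:u=0\text{ on }F\}$.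
   Context: All measure-theoretic statements refer to Lebesgue measure on $\mathbf{R}$. Functions in $H^1(\mathbf{R})$ are identified with their continuous (locally absolutely continuous) versions. Absolute continuity of $s$ on $\mathbf{R}$ means absolute continuity on compact intervals. The open set $G$ is a countable disjoint union of open intervals $I_n$; "a version of $u'$ is absolutely continuous on $G$" means that some a.e.-version of $u'$ is absolutely continuous on (compact subintervals of) each $I_n$. Let $\mathcal{F}=H^1(\mathbf{R})$, $\mathcal{E}(u,v)=\frac12\int_{\mathbf{R}}u'v'\,dx$ (the Dirichlet form of one-dimensional Brownian motion on $L^2(\mathbf{R})$) and, for $\alpha>0$, $\mathcal{E}_\alpha(u,v)=\mathcal{E}(u,v)+\alpha\int_{\mathbf{R}}uv\,dx$. Then $\mathcal{F}$ is a Hilbert space under $\mathcal{E}_\alpha$. The regular subspace of $(\mathcal{E},\mathcal{F})$ with scaling function $s$ has domain $$\mathcal{F}^{(s)}=\Big\{u\in L^2(\mathbf{R}):\ u\ll s,\ \int_{\mathbf{R}}\Big(\frac{du}{ds}\Big)^2ds<\infty\Big\},$$ where $u\ll s$ means that $u$ is absolutely continuous with respect to $s$, and form $\mathcal{E}^{(s)}(u,v)=\frac12\int_{\mathbf{R}}\frac{du}{ds}\frac{dv}{ds}\,ds$, which coincides with $\mathcal{E}$ on $\mathcal{F}^{(s)}$. $\mathcal{F}^{(s)}$ is a closed subspace of $(\mathcal{F},\mathcal{E}_\alpha)$. $\mathcal{G}^{(s)}_\alpha=\{u\in\mathcal{F}:\mathcal{E}_\alpha(u,v)=0\ \forall v\in\mathcal{F}^{(s)}\}$,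 so $\mathcal{F}=\mathcal{F}^{(s)}\oplus_{\mathcal{E}_\alpha}\mathcal{G}^{(s)}_\alpha$, and $P_{\mathcal{G}^{(s)}_\alpha}f$ denotes the $\mathcal{G}^{(s)}_\alpha$-component of $f\in\mathcal{F}$. $\mathcal{F}^{(s)}_G=\{u\in\mathcal{F}^{(s)}:u(x)=0\ \forall x\in F\}$ and $\mathcal{H}^{(s),\alpha}_F=\{u\in\mathcal{F}^{(s)}:\mathcal{E}_\alpha(u,v)=0\ \forall v\in\mathcal{F}^{(s)}_G\}$, so $\mathcal{F}^{(s)}=\mathcal{F}^{(s)}_G\oplus_{\mathcal{E}_\alpha}\mathcal{H}^{(s),\alpha}_F$. *)

theory Defs
  imports "HOL-Analysis.Analysis"
begin

text \<open>
  Elements of the function spaces below are genuine functions, namely the continuous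
  representatives; no quotient by almost-everywhere equality is taken.
\<close>

definition sq_integrable :: "real measure \<Rightarrow> (real \<Rightarrow> real) \<Rightarrow> bool" where
  "sq_integrable M u \<longleftrightarrow> u \<in> borel_measurable M \<and> integrable M (\<lambda>x. (u x)\<^sup>2)"

text \<open>
  The \<open>\<epsilon>\<close>-\<open>\<delta>\<close> definition of absolute continuity of \<open>u\<close> with respect to a nondecreasing \<open>s\<close> on
  the compact interval \<open>I\<close>. A division \<open>D\<close> is a finite set of nonempty, nonoverlapping compact
  intervals \<open>K = {Inf K..Sup K}\<close>. Ordinary absolute continuity is the case \<open>s x = x\<close>.
\<close>

definition ac_wrt_on :: "real set \<Rightarrow> (real \<Rightarrow> real) \<Rightarrow> (real \<Rightarrow> real) \<Rightarrow> bool" where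
  "ac_wrt_on I s u \<longleftrightarrow>
     (\<forall>\<epsilon>>0. \<exists>\<delta>>0. \<forall>D T. D division_of T \<and> T \<subseteq> I \<and> (\<Sum>K\<in>D. s (Sup K) - s (Inf K)) < \<delta>
        \<longrightarrow> (\<Sum>K\<in>D. \<bar>u (Sup K) - u (Inf K)\<bar>) < \<epsilon>)"

definition ac_wrt :: "(real \<Rightarrow> real) \<Rightarrow> (real \<Rightarrow> real) \<Rightarrow> bool" where
  "ac_wrt s u \<longleftrightarrow> (\<forall>a b. a \<le> b \<longrightarrow> ac_wrt_on {a..b} s u)"

definition locally_ac_on :: "real set \<Rightarrow> (real \<Rightarrow> real) \<Rightarrow> bool" where
  "locally_ac_on S u \<longleftrightarrow> (\<forall>a b. a \<le> b \<and> {a..b} \<subseteq> S \<longrightarrow> ac_wrt_on {a..b} (\<lambda>x. x) u)"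

text \<open>
  The space \<open>H\<^sup>1(\<real>)\<close>. Almost-everywhere differentiability already follows from local absolute
  continuity; it is spelled out because \<^term>\<open>deriv u x\<close> is an unspecified number at points
  where \<open>u\<close> is not differentiable.
\<close>

definition H1 :: "(real \<Rightarrow> real) set" where
  "H1 = {u. locally_ac_on UNIV u \<and> sq_integrable lebesgue u \<and>
            (AE x in lebesgue. u differentiable (at x)) \<and> sq_integrable lebesgue (deriv u)}"

definition dirichlet_form :: "(real \<Rightarrow> real) \<Rightarrow> (real \<Rightarrow> real) \<Rightarrow> real" where
  "dirichlet_form u v = (1/2) * (LINT x|lebesgue. deriv u x * deriv v x)"

definition dirichlet_form_alpha :: "real \<Rightarrow> (real \<Rightarrow> real) \<Rightarrow> (real \<Rightarrow> real) \<Rightarrow> real" where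
  "dirichlet_form_alpha \<alpha> u v = dirichlet_form u v + \<alpha> * (LINT x|lebesgue. u x * v x)"

text \<open>
  \<open>g\<close> is a version of \<open>du/ds\<close>: a density of \<open>du\<close> with respect to the Lebesgue-Stieltjes
  measure \<open>ds\<close>.
\<close>

definition is_stieltjes_deriv ::
    "(real \<Rightarrow> real) \<Rightarrow> (real \<Rightarrow> real) \<Rightarrow> (real \<Rightarrow> real) \<Rightarrow> bool" where
  "is_stieltjes_deriv s u g \<longleftrightarrow> g \<in> borel_measurable borel \<and>
     (\<forall>a b. a \<le> b \<longrightarrow> set_integrable (interval_measure s) {a<..b} g \<and>
        u b - u a = (LINT x:{a<..b}|interval_measure s. g x))"

definition regular_subspace :: "(real \<Rightarrow> real) \<Rightarrow> (real \<Rightarrow> real) set" where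
  "regular_subspace s = {u. sq_integrable lebesgue u \<and> ac_wrt s u \<and>
     (\<exists>g. is_stieltjes_deriv s u g \<and> sq_integrable (interval_measure s) g)}"

definition orth_compl_in ::
    "real \<Rightarrow> (real \<Rightarrow> real) set \<Rightarrow> (real \<Rightarrow> real) set \<Rightarrow> (real \<Rightarrow> real) set" where
  "orth_compl_in \<alpha> V U = {u \<in> V. \<forall>v\<in>U. dirichlet_form_alpha \<alpha> u v = 0}"

definition G_space :: "(real \<Rightarrow> real) \<Rightarrow> real \<Rightarrow> (real \<Rightarrow> real) set" where
  "G_space s \<alpha> = orth_compl_in \<alpha> H1 (regular_subspace s)"

text \<open>The \<open>G_space\<close>-component of \<open>f\<close> in the orthogonal sum of
  \<open>regular_subspace s\<close> and \<open>G_space s \<alpha>\<close>.\<close>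

definition G_proj :: "(real \<Rightarrow> real) \<Rightarrow> real \<Rightarrow> (real \<Rightarrow> real) \<Rightarrow> (real \<Rightarrow> real)" where
  "G_proj s \<alpha> f = (THE p. p \<in> G_space s \<alpha> \<and> (\<exists>v\<in>regular_subspace s. f = (\<lambda>x. v x + p x)))"

definition regular_subspace_vanishing ::
    "(real \<Rightarrow> real) \<Rightarrow> real set \<Rightarrow> (real \<Rightarrow> real) set" where
  "regular_subspace_vanishing s F = {u \<in> regular_subspace s. \<forall>x\<in>F. u x = 0}"

definition H_space :: "(real \<Rightarrow> real) \<Rightarrow> real \<Rightarrow> real set \<Rightarrow> (real \<Rightarrow> real) set" where
  "H_space s \<alpha> F = orth_compl_in \<alpha> (regular_subspace s) (regular_subspace_vanishing s F)"

text \<open>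
  In the next definition \<open>w\<close> is the absolutely continuous version of \<open>u'\<close> on \<open>G\<close>. A compact
  interval contained in the open set \<open>G\<close> lies in one of its component intervals, so
  \<^term>\<open>locally_ac_on G w\<close> is absolute continuity on compact subintervals of each component;
  \<open>z\<close> is the value \<open>u''(x)\<close>.
\<close>

definition is_solution ::
    "real \<Rightarrow> real set \<Rightarrow> (real \<Rightarrow> real) \<Rightarrow> (real \<Rightarrow> real) \<Rightarrow> bool" where
  "is_solution \<alpha> G f u \<longleftrightarrow> u \<in> H1 \<and>
     (\<exists>w. (AE x in lebesgue. x \<in> G \<longrightarrow> w x = deriv u x) \<and> locally_ac_on G w \<and>
          (AE x in lebesgue. x \<in> G \<longrightarrow>
             (\<exists>z. (w has_real_derivative z) (at x) \<and> (1/2) * z = \<alpha> * u x))) \<and>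
     (AE x in lebesgue. x \<in> - G \<longrightarrow> deriv u x = deriv f x)"

end

theory Submission
  imports Defs
begin

text \<open>
  Absolute continuity gives \<open>s b - s a = \<integral>\<^sub>a\<^sup>b 1\<^sub>G\<close>, so the measure \<open>ds\<close> is Lebesgue measure restricted to \<open>G\<close>.
  Hence a function with a square integrable density \<open>du/ds\<close> is a function of \<open>H\<^sup>1\<close> whose derivative
  vanishes almost everywhere off \<open>G\<close> (\<open>regular_subspace_eq\<close>). This subspace is closed, so every \<open>f\<close>
  splits as \<open>f = v + p\<close> with \<open>v\<close> in it and \<open>p\<close> orthogonal to it, and \<open>p\<close> is the only such component
  (\<open>G_proj\<close>); since \<open>v' = 0\<close> off \<open>G\<close>, \<open>p' = f'\<close> there.
  
  The core is that the differential equation on \<open>G\<close> is equivalent to orthogonality of \<open>u\<close> to all \<open>v\<close>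
  in the regular subspace that vanish on \<open>F\<close> (\<open>is_solution_iff_weak\<close>). From orthogonality to the
  equation: on an interval \<open>[a,b]\<close> inside \<open>G\<close> let \<open>U\<close> be an antiderivative of \<open>u\<close>. Integration by parts
  shows that \<open>u'/2 - \<alpha> U\<close> is orthogonal to every square integrable function of mean zero on \<open>[a,b]\<close>,
  in particular to itself minus its mean, so it is constant. From the equation to orthogonality: the
  \<open>C\<^sup>1\<close> version \<open>w\<close> of \<open>u'\<close> on \<open>G\<close> is uncontrolled near the boundary of \<open>G\<close>. Therefore \<open>v\<close> is replaced by a
  smooth truncation \<open>T(v)\<close> that vanishes wherever \<open>v\<close> is small. Then \<open>w T(v)\<close> is a primitive of
  \<open>2 \<alpha> u T(v) + u' T'(v) v'\<close> near every point: on \<open>G\<close> by the product rule, and near a point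
  of \<open>F\<close> because everything is zero. Both functions are integrable over the line, so the second has
  integral zero. Removing the truncation by dominated convergence uses that \<open>v' = 0\<close> almost everywhere
  on \<open>{v = 0}\<close>.
  
  With this equivalence the theorem is linear algebra: \<open>u = p + h\<close> satisfies \<open>u' = f'\<close> off \<open>G\<close> exactly
  if \<open>h' = 0\<close> off \<open>G\<close>, and, \<open>p\<close> being orthogonal to the whole regular subspace, \<open>u\<close> and \<open>h\<close> have the
  same form values against the functions vanishing on \<open>F\<close>.
  
  The tools from real analysis are proved with the gauge integral: the
  fundamental theorem for absolutely continuous functions (\<open>fundamental_theorem_ac\<close>) and the
  almost everywhere differentiability of primitives (\<open>primitive_has_derivative_AE\<close>). The orthogonal
  decomposition rests on the completeness of \<open>L\<^sup>2\<close> (\<open>L2_complete\<close>).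
\<close>

section \<open>The fundamental theorem for absolutely continuous functions\<close>

lemma AE_lebesgue_iff_negligible:
  "(AE x in lebesgue. P x) \<longleftrightarrow> negligible {x. \<not> P x}"
  by (simp add: eventually_ae_filter negligible_iff_null_sets completion.AE_iff_null_sets null_sets_completion_subset)
   (metis (mono_tags, lifting) completion.complete2 mem_Collect_eq subsetI)

lemma division_interval_real:
  fixes K :: "real set"
  assumes "D division_of T" "K \<in> D"
  obtains c d where "c \<le> d" "K = {c..d}" "Inf K = c" "Sup K = d" "{c..d} \<subseteq> T"
proof -
  obtain c d where K: "K = cbox c d" "K \<noteq> {}" "K \<subseteq> T"
    using division_ofD(2,3,4)[OF assms(1) assms(2)] by blast
  then have "c \<le> d" by auto
  with K show thesis by (intro that[of c d]) auto
qed

lemma sum_integral_division_le: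
  fixes h :: "real \<Rightarrow> real"
  assumes D: "D division_of T" "T \<subseteq> S" and h: "h integrable_on S" "\<And>x. 0 \<le> h x"
  shows "(\<Sum>K\<in>D. integral K h) \<le> integral S h"
proof -
  have hT: "h integrable_on T"
    using integrable_on_subdivision[OF D(1) h(1) D(2)] .
  have "(\<Sum>K\<in>D. integral K h) = integral T h"
    using integral_combine_division_topdown[OF hT D(1)] by simp
  also have "\<dots> \<le> integral S h"
    by (rule integral_subset_le[OF D(2) hT h(1)]) (use h in auto)
  finally show ?thesis .
qed

lemma sum_length_division_le_measure:
  assumes D: "D division_of T" and T: "T \<subseteq> U" and U: "U \<in> lmeasurable"
  shows "(\<Sum>K\<in>D. Sup K - Inf K) \<le> measure lebesgue (U :: real set)"
proof -
  have int: "(\<lambda>x. 1::real) integrable_on U"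
    using U by (simp add: lmeasurable_iff_integrable_on)
  have "(\<Sum>K\<in>D. Sup K - Inf K) = (\<Sum>K\<in>D. integral K (\<lambda>x. 1::real))"
  proof (rule sum.cong[OF refl])
    fix K assume "K \<in> D"
    then obtain c d where "c \<le> d" "K = {c..d}" "Inf K = c" "Sup K = d"
      using division_interval_real[OF D] by metis
    then show "Sup K - Inf K = integral K (\<lambda>x. 1::real)"
      by simp
  qed
  also have "\<dots> \<le> integral U (\<lambda>x. 1)"
    by (rule sum_integral_division_le[OF D T int]) auto
  also have "\<dots> = measure lebesgue U"
    using U by (simp add: lmeasure_integral)
  finally show ?thesis .
qed

text \<open>
  The gauge integral makes this direct. At a point of differentiability the increment of \<open>u\<close> over a
  short interval is \<open>g x\<close> times its length up to a small proportion of that length. The exceptional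
  null set lies in an open set of small measure, and if the gauge confines its tagged intervals to
  that set, absolute continuity bounds the total increment over them.
\<close>

lemma fundamental_theorem_ac:
  fixes u g :: "real \<Rightarrow> real"
  assumes ab: "a \<le> b" and ac: "ac_wrt_on {a..b} (\<lambda>x. x) u"
    and der: "AE x in lebesgue. x \<in> {a..b} \<longrightarrow> (u has_real_derivative g x) (at x)"
  shows "(g has_integral (u b - u a)) {a..b}"
proof -
  define N where "N = {x \<in> {a..b}. \<not> (u has_real_derivative g x) (at x)}"
  have negN: "negligible N"
    using der unfolding AE_lebesgue_iff_negligible N_def by (simp add: conj_commute)
  \<comment> \<open>Changing \<open>g\<close> on the null set \<open>N\<close> removes the terms \<open>g x * |K|\<close> with tag in \<open>N\<close>,
    on which there is no bound.\<close>
  define g' where "g' = (\<lambda>x. if x \<in> N then 0 else g x)"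
  have "(g' has_integral (u b - u a)) {a..b}"
    unfolding has_integral_real
  proof (intro allI impI)
    fix e :: real assume e: "e > 0"
    obtain \<delta> where \<delta>: "\<delta> > 0"
      "\<And>D T. D division_of T \<Longrightarrow> T \<subseteq> {a..b} \<Longrightarrow> (\<Sum>K\<in>D. Sup K - Inf K) < \<delta>
         \<Longrightarrow> (\<Sum>K\<in>D. \<bar>u (Sup K) - u (Inf K)\<bar>) < e / 2"
      using ac e unfolding ac_wrt_on_def by (metis half_gt_zero)
    obtain U where U: "open U" "N \<subseteq> U" "(U - N) \<in> lmeasurable" "emeasure lebesgue (U - N) < ennreal \<delta>"
      using sets_lebesgue_outer_open[of N \<delta>] negN \<delta>(1) negligible_imp_sets by blast
    have UN: "U = (U - N) \<union> N" using U by auto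
    have Um: "U \<in> lmeasurable"
      using U(3) negN UN by (metis fmeasurable.Un negligible_imp_measurable)
    have "measure lebesgue (U - N) < \<delta>"
      using U(3,4) \<delta>(1) by (simp add: emeasure_eq_measure2 ennreal_less_iff)
    moreover have "measure lebesgue U \<le> measure lebesgue (U - N) + measure lebesgue N"
      using UN measure_Un_le[of "U - N" lebesgue N] U(3) negN negligible_imp_sets
      by (metis fmeasurableD)
    ultimately have Ud: "measure lebesgue U < \<delta>"
      using negN by (simp add: negligible_imp_measure0)
    \<comment> \<open>Summed over a division of \<open>[a,b]\<close>, the errors \<open>e' * |K|\<close> amount to at most \<open>e/2\<close>.\<close>
    define e' where "e' = e / (2 * (b - a + 1))"
    have e': "e' > 0" "e' * (b - a) < e / 2"
      using e ab by (auto simp: e'_def field_simps)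
    have "\<exists>d>0. \<forall>y. \<bar>y - x\<bar> < d \<longrightarrow> \<bar>u y - u x - g x * (y - x)\<bar> \<le> e' * \<bar>y - x\<bar>"
      if "x \<in> {a..b} - N" for x
    proof -
      have "(u has_derivative (\<lambda>h. g x * h)) (at x)"
        using that by (simp add: N_def has_field_derivative_def)
      then show ?thesis
        using e'(1) unfolding has_derivative_at_alt by (auto simp: real_norm_def)
    qed
    then obtain d where d: "\<And>x. x \<in> {a..b} - N \<Longrightarrow> d x > 0 \<and> (\<forall>y. \<bar>y - x\<bar> < d x \<longrightarrow>
        \<bar>u y - u x - g x * (y - x)\<bar> \<le> e' * \<bar>y - x\<bar>)"
      by metis
    define \<gamma> where "\<gamma> = (\<lambda>x. if x \<in> N then U else if x \<in> {a..b} then ball x (d x) else UNIV)"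
    have gauge: "gauge \<gamma>"
      using U d by (auto simp: gauge_def \<gamma>_def)
    show "\<exists>\<gamma>. gauge \<gamma> \<and> (\<forall>\<D>. \<D> tagged_division_of {a..b} \<and> \<gamma> fine \<D> \<longrightarrow>
        norm ((\<Sum>(x,k)\<in>\<D>. measure lborel k *\<^sub>R g' x) - (u b - u a)) < e)"
    proof (intro exI[of _ \<gamma>] conjI gauge allI impI, elim conjE)
      fix p assume p: "p tagged_division_of {a..b}" and fine: "\<gamma> fine p"
      define E where "E = (\<lambda>(x,K). measure lborel K * g' x - (u (Sup K) - u (Inf K)))"
      define p1 where "p1 = {(x,K) \<in> p. x \<in> N}"
      define p2 where "p2 = {(x,K) \<in> p. x \<notin> N}"
      have fin: "finite p" using p by auto
      have part: "p1 tagged_partial_division_of {a..b}"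
        using p by (auto simp: p1_def tagged_division_of_def intro: tagged_partial_division_subset)
      have K: "\<exists>c d. c \<le> d \<and> K = {c..d} \<and> Inf K = c \<and> Sup K = d \<and> x \<in> {c..d} \<and> {c..d} \<subseteq> {a..b}" if xK: "(x,K) \<in> p" for x K
      proof -
        obtain c d where "K = cbox c d" "x \<in> K" "K \<subseteq> {a..b}"
          using tagged_division_ofD(2,3,4)[OF p xK] by blast
        then show ?thesis by (intro exI[of _ c] exI[of _ d]) auto
      qed
      have "(\<Sum>(x,k)\<in>p. measure lborel k *\<^sub>R g' x) - (u b - u a) = (\<Sum>z\<in>p. E z)"
        using additive_tagged_division_1[OF ab p, of u]
        by (simp add: E_def sum_subtractf case_prod_unfold)
      also have "\<dots> = (\<Sum>z\<in>p1. E z) + (\<Sum>z\<in>p2. E z)"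
      proof -
        have "p = p1 \<union> p2" "p1 \<inter> p2 = {}" by (auto simp: p1_def p2_def)
        then show ?thesis using fin by (simp add: sum.union_disjoint)
      qed
      finally have eq: "(\<Sum>(x,k)\<in>p. measure lborel k *\<^sub>R g' x) - (u b - u a) = (\<Sum>z\<in>p1. E z) + (\<Sum>z\<in>p2. E z)" .
      have "\<bar>\<Sum>z\<in>p2. E z\<bar> \<le> (\<Sum>z\<in>p2. e' * measure lborel (snd z))"
      proof (rule order_trans[OF sum_abs], rule sum_mono)
        fix z assume z: "z \<in> p2"
        obtain x K where xK: "z = (x,K)" by force
        then obtain c d' where c: "c \<le> d'" "K = {c..d'}" "Inf K = c" "Sup K = d'" "x \<in> {c..d'}" "{c..d'} \<subseteq> {a..b}"
          using K z unfolding p2_def by blast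
        have xN: "x \<in> {a..b} - N" using z xK c by (auto simp: p2_def)
        have "K \<subseteq> ball x (d x)"
          using fine z xK xN unfolding fine_def \<gamma>_def p2_def by fastforce
        then have "\<bar>c - x\<bar> < d x" "\<bar>d' - x\<bar> < d x"
          using c(1,2) by (auto simp: subset_iff dist_real_def abs_minus_commute)
        then have "\<bar>u c - u x - g x * (c - x)\<bar> \<le> e' * \<bar>c - x\<bar>"
          "\<bar>u d' - u x - g x * (d' - x)\<bar> \<le> e' * \<bar>d' - x\<bar>"
          using d[OF xN] by auto
        moreover have "E z = (u c - u x - g x * (c - x)) - (u d' - u x - g x * (d' - x))"
          using xK c xN by (simp add: E_def g'_def algebra_simps)
        ultimately have "\<bar>E z\<bar> \<le> e' * \<bar>c - x\<bar> + e' * \<bar>d' - x\<bar>" by linarith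
        also have "\<dots> = e' * measure lborel K" using c by (simp add: algebra_simps)
        finally show "\<bar>E z\<bar> \<le> e' * measure lborel (snd z)" using xK by simp
      qed
      also have "\<dots> \<le> (\<Sum>z\<in>p. e' * measure lborel (snd z))"
        by (rule sum_mono2[OF fin]) (use e' in \<open>auto simp: p2_def\<close>)
      also have "\<dots> = e' * (b - a)"
        using additive_content_tagged_division[of p a b] p ab
        by (simp add: sum_distrib_left[symmetric] case_prod_unfold)
      finally have 2: "\<bar>\<Sum>z\<in>p2. E z\<bar> < e / 2" using e' by linarith
      have "\<bar>\<Sum>z\<in>p1. E z\<bar> \<le> (\<Sum>z\<in>p1. (\<lambda>(x,K). \<bar>u (Sup K) - u (Inf K)\<bar>) z)"
        by (rule order_trans[OF sum_abs], rule sum_mono) (auto simp: E_def p1_def g'_def)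
      \<comment> \<open>Distinct tags may share a degenerate interval; such an interval contributes zero, so
        the sum over tagged intervals is a sum over intervals. The case distinction settles the
        empty interval, at which \<open>Sup\<close> and \<open>Inf\<close> are arbitrary.\<close>
      also have "\<dots> = (\<Sum>(x,K)\<in>p1. if K = {} then 0 else \<bar>u (Sup K) - u (Inf K)\<bar>)"
        by (rule sum.cong[OF refl]) (use tagged_partial_division_ofD(2)[OF part] in fastforce)
      also have "\<dots> = (\<Sum>K\<in>snd ` p1. if K = {} then 0 else \<bar>u (Sup K) - u (Inf K)\<bar>)"
        by (rule sum.over_tagged_division_lemma[OF tagged_partial_division_of_Union_self[OF part]])
           auto
      also have "\<dots> = (\<Sum>K\<in>snd ` p1. \<bar>u (Sup K) - u (Inf K)\<bar>)"
        by (rule sum.cong[OF refl]) (use tagged_partial_division_ofD(2)[OF part] in fastforce)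
      also have "\<dots> < e / 2"
      proof (rule \<delta>(2))
        show div: "(snd ` p1) division_of \<Union>(snd ` p1)"
          by (rule partial_division_of_tagged_division[OF part])
        show "\<Union>(snd ` p1) \<subseteq> {a..b}"
          using tagged_partial_division_ofD(3)[OF part] by fastforce
        have "\<Union>(snd ` p1) \<subseteq> U"
          using fine unfolding fine_def \<gamma>_def p1_def by fastforce
        then show "(\<Sum>K\<in>snd ` p1. Sup K - Inf K) < \<delta>"
          using sum_length_division_le_measure[OF div _ Um] Ud by fastforce
      qed
      finally have "\<bar>\<Sum>z\<in>p1. E z\<bar> < e / 2" .
      with 2 eq show "norm ((\<Sum>(x,k)\<in>p. measure lborel k *\<^sub>R g' x) - (u b - u a)) < e"
        by (simp only: real_norm_def)
    qed
  qed
  then show ?thesis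
    by (rule has_integral_spike[OF negN, rotated]) (simp add: g'_def)
qed

text \<open>
  The gauge integral is used because the fundamental theorem above and Henstock's lemma apply to it
  without an integrability assumption on \<open>g\<close>; for square integrable \<open>g\<close> it is the Lebesgue integral.
\<close>

definition primitive :: "(real \<Rightarrow> real) \<Rightarrow> (real \<Rightarrow> real) \<Rightarrow> bool" where
  "primitive u g \<longleftrightarrow> (\<forall>a b. a \<le> b \<longrightarrow> (g has_integral (u b - u a)) {a..b})"

text \<open>
  By the inequality of the means, \<open>|g| \<le> (\<eta>/2) g\<^sup>2 + 1\<^sub>S/(2\<eta>)\<close>. Summed over a division, the first term is
  at most \<open>\<eta>/2\<close> times the full integral of \<open>g\<^sup>2\<close>, whatever the division, and the second is the total
  increment of \<open>s\<close> divided by \<open>2\<eta>\<close>. With \<open>S\<close> the whole line this is ordinary absolute continuity.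
\<close>

lemma primitive_ac_wrt:
  fixes s u g :: "real \<Rightarrow> real"
  assumes s: "primitive s (indicator S)" and u: "primitive u g"
    and g0: "\<And>x. x \<notin> S \<Longrightarrow> g x = 0" and g2: "(\<lambda>x. (g x)\<^sup>2) integrable_on UNIV"
  shows "ac_wrt s u"
  unfolding ac_wrt_def ac_wrt_on_def
proof (intro allI impI)
  fix a b e :: real assume ab: "a \<le> b" and e: "e > 0"
  define C where "C = integral UNIV (\<lambda>x. (g x)\<^sup>2)"
  have C: "C \<ge> 0" unfolding C_def by (rule integral_nonneg[OF g2]) auto
  define \<eta> where "\<eta> = e / (C + 1)"
  have \<eta>: "\<eta> > 0" "\<eta> / 2 * C < e / 2"
    using e C by (auto simp: \<eta>_def field_simps)
  show "\<exists>\<delta>>0. \<forall>D T. D division_of T \<and> T \<subseteq> {a..b} \<and> (\<Sum>K\<in>D. s (Sup K) - s (Inf K)) < \<delta> \<longrightarrow>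
         (\<Sum>K\<in>D. \<bar>u (Sup K) - u (Inf K)\<bar>) < e"
  proof (intro exI[of _ "e * \<eta>"] conjI allI impI)
    show "e * \<eta> > 0" using e \<eta> by simp
    fix D T assume "D division_of T \<and> T \<subseteq> {a..b} \<and> (\<Sum>K\<in>D. s (Sup K) - s (Inf K)) < e * \<eta>"
    then have D: "D division_of T" and small: "(\<Sum>K\<in>D. s (Sup K) - s (Inf K)) < e * \<eta>"
      by auto
    have "(\<Sum>K\<in>D. \<bar>u (Sup K) - u (Inf K)\<bar>)
      \<le> (\<Sum>K\<in>D. \<eta> / 2 * integral K (\<lambda>x. (g x)\<^sup>2) + (s (Sup K) - s (Inf K)) / (2 * \<eta>))"
    proof (rule sum_mono)
      fix K assume "K \<in> D"
      then obtain c d where K: "c \<le> d" "K = {c..d}" "Inf K = c" "Sup K = d"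
        using division_interval_real[OF D] by metis
      have g2': "(\<lambda>x. (g x)\<^sup>2) integrable_on {c..d}"
        using integrable_on_subcbox[OF g2, of c d] by simp
      have "((\<lambda>x. \<eta> / 2 * (g x)\<^sup>2 + indicator S x / (2 * \<eta>)) has_integral
          (\<eta> / 2 * integral K (\<lambda>x. (g x)\<^sup>2) + (s d - s c) / (2 * \<eta>))) {c..d}"
        using s K(1) unfolding primitive_def K(2)
        by (intro has_integral_add has_integral_mult_right has_integral_divide
            integrable_integral[OF g2']) auto
      moreover have "(g has_integral (u d - u c)) {c..d}"
        using u K(1) by (auto simp: primitive_def)
      moreover have "\<bar>g x\<bar> \<le> \<eta> / 2 * (g x)\<^sup>2 + indicator S x / (2 * \<eta>)" for x
      proof (cases "x \<in> S")
        case True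
        have "0 \<le> (\<eta> * \<bar>g x\<bar> - 1)\<^sup>2" by simp
        then have "2 * \<eta> * \<bar>g x\<bar> \<le> \<eta>\<^sup>2 * (g x)\<^sup>2 + 1"
          by (simp add: power2_diff power_mult_distrib)
        then show ?thesis using True \<eta>(1) by (simp add: field_simps power2_eq_square)
      qed (use g0 in simp)
      ultimately show "\<bar>u (Sup K) - u (Inf K)\<bar>
         \<le> \<eta> / 2 * integral K (\<lambda>x. (g x)\<^sup>2) + (s (Sup K) - s (Inf K)) / (2 * \<eta>)"
        unfolding K(3,4)
        by (metis (no_types, lifting) has_integral_integrable integral_norm_bound_integral integral_unique real_norm_def)
    qed
    also have "\<dots> = \<eta> / 2 * (\<Sum>K\<in>D. integral K (\<lambda>x. (g x)\<^sup>2)) + (\<Sum>K\<in>D. s (Sup K) - s (Inf K)) / (2 * \<eta>)"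
      by (simp add: sum.distrib sum_distrib_left sum_divide_distrib)
    also have "\<dots> < e"
    proof -
      have "(\<Sum>K\<in>D. integral K (\<lambda>x. (g x)\<^sup>2)) \<le> C"
        unfolding C_def by (rule sum_integral_division_le[OF D _ g2]) auto
      then have "\<eta> / 2 * (\<Sum>K\<in>D. integral K (\<lambda>x. (g x)\<^sup>2)) \<le> \<eta> / 2 * C"
        using \<eta>(1) by (intro mult_left_mono) auto
      moreover have "(\<Sum>K\<in>D. s (Sup K) - s (Inf K)) / (2 * \<eta>) < e / 2"
        using small \<eta>(1) by (simp add: field_simps)
      ultimately show ?thesis using \<eta>(2) by linarith
    qed
    finally show "(\<Sum>K\<in>D. \<bar>u (Sup K) - u (Inf K)\<bar>) < e" .
  qed
qed

section \<open>Almost everywhere differentiability of primitives\<close>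

text \<open>
  Around a bad point there are arbitrarily short intervals on which the increment of \<open>u\<close> misses
  \<open>g x * |K|\<close> by more than \<open>\<kappa> |K|\<close>. The Vitali covering theorem selects disjoint ones that cover the
  bad points up to a null set. Henstock's lemma bounds the sum of these deviations over disjoint
  fine intervals by \<open>\<kappa> \<epsilon>\<close>, so the total length of the selected intervals is at most \<open>\<epsilon>\<close>.
\<close>

lemma negligible_primitive_bad_quotients:
  fixes u g :: "real \<Rightarrow> real"
  assumes u: "primitive u g" and ab: "a < b" and \<kappa>: "\<kappa> > 0"
  shows "negligible {x \<in> {a<..<b}. \<forall>d>0. \<exists>c e. c < e \<and> (x = c \<or> x = e) \<and> e - c < d \<and>
            \<bar>u e - u c - g x * (e - c)\<bar> > \<kappa> * (e - c)}" (is "negligible ?B")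
  unfolding negligible_outer_le
proof (intro allI impI)
  fix \<epsilon> :: real assume \<epsilon>: "\<epsilon> > 0"
  have int: "(g has_integral (u e - u c)) {c..e}" if "c \<le> e" for c e
    using u that by (auto simp: primitive_def)
  have "g integrable_on cbox a b"
    using int[of a b] ab by (auto intro: has_integral_integrable)
  note Henstock = Henstock_lemma[OF this mult_pos_pos[OF \<kappa> \<epsilon>]]
  obtain \<gamma> where \<gamma>: "gauge \<gamma>"
    "\<And>p. p tagged_partial_division_of (cbox a b) \<Longrightarrow> \<gamma> fine p \<Longrightarrow>
       (\<Sum>(x,k)\<in>p. norm (measure lborel k *\<^sub>R g x - integral k g)) < \<kappa> * \<epsilon>"
    by (rule Henstock) (rule that, assumption)
  define I where "I = {(x,c,e). c < e \<and> (x = c \<or> x = e) \<and> {c..e} \<subseteq> \<gamma> x \<and> {c..e} \<subseteq> {a..b} \<and>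
      \<bar>u e - u c - g x * (e - c)\<bar> > \<kappa> * (e - c)}"
  \<comment> \<open>The covering theorem speaks of balls: \<open>ctr\<close> and \<open>rad\<close> describe the interval \<open>J\<close> as one. The
    tag \<open>x\<close> is an end point of the interval, not its centre.\<close>
  define ctr :: "real \<times> real \<times> real \<Rightarrow> real" where "ctr = (\<lambda>(x,c,e). (c + e) / 2)"
  define rad :: "real \<times> real \<times> real \<Rightarrow> real" where "rad = (\<lambda>(x,c,e). (e - c) / 2)"
  define J :: "real \<times> real \<times> real \<Rightarrow> real set" where "J = (\<lambda>(x,c,e). {c..e})"
  have J: "cball (ctr i) (rad i) = J i" for i
    by (cases i) (simp add: ctr_def rad_def J_def cball_eq_atLeastAtMost field_simps)
  have cover: "\<exists>i. i \<in> I \<and> x \<in> cball (ctr i) (rad i) \<and> rad i < d" if x: "x \<in> ?B" and d: "d > 0" for x d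
  proof -
    have "open (\<gamma> x \<inter> {a<..<b})" "x \<in> \<gamma> x \<inter> {a<..<b}"
      using \<gamma>(1) x by (auto simp: gauge_def)
    then obtain r where r: "r > 0" "ball x r \<subseteq> \<gamma> x \<inter> {a<..<b}"
      by (meson openE)
    have "\<forall>d>0. \<exists>c e. c < e \<and> (x = c \<or> x = e) \<and> e - c < d \<and>
            \<bar>u e - u c - g x * (e - c)\<bar> > \<kappa> * (e - c)" using x by blast
    moreover have "min r d > 0" using r d by simp
    ultimately obtain c e where ce: "c < e" "x = c \<or> x = e" "e - c < min r d"
      "\<bar>u e - u c - g x * (e - c)\<bar> > \<kappa> * (e - c)"
      by blast
    have "{c..e} \<subseteq> ball x r"
      using ce(1-3) by (auto simp: dist_real_def)
    then have "{c..e} \<subseteq> \<gamma> x \<inter> {a<..<b}" using r(2) by (rule order_trans)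
    then have "{c..e} \<subseteq> \<gamma> x" "{c..e} \<subseteq> {a..b}" by auto
    then have "(x,c,e) \<in> I" using ce by (auto simp: I_def)
    moreover have "x \<in> J (x,c,e)" using ce by (auto simp: J_def)
    moreover have "rad (x,c,e) < d" using ce by (simp add: rad_def)
    ultimately show ?thesis using J by blast
  qed
  have rad: "0 < rad i" if "i \<in> I" for i
    using that by (auto simp: I_def rad_def)
  obtain C where C: "countable C" "C \<subseteq> I" "pairwise (\<lambda>i j. disjnt (J i) (J j)) C"
    "negligible (?B - (\<Union>i\<in>C. J i))"
    by (rule Vitali_covering_theorem_cballs[OF rad cover, unfolded J]) (assumption | rule that)+
  have bound: "measure lebesgue (\<Union>i\<in>C'. J i) \<le> \<epsilon>" if C': "C' \<subseteq> C" "finite C'" for C'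
  proof -
    define tag where "tag = (\<lambda>i. (fst i :: real, J i))"
    have mem: "\<exists>x c e. i = (x,c,e) \<and> c < e \<and> (x = c \<or> x = e) \<and> {c..e} \<subseteq> \<gamma> x \<and> {c..e} \<subseteq> {a..b} \<and>
      \<bar>u e - u c - g x * (e - c)\<bar> > \<kappa> * (e - c)" if "i \<in> C'" for i
    proof -
      have "i \<in> I" using that C'(1) C(2) by blast
      then show ?thesis by (cases i) (simp add: I_def)
    qed
    have disj: "J i \<inter> J j = {}" if "i \<in> C'" "j \<in> C'" "i \<noteq> j" for i j
      using that C'(1) C(3) unfolding pairwise_def disjnt_def by blast
    have ne: "J i \<noteq> {}" if "i \<in> C'" for i
      using mem[OF that] by (auto simp: J_def)
    have inj: "inj_on tag C'"
    proof (rule inj_onI, rule ccontr)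
      fix i j assume "i \<in> C'" "j \<in> C'" "tag i = tag j" "i \<noteq> j"
      then show False using disj[of i j] ne[of i] by (simp add: tag_def)
    qed
    have part: "tag ` C' tagged_partial_division_of cbox a b"
      unfolding tagged_partial_division_of_def
    proof (intro conjI allI impI)
      fix x K assume "(x, K) \<in> tag ` C'"
      then obtain i where i: "i \<in> C'" "(x,K) = tag i" by blast
      obtain y c e where "i = (y,c,e)" "c < e" "y = c \<or> y = e" "{c..e} \<subseteq> {a..b}"
        using mem[OF i(1)] by blast
      then show "x \<in> K" "K \<subseteq> cbox a b" "\<exists>a b. K = cbox a b"
        using i(2) by (auto simp: tag_def J_def)
    next
      fix x1 K1 x2 K2
      assume *: "(x1, K1) \<in> tag ` C' \<and> (x2, K2) \<in> tag ` C' \<and> (x1, K1) \<noteq> (x2, K2)"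
      from * obtain i where i: "i \<in> C'" "(x1,K1) = tag i" by blast
      from * obtain j where j: "j \<in> C'" "(x2,K2) = tag j" by blast
      from * i j have "i \<noteq> j" by auto
      then have "K1 \<inter> K2 = {}" using disj[of i j] i j by (simp add: tag_def)
      then show "interior K1 \<inter> interior K2 = {}" using interior_subset by blast
    qed (use C' in auto)
    have fine: "\<gamma> fine (tag ` C')"
      unfolding fine_def tag_def J_def using mem by fastforce
    have len: "\<kappa> * measure lebesgue (J i) \<le> norm (measure lborel (J i) *\<^sub>R g (fst i) - integral (J i) g)"
      if i: "i \<in> C'" for i
    proof -
      obtain x c e where *: "i = (x,c,e)" "c < e" "\<bar>u e - u c - g x * (e - c)\<bar> > \<kappa> * (e - c)"
        using mem[OF i] by blast
      have "integral {c..e} g = u e - u c" using int[of c e] *(2) by (simp add: integral_unique)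
      then show ?thesis using * by (simp add: J_def abs_minus_commute mult.commute)
    qed
    have Jm: "J i \<in> lmeasurable" for i by (simp add: J[symmetric])
    have "\<kappa> * measure lebesgue (\<Union>i\<in>C'. J i) \<le> \<kappa> * (\<Sum>i\<in>C'. measure lebesgue (J i))"
      using \<kappa> C' Jm by (intro mult_left_mono measure_UNION_le) (auto intro: fmeasurableD)
    also have "\<dots> \<le> (\<Sum>i\<in>C'. norm (measure lborel (J i) *\<^sub>R g (fst i) - integral (J i) g))"
      unfolding sum_distrib_left by (rule sum_mono[OF len])
    also have "\<dots> = (\<Sum>(x,k)\<in>tag ` C'. norm (measure lborel k *\<^sub>R g x - integral k g))"
      by (subst sum.reindex[OF inj]) (simp add: tag_def)
    also have "\<dots> < \<kappa> * \<epsilon>" by (rule \<gamma>(2)[OF part fine])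
    finally show ?thesis using \<kappa> by simp
  qed
  have Jm: "J i \<in> lmeasurable" for i by (simp add: J[symmetric])
  have UM: "(\<Union>i\<in>C. J i) \<in> lmeasurable" "measure lebesgue (\<Union>i\<in>C. J i) \<le> \<epsilon>"
    using fmeasurable_UN_bound[OF C(1) Jm bound] measure_UN_bound[OF C(1) Jm bound] by auto
  show "\<exists>T. ?B \<subseteq> T \<and> T \<in> lmeasurable \<and> measure lebesgue T \<le> \<epsilon>"
  proof (intro exI[of _ "(\<Union>i\<in>C. J i) \<union> (?B - (\<Union>i\<in>C. J i))"] conjI)
    show "(\<Union>i\<in>C. J i) \<union> (?B - (\<Union>i\<in>C. J i)) \<in> lmeasurable"
      using UM(1) C(4) negligible_imp_measurable by blast
    show "measure lebesgue ((\<Union>i\<in>C. J i) \<union> (?B - (\<Union>i\<in>C. J i))) \<le> \<epsilon>"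
      using UM C(4) measure_Un_le[of "\<Union>i\<in>C. J i" lebesgue "?B - (\<Union>i\<in>C. J i)"]
        negligible_imp_measurable[OF C(4)] negligible_imp_measure0[OF C(4)]
      by (simp add: fmeasurableD)
  qed blast
qed

text \<open>
  This is Lebesgue's differentiation theorem on the line: a point at which some difference quotient
  fails to converge to \<open>g x\<close> is bad for some tolerance \<open>1 / (k + 1)\<close>, and each of these bad sets is null.
\<close>

proposition primitive_has_derivative_AE:
  assumes u: "primitive u g"
  shows "AE x in lebesgue. (u has_real_derivative g x) (at x)"
proof -
  define B where "B = (\<lambda>m k. {x \<in> {- real (Suc m)<..<real (Suc m)}. \<forall>d>0. \<exists>c e. c < e \<and> (x = c \<or> x = e) \<and>
     e - c < d \<and> \<bar>u e - u c - g x * (e - c)\<bar> > inverse (real (Suc k)) * (e - c)})"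
  have "negligible (B m k)" for m k
    unfolding B_def by (rule negligible_primitive_bad_quotients[OF u]) auto
  then have neg: "negligible (\<Union>m k. B m k)"
    by (intro negligible_countable_Union) auto
  have "(u has_real_derivative g x) (at x)" if x: "x \<notin> (\<Union>m k. B m k)" for x
    unfolding has_field_derivative_def has_derivative_at_alt
  proof (intro conjI bounded_linear_mult_right, intro allI impI)
    fix \<epsilon> :: real assume "\<epsilon> > 0"
    then obtain k where k: "inverse (real (Suc k)) < \<epsilon>" using reals_Archimedean by blast
    obtain m where m: "\<bar>x\<bar> < real (Suc m)" by (meson reals_Archimedean2 less_trans of_nat_less_iff lessI)
    have "x \<notin> B m k" using x by blast
    then have "\<exists>d>0. \<forall>c e. c < e \<longrightarrow> x = c \<or> x = e \<longrightarrow> e - c < d \<longrightarrow>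
        \<bar>u e - u c - g x * (e - c)\<bar> \<le> inverse (real (Suc k)) * (e - c)"
      using m unfolding B_def mem_Collect_eq greaterThanLessThan_iff not_less[symmetric]
      by (smt (verit, best))
    then obtain d where d: "d > 0" "\<And>c e. c < e \<Longrightarrow> x = c \<or> x = e \<Longrightarrow> e - c < d \<Longrightarrow>
        \<bar>u e - u c - g x * (e - c)\<bar> \<le> inverse (real (Suc k)) * (e - c)"
      by blast
    have "\<bar>u y - u x - g x * (y - x)\<bar> \<le> \<epsilon> * \<bar>y - x\<bar>" if y: "\<bar>y - x\<bar> < d" for y
    proof -
      have "\<bar>u y - u x - g x * (y - x)\<bar> \<le> inverse (real (Suc k)) * \<bar>y - x\<bar>"
      proof (cases x y rule: linorder_cases)
        case less then show ?thesis using d(2)[of x y] y by simp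
      next
        case greater
        have "u y - u x - g x * (y - x) = - (u x - u y - g x * (x - y))" by (simp add: algebra_simps)
        moreover have "\<bar>y - x\<bar> = x - y" using greater by simp
        ultimately show ?thesis using d(2)[of y x] y greater by (simp only: abs_minus_cancel simp_thms)
      qed simp
      also have "\<dots> \<le> \<epsilon> * \<bar>y - x\<bar>" using k by (intro mult_right_mono) auto
      finally show ?thesis .
    qed
    then show "\<exists>d>0. \<forall>y. norm (y - x) < d \<longrightarrow> norm (u y - u x - g x * (y - x)) \<le> \<epsilon> * norm (y - x)"
      using d(1) by auto
  qed
  then show ?thesis
    unfolding AE_lebesgue_iff_negligible by (intro negligible_subset[OF neg]) blast
qed

section \<open>Square integrable functions and primitives\<close>

lemma sq_integrable_measurable [measurable_dest]:
  "sq_integrable M u \<Longrightarrow> u \<in> borel_measurable M"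
  by (simp add: sq_integrable_def)

lemma sq_integrable_mult:
  assumes u: "sq_integrable M u" and v: "sq_integrable M v"
  shows "integrable M (\<lambda>x. u x * v x)"
proof (rule Bochner_Integration.integrable_bound)
  show "integrable M (\<lambda>x. (u x)\<^sup>2 + (v x)\<^sup>2)"
    using u v by (simp add: sq_integrable_def)
  show "(\<lambda>x. u x * v x) \<in> borel_measurable M"
    using u v by measurable
  have "\<bar>p * q\<bar> \<le> p\<^sup>2 + q\<^sup>2" for p q :: real
  proof -
    have "2 * (\<bar>p\<bar> * \<bar>q\<bar>) \<le> p\<^sup>2 + q\<^sup>2" "0 \<le> \<bar>p\<bar> * \<bar>q\<bar>"
      using sum_squares_bound[of "\<bar>p\<bar>" "\<bar>q\<bar>"] by (auto simp: mult.assoc)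
    then show ?thesis unfolding abs_mult by linarith
  qed
  then show "AE x in M. norm (u x * v x) \<le> norm ((u x)\<^sup>2 + (v x)\<^sup>2)"
    by (auto intro!: AE_I2)
qed

lemma sq_integrable_add_scale:
  assumes u: "sq_integrable M u" and v: "sq_integrable M v"
  shows "sq_integrable M (\<lambda>x. u x + c * v x)"
proof -
  have "integrable M (\<lambda>x. (u x)\<^sup>2 + 2 * c * (u x * v x) + c\<^sup>2 * (v x)\<^sup>2)"
    using u v sq_integrable_mult[OF u v]
    by (intro Bochner_Integration.integrable_add integrable_mult_right) (auto simp: sq_integrable_def)
  moreover have "(\<lambda>x. (u x)\<^sup>2 + 2 * c * (u x * v x) + c\<^sup>2 * (v x)\<^sup>2) = (\<lambda>x. (u x + c * v x)\<^sup>2)"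
    by (rule ext) (simp add: power2_eq_square algebra_simps)
  moreover have "(\<lambda>x. u x + c * v x) \<in> borel_measurable M"
    using u v by measurable
  ultimately show ?thesis by (simp add: sq_integrable_def)
qed

lemma sq_integrable_bound:
  assumes "sq_integrable M u" "v \<in> borel_measurable M" "\<And>x. \<bar>v x\<bar> \<le> \<bar>u x\<bar>"
  shows "sq_integrable M v"
  unfolding sq_integrable_def
proof
  show "integrable M (\<lambda>x. (v x)\<^sup>2)"
    by (rule Bochner_Integration.integrable_bound[of M "\<lambda>x. (u x)\<^sup>2"])
       (use assms in \<open>auto simp: sq_integrable_def abs_le_square_iff intro!: AE_I2\<close>)
qed fact

lemma sq_integrable_cong_AE:
  assumes "sq_integrable lebesgue (u :: real \<Rightarrow> real)" "AE x in lebesgue. u x = v x"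
  shows "sq_integrable lebesgue v"
proof -
  have v: "v \<in> borel_measurable lebesgue"
    using assms borel_measurable_AE[of u v] by (simp add: sq_integrable_def)
  moreover have "integrable lebesgue (\<lambda>x. (v x)\<^sup>2)"
    by (rule integrable_cong_AE_imp[of _ "\<lambda>x. (u x)\<^sup>2"]) (use assms v in \<open>auto simp: sq_integrable_def\<close>)
  ultimately show ?thesis by (simp add: sq_integrable_def)
qed

lemma sq_integrable_indicator_interval:
  "sq_integrable lebesgue (indicator {a..b::real} :: real \<Rightarrow> real)"
proof -
  have "(\<lambda>x. (indicator {a..b} x :: real)\<^sup>2) = indicator {a..b}"
    by (auto simp: indicator_def)
  moreover have "{a..b} \<in> sets lebesgue" by simp
  ultimately show ?thesis
    by (simp add: sq_integrable_def integrable_indicator_iff emeasure_lborel_Icc_eq borel_measurable_indicator)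
qed

lemma sq_integrable_imp_absolutely_integrable:
  assumes "sq_integrable lebesgue g"
  shows "g absolutely_integrable_on {a..b::real}"
  using sq_integrable_mult[OF sq_integrable_indicator_interval assms, of a b]
  by (simp add: set_integrable_def)

lemma sq_integrable_has_integral:
  assumes "sq_integrable lebesgue g"
  shows "(g has_integral (LINT x:{a..b::real}|lebesgue. g x)) {a..b}"
  by (rule has_integral_set_lebesgue[OF sq_integrable_imp_absolutely_integrable[OF assms]])

lemma primitive_iff_lebesgue_integral:
  assumes "sq_integrable lebesgue g"
  shows "primitive u g \<longleftrightarrow> (\<forall>a b. a \<le> b \<longrightarrow> u b - u a = (LINT x:{a..b}|lebesgue. g x))"
proof -
  have "(g has_integral (u b - u a)) {a..b} \<longleftrightarrow> u b - u a = (LINT x:{a..b}|lebesgue. g x)" for a b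
  proof
    assume "(g has_integral (u b - u a)) {a..b}"
    then show "u b - u a = (LINT x:{a..b}|lebesgue. g x)"
      by (rule has_integral_unique) (rule sq_integrable_has_integral[OF assms])
  qed (simp add: sq_integrable_has_integral[OF assms])
  then show ?thesis by (simp add: primitive_def)
qed

lemma primitive_cong_AE:
  assumes "primitive u g" "AE x in lebesgue. g x = h x"
  shows "primitive u h"
  unfolding primitive_def
proof (intro allI impI)
  fix a b :: real assume "a \<le> b"
  then have "(g has_integral (u b - u a)) {a..b}" using assms by (simp add: primitive_def)
  moreover have "negligible {x. g x \<noteq> h x}"
    using assms(2) by (simp add: AE_lebesgue_iff_negligible)
  ultimately show "(h has_integral (u b - u a)) {a..b}"
    by (rule has_integral_spike[rotated 2]) simp
qed

lemma primitive_add_scale: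
  assumes "primitive u g" "primitive v h"
  shows "primitive (\<lambda>x. u x + c * v x) (\<lambda>x. g x + c * h x)"
  unfolding primitive_def
proof (intro allI impI)
  fix a b :: real assume "a \<le> b"
  then have "((\<lambda>x. g x + c * h x) has_integral ((u b - u a) + c * (v b - v a))) {a..b}"
    using assms by (intro has_integral_add has_integral_mult_right) (auto simp: primitive_def)
  then show "((\<lambda>x. g x + c * h x) has_integral (u b + c * v b - (u a + c * v a))) {a..b}"
    by (simp add: algebra_simps)
qed

section \<open>The Sobolev space and its energy form\<close>

lemma H1_D:
  assumes "u \<in> H1"
  shows "sq_integrable lebesgue u" "sq_integrable lebesgue (deriv u)"
    and "AE x in lebesgue. (u has_real_derivative deriv u x) (at x)"
    and "primitive u (deriv u)"
    and "\<And>a b. a \<le> b \<Longrightarrow> ac_wrt_on {a..b} (\<lambda>x. x) u"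
proof -
  show "sq_integrable lebesgue u" "sq_integrable lebesgue (deriv u)"
    using assms by (auto simp: H1_def)
  show AE: "AE x in lebesgue. (u has_real_derivative deriv u x) (at x)"
    using assms by (auto simp: H1_def DERIV_deriv_iff_real_differentiable)
  show ac: "\<And>a b. a \<le> b \<Longrightarrow> ac_wrt_on {a..b} (\<lambda>x. x) u"
    using assms by (auto simp: H1_def locally_ac_on_def)
  show "primitive u (deriv u)"
    unfolding primitive_def using AE by (intro allI impI fundamental_theorem_ac ac) auto
qed

lemma primitive_locally_ac:
  assumes u: "primitive u g" and g: "sq_integrable lebesgue g"
  shows "locally_ac_on UNIV u"
proof -
  have "primitive (\<lambda>x. x) (indicator UNIV)"
    unfolding primitive_def
  proof (intro allI impI)
    fix a b :: real assume "a \<le> b"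
    then show "(indicator UNIV has_integral (b - a)) {a..b}"
      using has_integral_const_real[of "1::real" a b] by simp
  qed
  moreover have "(\<lambda>x. (g x)\<^sup>2) integrable_on UNIV"
    using g by (auto simp: sq_integrable_def intro: integrable_on_lebesgue)
  ultimately have "ac_wrt (\<lambda>x. x) u"
    using u by (intro primitive_ac_wrt[where S = UNIV and g = g]) auto
  then show ?thesis by (auto simp: ac_wrt_def locally_ac_on_def)
qed

text \<open>
  Together with \<open>H1_D\<close> this describes \<open>H\<^sup>1\<close> as the square integrable functions with a square integrable
  density. Differentiability almost everywhere comes from Lebesgue's theorem.
\<close>

lemma H1_I:
  assumes u: "sq_integrable lebesgue u" and g: "sq_integrable lebesgue g" and ug: "primitive u g"
  shows "u \<in> H1" "AE x in lebesgue. deriv u x = g x"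
proof -
  have AE: "AE x in lebesgue. (u has_real_derivative g x) (at x)"
    by (rule primitive_has_derivative_AE[OF ug])
  then show der: "AE x in lebesgue. deriv u x = g x"
    by eventually_elim (rule DERIV_imp_deriv)
  have "sq_integrable lebesgue (deriv u)"
    by (rule sq_integrable_cong_AE[OF g]) (use der in eventually_elim, simp)
  moreover have "AE x in lebesgue. u differentiable (at x)"
    using AE by eventually_elim (auto simp: real_differentiable_def)
  ultimately show "u \<in> H1"
    using u primitive_locally_ac[OF ug g] by (simp add: H1_def)
qed

lemma primitive_continuous:
  assumes "primitive u g"
  shows "continuous_on UNIV u"
proof -
  have "isCont u x" for x
  proof -
    have "g integrable_on {x - 1..x + 1}"
      using assms[unfolded primitive_def, rule_format, of "x - 1" "x + 1"]
      by (simp add: has_integral_integrable)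
    then have "continuous_on {x - 1..x + 1} (\<lambda>y. u (x - 1) + integral {x - 1..y} g)"
      by (intro continuous_intros indefinite_integral_continuous_1)
    moreover have "u (x - 1) + integral {x - 1..y} g = u y" if "y \<in> {x - 1..x + 1}" for y
      using assms[unfolded primitive_def, rule_format, of "x - 1" y] that by (simp add: integral_unique)
    ultimately have "continuous_on {x - 1..x + 1} u"
      by (rule continuous_on_eq)
    then show ?thesis
      by (rule continuous_on_interior) simp
  qed
  then show ?thesis by (simp add: continuous_at_imp_continuous_on)
qed

lemma H1_add_scale:
  assumes u: "u \<in> H1" and v: "v \<in> H1"
  shows "(\<lambda>x. u x + c * v x) \<in> H1"
    and "AE x in lebesgue. deriv (\<lambda>x. u x + c * v x) x = deriv u x + c * deriv v x"
proof -
  have "sq_integrable lebesgue (\<lambda>x. u x + c * v x)" "sq_integrable lebesgue (\<lambda>x. deriv u x + c * deriv v x)"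
    "primitive (\<lambda>x. u x + c * v x) (\<lambda>x. deriv u x + c * deriv v x)"
    by (intro sq_integrable_add_scale primitive_add_scale H1_D u v)+
  from H1_I[OF this] show "(\<lambda>x. u x + c * v x) \<in> H1"
    "AE x in lebesgue. deriv (\<lambda>x. u x + c * v x) x = deriv u x + c * deriv v x" .
qed

lemma dirichlet_form_alpha_commute:
  "dirichlet_form_alpha \<alpha> u v = dirichlet_form_alpha \<alpha> v u"
  by (simp add: dirichlet_form_alpha_def dirichlet_form_def mult.commute)

lemma dirichlet_form_alpha_add_scale:
  assumes u: "u \<in> H1" and v: "v \<in> H1" and w: "w \<in> H1"
  shows "dirichlet_form_alpha \<alpha> (\<lambda>x. u x + c * v x) w = dirichlet_form_alpha \<alpha> u w + c * dirichlet_form_alpha \<alpha> v w"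
proof -
  note uv = H1_add_scale[OF u v, of c]
  note [simp] = sq_integrable_mult[OF H1_D(1)[OF u] H1_D(1)[OF w]] sq_integrable_mult[OF H1_D(2)[OF u] H1_D(2)[OF w]]
    sq_integrable_mult[OF H1_D(1)[OF v] H1_D(1)[OF w]] sq_integrable_mult[OF H1_D(2)[OF v] H1_D(2)[OF w]]
  have "(LINT x|lebesgue. deriv (\<lambda>x. u x + c * v x) x * deriv w x)
      = (LINT x|lebesgue. deriv u x * deriv w x + c * (deriv v x * deriv w x))"
  proof (rule integral_cong_AE)
    note [measurable] = sq_integrable_measurable[OF H1_D(2)[OF uv(1)]] sq_integrable_measurable[OF H1_D(2)[OF u]]
      sq_integrable_measurable[OF H1_D(2)[OF v]] sq_integrable_measurable[OF H1_D(2)[OF w]]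
    show "(\<lambda>x. deriv (\<lambda>x. u x + c * v x) x * deriv w x) \<in> borel_measurable lebesgue"
      by measurable
    show "(\<lambda>x. deriv u x * deriv w x + c * (deriv v x * deriv w x)) \<in> borel_measurable lebesgue"
      by measurable
    show "AE x in lebesgue. deriv (\<lambda>x. u x + c * v x) x * deriv w x = deriv u x * deriv w x + c * (deriv v x * deriv w x)"
      using uv(2) by eventually_elim (simp add: algebra_simps)
  qed
  moreover have "(\<lambda>x. (u x + c * v x) * w x) = (\<lambda>x. u x * w x + c * (v x * w x))"
    by (simp add: algebra_simps)
  ultimately show ?thesis
    by (simp add: dirichlet_form_alpha_def dirichlet_form_def algebra_simps)
qed

lemma L2_norms_le_form:
  assumes u: "u \<in> H1" and \<alpha>: "\<alpha> > 0"
  shows "0 \<le> dirichlet_form_alpha \<alpha> u u"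
    and "(LINT x|lebesgue. (deriv u x)\<^sup>2) \<le> 2 * dirichlet_form_alpha \<alpha> u u"
    and "(LINT x|lebesgue. (u x)\<^sup>2) \<le> dirichlet_form_alpha \<alpha> u u / \<alpha>"
proof -
  have eq: "dirichlet_form_alpha \<alpha> u u = (LINT x|lebesgue. (deriv u x)\<^sup>2) / 2 + \<alpha> * (LINT x|lebesgue. (u x)\<^sup>2)"
    by (simp add: dirichlet_form_alpha_def dirichlet_form_def power2_eq_square)
  have nn: "0 \<le> (LINT x|lebesgue. (deriv u x)\<^sup>2)" "0 \<le> (LINT x|lebesgue. (u x)\<^sup>2)"
    by (auto intro!: integral_nonneg_AE)
  show "0 \<le> dirichlet_form_alpha \<alpha> u u" using eq nn \<alpha> by simp
  show "(LINT x|lebesgue. (deriv u x)\<^sup>2) \<le> 2 * dirichlet_form_alpha \<alpha> u u"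
    using eq nn \<alpha> by simp
  show "(LINT x|lebesgue. (u x)\<^sup>2) \<le> dirichlet_form_alpha \<alpha> u u / \<alpha>"
  proof -
    have "(LINT x|lebesgue. (u x)\<^sup>2) * \<alpha> \<le> dirichlet_form_alpha \<alpha> u u"
      using eq nn by (simp add: mult.commute)
    then show ?thesis using \<alpha> by (simp add: pos_le_divide_eq)
  qed
qed

text \<open>
  The elements of \<open>H\<^sup>1\<close> are continuous functions and not classes, so a vanishing norm forces the value
  zero at every point. This makes orthogonal components unique as functions.
\<close>

lemma H1_eq_zero_of_form_zero:
  assumes u: "u \<in> H1" and \<alpha>: "\<alpha> > 0" and z: "dirichlet_form_alpha \<alpha> u u = 0"
  shows "u x = 0"
proof -
  have "(LINT x|lebesgue. (u x)\<^sup>2) = 0"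
    using L2_norms_le_form(3)[OF u \<alpha>] z by (simp add: integral_nonneg_AE order_antisym)
  then have "AE x in lebesgue. (u x)\<^sup>2 = 0"
    using H1_D(1)[OF u] by (subst (asm) integral_nonneg_eq_0_iff_AE) (auto simp: sq_integrable_def)
  then have "negligible {x. u x \<noteq> 0}"
    unfolding AE_lebesgue_iff_negligible by simp
  moreover have "open {x. u x \<noteq> 0}"
    using primitive_continuous[OF H1_D(4)[OF u]] by (intro open_Collect_neq) auto
  ultimately show ?thesis using open_not_negligible by auto
qed

section \<open>The regular subspace of a singular scale\<close>

lemma emeasure_primitive_indicator_Ioc:
  assumes s: "primitive s (indicator G)" and G: "open G" and ab: "a \<le> b"
  shows "emeasure lborel (G \<inter> {a<..b}) = ennreal (s b - s a)"
proof -
  have [measurable]: "G \<in> sets borel" using G by auto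
  have I: "((\<lambda>x. if x \<in> G then 1::real else 0) has_integral (s b - s a)) {a..b}"
  proof -
    have "indicat_real G = (\<lambda>x. if x \<in> G then 1 else 0)" by (auto simp: indicator_def)
    then show ?thesis using s ab by (simp add: primitive_def)
  qed
  then have 1: "((\<lambda>x. 1::real) has_integral (s b - s a)) (G \<inter> {a..b})"
    by (simp add: has_integral_restrict_Int)
  have "((\<lambda>x. 1::real) has_integral (s b - s a)) (G \<inter> {a<..b})"
  proof (rule has_integral_spike_set_eq[THEN iffD1, OF _ _ 1])
    show "negligible {x \<in> G \<inter> {a..b} - G \<inter> {a<..b}. (1::real) \<noteq> 0}"
      by (rule negligible_subset[of "{a}"]) auto
    have "{x \<in> G \<inter> {a<..b} - G \<inter> {a..b}. (1::real) \<noteq> 0} = {}" by auto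
    then show "negligible {x \<in> G \<inter> {a<..b} - G \<inter> {a..b}. (1::real) \<noteq> 0}"
      by (simp only: negligible_empty)
  qed
  moreover have "0 \<le> s b - s a"
    by (rule has_integral_nonneg[OF I]) auto
  ultimately show ?thesis
    by (subst (asm) has_integral_iff_emeasure_lborel) auto
qed

text \<open>
  The Lebesgue-Stieltjes measure of the scale \<open>s\<close> is Lebesgue measure restricted to \<open>G\<close>: both sides give
  \<open>{a<..b}\<close> the mass \<open>s b - s a\<close>.
\<close>

lemma interval_measure_primitive_indicator:
  assumes s: "primitive s (indicator G)" and G: "open G" and mono: "mono s"
  shows "interval_measure s = density lborel (\<lambda>x. ennreal (indicator G x))"
proof -
  have [measurable]: "G \<in> sets borel" using G by auto
  have cont: "continuous (at_right a) s" for a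
    using primitive_continuous[OF s]
    by (simp add: continuous_on_eq_continuous_at continuous_at_imp_continuous_within)
  have IM: "emeasure (interval_measure s) {a<..b} = emeasure lborel (G \<inter> {a<..b})" for a b
  proof (cases "a \<le> b")
    case True
    then show ?thesis
      using emeasure_primitive_indicator_Ioc[OF s G True] cont mono
      by (simp add: emeasure_interval_measure_Ioc monoD)
  qed simp
  have DM: "emeasure (density lborel (\<lambda>x. ennreal (indicator G x))) {a<..b} = emeasure lborel (G \<inter> {a<..b})" for a b
    by (simp add: emeasure_density ennreal_indicator indicator_inter_arith[symmetric])
  show ?thesis
  proof (rule measure_eqI_generator_eq[where \<Omega> = UNIV and A = "\<lambda>i. {- real i<..real i}"
      and E = "range (\<lambda>(a, b). {a<..b::real})"])
    show "Int_stable (range (\<lambda>(a, b). {a<..b::real}))"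
      by (auto simp: Int_stable_def)
    show "(\<Union>i. {- real i<..real i}) = UNIV"
    proof -
      have "\<exists>i. x \<in> {- real i<..real i}" for x
      proof -
        obtain i :: nat where "\<bar>x\<bar> < real i" using reals_Archimedean2 by blast
        then show ?thesis by (intro exI[of _ i]) auto
      qed
      then show ?thesis by blast
    qed
    show "emeasure (interval_measure s) {- real i<..real i} \<noteq> \<infinity>" for i
      using emeasure_primitive_indicator_Ioc[OF s G, of "- real i" "real i"] IM by simp
    show "emeasure (interval_measure s) X = emeasure (density lborel (\<lambda>x. ennreal (indicator G x))) X"
      if "X \<in> range (\<lambda>(a, b). {a<..b::real})" for X
      using that IM DM by auto
  qed (auto simp: borel_sigma_sets_Ioc)
qed

text \<open>
  A version \<open>g\<close> of \<open>du/ds\<close> corresponds to the ordinary density \<open>1\<^sub>G g\<close> of \<open>u\<close>. In the converse direction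
  \<open>g\<close> has to be Borel measurable, while \<open>deriv u\<close> is only Lebesgue measurable; hence the passage to a
  Borel version.
\<close>

lemma regular_subspace_eq:
  assumes s: "primitive s (indicator G)" and G: "open G" and mono: "mono s"
  shows "regular_subspace s = {u \<in> H1. AE x in lebesgue. x \<notin> G \<longrightarrow> deriv u x = 0}"
proof -
  note M = interval_measure_primitive_indicator[OF assms]
  have [measurable]: "G \<in> sets borel" using G by auto
  have set_iff: "set_integrable (interval_measure s) {a<..b} g \<longleftrightarrow> set_integrable lborel {a<..b} (\<lambda>x. indicator G x * g x)"
    and set_eq: "(LINT x:{a<..b}|interval_measure s. g x) = (LINT x:{a<..b}|lborel. indicator G x * g x)"
    if [measurable]: "g \<in> borel_measurable borel" for g :: "real \<Rightarrow> real" and a b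
    unfolding set_integrable_def set_lebesgue_integral_def M
    by (simp_all add: integrable_density integral_density mult.left_commute)
  have sq_iff: "sq_integrable (interval_measure s) g \<longleftrightarrow> sq_integrable lebesgue (\<lambda>x. indicator G x * g x)"
    if [measurable]: "g \<in> borel_measurable borel" for g :: "real \<Rightarrow> real"
  proof -
    have "(\<lambda>x. (indicator G x * g x)\<^sup>2) = (\<lambda>x. indicator G x * (g x)\<^sup>2)"
      by (auto simp: indicator_def)
    moreover have "integrable (interval_measure s) (\<lambda>x. (g x)\<^sup>2) \<longleftrightarrow> integrable lborel (\<lambda>x. indicator G x * (g x)\<^sup>2)"
      unfolding M by (simp add: integrable_density)
    moreover have "g \<in> borel_measurable (interval_measure s)" by simp
    moreover have "(\<lambda>x. indicator G x * g x) \<in> borel_measurable lebesgue"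
      by (intro measurable_completion) measurable
    moreover have "(\<lambda>x. indicator G x * (g x)\<^sup>2) \<in> borel_measurable lborel" by measurable
    ultimately show ?thesis
      by (simp add: sq_integrable_def integrable_completion)
  qed
  have int_eq: "(LINT x:{a<..b}|lborel. h x) = (LINT x:{a..b}|lebesgue. h x)"
    if [measurable]: "h \<in> borel_measurable borel" for h :: "real \<Rightarrow> real" and a b
  proof -
    have "(LINT x:{a<..b}|lborel. h x) = (LINT x:{a..b}|lborel. h x)"
      unfolding set_lebesgue_integral_def
    proof (rule integral_cong_AE)
      show "AE x in lborel. indicator {a<..b} x *\<^sub>R h x = indicator {a..b} x *\<^sub>R h x"
        using AE_lborel_singleton[of a] by eventually_elim (auto simp: indicator_def)
    qed measurable
    then show ?thesis
      unfolding set_lebesgue_integral_def by (simp add: integral_completion)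
  qed
  show ?thesis
  proof (intro set_eqI iffI)
    fix u assume "u \<in> regular_subspace s"
    then obtain g where u: "sq_integrable lebesgue u" and g: "is_stieltjes_deriv s u g" "sq_integrable (interval_measure s) g"
      by (auto simp: regular_subspace_def)
    have gm [measurable]: "g \<in> borel_measurable borel" using g by (simp add: is_stieltjes_deriv_def)
    define h where "h = (\<lambda>x. indicator G x * g x)"
    have h: "sq_integrable lebesgue h" using g(2) sq_iff[OF gm] by (simp add: h_def)
    have hm [measurable]: "h \<in> borel_measurable borel" unfolding h_def by measurable
    have "primitive u h"
      unfolding primitive_iff_lebesgue_integral[OF h]
      using g(1) set_eq[OF gm] int_eq[OF hm] by (simp add: is_stieltjes_deriv_def h_def)
    note H = H1_I[OF u h this]
    have "AE x in lebesgue. x \<notin> G \<longrightarrow> deriv u x = 0"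
      using H(2) by eventually_elim (simp add: h_def)
    with H(1) show "u \<in> {u \<in> H1. AE x in lebesgue. x \<notin> G \<longrightarrow> deriv u x = 0}" by simp
  next
    fix u assume "u \<in> {u \<in> H1. AE x in lebesgue. x \<notin> G \<longrightarrow> deriv u x = 0}"
    then have u: "u \<in> H1" and z: "AE x in lebesgue. x \<notin> G \<longrightarrow> deriv u x = 0" by auto
    obtain g where g: "g \<in> borel_measurable lborel" "AE x in lborel. deriv u x = g x"
      using completion_ex_borel_measurable_real[OF sq_integrable_measurable[OF H1_D(2)[OF u]]] by blast
    have gm [measurable]: "g \<in> borel_measurable borel" using g by simp
    define h where "h = (\<lambda>x. indicator G x * g x)"
    have hm [measurable]: "h \<in> borel_measurable borel" unfolding h_def by measurable
    have eq: "AE x in lebesgue. deriv u x = h x"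
      using AE_completion[OF g(2)] z by eventually_elim (auto simp: h_def indicator_def)
    have h: "sq_integrable lebesgue h"
      by (rule sq_integrable_cong_AE[OF H1_D(2)[OF u] eq])
    have uh: "primitive u h" by (rule primitive_cong_AE[OF H1_D(4)[OF u] eq])
    have ac: "ac_wrt s u"
    proof (rule primitive_ac_wrt[OF s uh])
      show "(\<lambda>x. (h x)\<^sup>2) integrable_on UNIV"
        using h by (auto simp: sq_integrable_def intro: integrable_on_lebesgue)
    qed (simp add: h_def)
    have hint: "set_integrable lborel {a<..b} h" for a b
    proof -
      have "integrable lebesgue (\<lambda>x. indicator {a..b} x * h x)"
        using sq_integrable_mult[OF sq_integrable_indicator_interval h] .
      then have "integrable lborel (\<lambda>x. indicator {a..b} x * h x)"
        by (simp add: integrable_completion)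
      then have "set_integrable lborel {a..b} h" by (simp add: set_integrable_def)
      then show ?thesis by (rule set_integrable_subset) auto
    qed
    have "\<forall>a b. a \<le> b \<longrightarrow> u b - u a = (LINT x:{a..b}|lebesgue. h x)"
      using uh primitive_iff_lebesgue_integral[OF h] by blast
    then have "is_stieltjes_deriv s u g"
      unfolding is_stieltjes_deriv_def set_iff[OF gm] set_eq[OF gm]
      using hint int_eq[OF hm] unfolding h_def by simp
    moreover have "sq_integrable (interval_measure s) g"
      using h sq_iff[OF gm] by (simp add: h_def)
    ultimately show "u \<in> regular_subspace s"
      using H1_D(1)[OF u] ac by (auto simp: regular_subspace_def)
  qed
qed

section \<open>Completeness and weak convergence in mean square\<close>

text \<open>
  The weighted sum \<open>\<Sum>k. 2\<^sup>k (f\<^sub>k\<^sub>+\<^sub>1 - f\<^sub>k)\<^sup>2\<close> has a finite integral, hence finite values almost everywhere.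
  Since \<open>|d| \<le> 2\<^sup>k d\<^sup>2 + 2\<^sup>-\<^sup>k\<close>, the increments are then absolutely summable.
\<close>

lemma fast_L2_Cauchy_imp_AE_convergent:
  fixes f :: "nat \<Rightarrow> real \<Rightarrow> real"
  assumes f: "\<And>n. sq_integrable M (f n)"
    and small: "\<And>k. (LINT x|M. (f (Suc k) x - f k x)\<^sup>2) \<le> (1/4) ^ k"
  shows "AE x in M. convergent (\<lambda>k. f k x)"
proof -
  note [measurable] = sq_integrable_measurable[OF f]
  define D where "D = (\<lambda>k x. 2 ^ k * (f (Suc k) x - f k x)\<^sup>2)"
  have int: "integrable M (\<lambda>x. (f (Suc k) x - f k x)\<^sup>2)" for k
    using sq_integrable_add_scale[OF f f, of "Suc k" "-1" k] by (simp add: sq_integrable_def)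
  have [measurable]: "D k \<in> borel_measurable M" for k
    unfolding D_def by measurable
  have "(\<integral>\<^sup>+x. ennreal (D k x) \<partial>M) \<le> ennreal ((1/2) ^ k)" for k
  proof -
    have "(\<integral>\<^sup>+x. ennreal (D k x) \<partial>M) = ennreal (LINT x|M. D k x)"
      by (rule nn_integral_eq_integral) (auto simp: D_def int)
    also have "(LINT x|M. D k x) \<le> 2 ^ k * (1/4) ^ k"
      using small[of k] by (simp add: D_def)
    also have "2 ^ k * (1/4) ^ k = (1/2 :: real) ^ k"
      by (simp add: power_mult_distrib[symmetric])
    finally show ?thesis by (simp add: ennreal_leI)
  qed
  then have "(\<integral>\<^sup>+x. (\<Sum>k. ennreal (D k x)) \<partial>M) \<le> (\<Sum>k. ennreal ((1/2) ^ k))"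
    by (subst nn_integral_suminf) (auto intro!: suminf_le)
  also have "\<dots> = ennreal (\<Sum>k. (1/2) ^ k)"
    by (rule suminf_ennreal2) (auto intro: summable_geometric)
  also have "\<dots> < \<infinity>" by simp
  finally have "AE x in M. (\<Sum>k. ennreal (D k x)) \<noteq> \<infinity>"
    by (intro nn_integral_PInf_AE) auto
  then show ?thesis
  proof eventually_elim
    case (elim x)
    have "summable (\<lambda>k. D k x)"
      by (rule summable_suminf_not_top) (use elim in \<open>auto simp: D_def\<close>)
    then have sum: "summable (\<lambda>k. D k x + (1/2) ^ k)"
      by (intro summable_add summable_geometric) auto
    have "norm (f (Suc k) x - f k x) \<le> D k x + (1/2) ^ k" for k
    proof -
      define p q where "p = \<bar>f (Suc k) x - f k x\<bar>" and "q = (2::real) ^ k"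
      have q: "q > 0" by (simp add: q_def)
      have "0 \<le> (q * p - 1)\<^sup>2" by simp
      then have "2 * q * p \<le> q\<^sup>2 * p\<^sup>2 + 1" by (simp add: power2_diff power_mult_distrib)
      moreover have "0 \<le> q * p" using q by (simp add: p_def)
      ultimately have "q * p \<le> q\<^sup>2 * p\<^sup>2 + 1" by linarith
      then have "p \<le> q * p\<^sup>2 + 1 / q"
        using q by (simp add: field_simps power2_eq_square)
      then show ?thesis by (simp add: D_def p_def q_def power_divide)
    qed
    then have "summable (\<lambda>k. f (Suc k) x - f k x)"
      by (intro summable_comparison_test'[OF sum]) auto
    then have "convergent (\<lambda>n. \<Sum>k<n. f (Suc k) x - f k x)"
      by (simp add: summable_iff_convergent)
    then have "convergent (\<lambda>n. f n x - f 0 x)"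
      by (simp add: sum_lessThan_telescope[of "\<lambda>k. f k x"])
    then have "convergent (\<lambda>n. (f n x - f 0 x) + f 0 x)"
      by (intro convergent_add convergent_const)
    then show ?case by simp
  qed
qed

text \<open>
  A rapidly converging subsequence has an almost everywhere limit, and Fatou's lemma turns the Cauchy
  condition into convergence to it. The subsequence is part of the conclusion because the
  pointwise limit is needed to identify the limit in \<open>H\<^sup>1\<close>.
\<close>

lemma L2_complete:
  fixes f :: "nat \<Rightarrow> real \<Rightarrow> real"
  assumes f: "\<And>n. sq_integrable M (f n)"
    and Cauchy: "\<And>e. e > 0 \<Longrightarrow> \<exists>N. \<forall>m\<ge>N. \<forall>n\<ge>N. (LINT x|M. (f m x - f n x)\<^sup>2) < e"
  obtains g r where "sq_integrable M g" "strict_mono r" "AE x in M. (\<lambda>k. f (r k) x) \<longlonglongrightarrow> g x"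
    "(\<lambda>n. LINT x|M. (f n x - g x)\<^sup>2) \<longlonglongrightarrow> 0"
proof -
  note [measurable] = sq_integrable_measurable[OF f]
  have "\<forall>k. \<exists>N. \<forall>m\<ge>N. \<forall>n\<ge>N. (LINT x|M. (f m x - f n x)\<^sup>2) < (1/4) ^ k"
    using Cauchy by simp
  then obtain N where N: "\<And>k m n. m \<ge> N k \<Longrightarrow> n \<ge> N k \<Longrightarrow> (LINT x|M. (f m x - f n x)\<^sup>2) < (1/4) ^ k"
    by metis
  \<comment> \<open>The partial sums of \<open>N + 1\<close> are strictly increasing and dominate \<open>N\<close>.\<close>
  define r where "r = (\<lambda>k. \<Sum>i\<le>k. Suc (N i))"
  have r: "strict_mono r" by (simp add: r_def strict_mono_Suc_iff)
  have rN: "N k \<le> r k" for k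
    by (cases k) (auto simp: r_def)
  have "(LINT x|M. (f (r (Suc k)) x - f (r k) x)\<^sup>2) \<le> (1/4) ^ k" for k
    by (rule less_imp_le, rule N)
       (use rN[of k] strict_mono_less[OF r, of k "Suc k"] in auto)
  then have AEc: "AE x in M. convergent (\<lambda>k. f (r k) x)"
    by (intro fast_L2_Cauchy_imp_AE_convergent) (auto intro: f)
  define g where "g = (\<lambda>x. lim (\<lambda>k. f (r k) x))"
  have gm [measurable]: "g \<in> borel_measurable M"
    unfolding g_def by measurable
  have AEg: "AE x in M. (\<lambda>k. f (r k) x) \<longlonglongrightarrow> g x"
    using AEc unfolding g_def by eventually_elim (rule convergent_LIMSEQ_iff[THEN iffD1])
  have intd: "integrable M (\<lambda>x. (f n x - f m x)\<^sup>2)" for n m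
    using sq_integrable_add_scale[OF f f, of n "-1" m] by (simp add: sq_integrable_def)
  have fatou: "(\<integral>\<^sup>+x. ennreal ((f n x - g x)\<^sup>2) \<partial>M) \<le> ennreal e"
    if Ne: "\<And>m. m \<ge> K \<Longrightarrow> (LINT x|M. (f n x - f m x)\<^sup>2) < e" for n K e
  proof -
    have "(\<integral>\<^sup>+x. ennreal ((f n x - g x)\<^sup>2) \<partial>M) = (\<integral>\<^sup>+x. liminf (\<lambda>k. ennreal ((f n x - f (r k) x)\<^sup>2)) \<partial>M)"
    proof (rule nn_integral_cong_AE)
      show "AE x in M. ennreal ((f n x - g x)\<^sup>2) = liminf (\<lambda>k. ennreal ((f n x - f (r k) x)\<^sup>2))"
        using AEg
      proof eventually_elim
        case (elim x)
        have "(\<lambda>k. ennreal ((f n x - f (r k) x)\<^sup>2)) \<longlonglongrightarrow> ennreal ((f n x - g x)\<^sup>2)"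
          by (intro tendsto_intros tendsto_ennrealI elim)
        then show ?case by (rule lim_imp_Liminf[OF trivial_limit_sequentially, symmetric])
      qed
    qed
    also have "\<dots> \<le> liminf (\<lambda>k. \<integral>\<^sup>+x. ennreal ((f n x - f (r k) x)\<^sup>2) \<partial>M)"
      by (rule nn_integral_liminf) measurable
    also have "\<dots> \<le> ennreal e"
    proof (rule Liminf_le)
      show "\<forall>\<^sub>F k in sequentially. (\<integral>\<^sup>+x. ennreal ((f n x - f (r k) x)\<^sup>2) \<partial>M) \<le> ennreal e"
        using eventually_ge_at_top[of K]
      proof eventually_elim
        case (elim k)
        have "r k \<ge> K" using elim seq_suble[OF r, of k] by simp
        have "(\<integral>\<^sup>+x. ennreal ((f n x - f (r k) x)\<^sup>2) \<partial>M) = ennreal (LINT x|M. (f n x - f (r k) x)\<^sup>2)"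
          by (rule nn_integral_eq_integral[OF intd]) auto
        also have "\<dots> \<le> ennreal e" using Ne[OF \<open>r k \<ge> K\<close>] by (intro ennreal_leI) simp
        finally show ?case .
      qed
    qed simp
    finally show ?thesis .
  qed
  have int: "integrable M (\<lambda>x. (f n x - g x)\<^sup>2)" and le: "(LINT x|M. (f n x - g x)\<^sup>2) \<le> e"
    if Ne: "\<And>m. m \<ge> K \<Longrightarrow> (LINT x|M. (f n x - f m x)\<^sup>2) < e" and e: "e > 0" for n K e
  proof -
    have "(\<integral>\<^sup>+x. ennreal ((f n x - g x)\<^sup>2) \<partial>M) < \<infinity>"
      using le_less_trans[OF fatou[OF Ne] ennreal_less_top] by simp
    then show I: "integrable M (\<lambda>x. (f n x - g x)\<^sup>2)"
      unfolding integrable_iff_bounded by simp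
    have "ennreal (LINT x|M. (f n x - g x)\<^sup>2) = (\<integral>\<^sup>+x. ennreal ((f n x - g x)\<^sup>2) \<partial>M)"
      by (rule nn_integral_eq_integral[symmetric, OF I]) auto
    also have "\<dots> \<le> ennreal e" by (rule fatou[OF Ne])
    finally show "(LINT x|M. (f n x - g x)\<^sup>2) \<le> e"
      using e by (simp add: ennreal_le_iff)
  qed
  have lim: "(\<lambda>n. LINT x|M. (f n x - g x)\<^sup>2) \<longlonglongrightarrow> 0"
  proof (rule LIMSEQ_I)
    fix e :: real assume e: "e > 0"
    obtain K where K: "\<And>m n. m \<ge> K \<Longrightarrow> n \<ge> K \<Longrightarrow> (LINT x|M. (f m x - f n x)\<^sup>2) < e / 2"
      using Cauchy[of "e / 2"] e by auto
    have "norm ((LINT x|M. (f n x - g x)\<^sup>2) - 0) < e" if "n \<ge> K" for n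
    proof -
      have "(LINT x|M. (f n x - g x)\<^sup>2) \<le> e / 2"
        using le[of K n "e / 2"] K that e by auto
      moreover have "0 \<le> (LINT x|M. (f n x - g x)\<^sup>2)" by (rule integral_nonneg_AE) auto
      ultimately show ?thesis using e by simp
    qed
    then show "\<exists>no. \<forall>n\<ge>no. norm ((LINT x|M. (f n x - g x)\<^sup>2) - 0) < e" by blast
  qed
  obtain K where K: "\<And>m n. m \<ge> K \<Longrightarrow> n \<ge> K \<Longrightarrow> (LINT x|M. (f m x - f n x)\<^sup>2) < 1"
    using Cauchy[of 1] by auto
  have "integrable M (\<lambda>x. (f K x - g x)\<^sup>2)"
    by (rule int[of K K 1]) (use K in auto)
  then have "sq_integrable M (\<lambda>x. f K x - g x)"
    by (simp add: sq_integrable_def)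
  from sq_integrable_add_scale[OF f this, of K "-1"]
  have "sq_integrable M g" by simp
  from that[OF this r AEg lim] show thesis .
qed

text \<open>
  The polynomial is evaluated at \<open>t = b / (q + 1)\<close>. Taking \<open>q + 1\<close> instead of the sharp \<open>q\<close> covers \<open>q = 0\<close> as
  well, and the bound still tends to zero with \<open>c\<close>.
\<close>

lemma weak_discriminant:
  fixes b c q :: real
  assumes "\<And>t. 0 \<le> c - 2 * t * b + t\<^sup>2 * q" and "q \<ge> 0"
  shows "b\<^sup>2 \<le> c * (q + 1)"
proof -
  define t where "t = b / (q + 1)"
  have q: "q + 1 > 0" using assms by simp
  have tb: "t * (q + 1) = b" using q by (simp add: t_def)
  have "0 \<le> c - 2 * t * b + t\<^sup>2 * q" by (rule assms)
  also have "\<dots> \<le> c - 2 * t * b + t\<^sup>2 * (q + 1)" by (simp add: algebra_simps)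
  also have "\<dots> = c - t * b" using tb by (simp add: power2_eq_square mult.assoc)
  finally have "t * b \<le> c" by simp
  then have "t * b * (q + 1) \<le> c * (q + 1)" using q by (intro mult_right_mono) auto
  moreover have "t * b * (q + 1) = b\<^sup>2" using tb by (simp add: power2_eq_square mult.commute mult.left_commute)
  ultimately show ?thesis by simp
qed

lemma tendsto_zero_of_square_le:
  fixes b c :: "nat \<Rightarrow> real"
  assumes le: "\<And>n. (b n)\<^sup>2 \<le> c n" and c: "c \<longlonglongrightarrow> 0"
  shows "b \<longlonglongrightarrow> 0"
proof -
  have "(\<lambda>n. (b n)\<^sup>2) \<longlonglongrightarrow> 0"
  proof (rule tendsto_sandwich[OF _ _ tendsto_const c])
    show "\<forall>\<^sub>F n in sequentially. 0 \<le> (b n)\<^sup>2" by simp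
    show "\<forall>\<^sub>F n in sequentially. (b n)\<^sup>2 \<le> c n" using le by simp
  qed
  then show ?thesis by simp
qed

text \<open>
  The bound on \<open>b\<^sup>2\<close> is the Cauchy-Schwarz inequality with \<open>q + 1\<close> in place of \<open>q\<close>.
\<close>

lemma sq_integrable_weak_convergence:
  fixes f :: "nat \<Rightarrow> real \<Rightarrow> real"
  assumes f: "\<And>n. sq_integrable M (f n)" and g: "sq_integrable M g" and u: "sq_integrable M u"
    and lim: "(\<lambda>n. LINT x|M. (f n x - g x)\<^sup>2) \<longlonglongrightarrow> 0"
  shows "(\<lambda>n. LINT x|M. u x * f n x) \<longlonglongrightarrow> (LINT x|M. u x * g x)"
proof -
  define q where "q = (LINT x|M. (u x)\<^sup>2)"
  define c where "c = (\<lambda>n. LINT x|M. (f n x - g x)\<^sup>2)"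
  define b where "b = (\<lambda>n. LINT x|M. u x * (f n x - g x))"
  have d: "sq_integrable M (\<lambda>x. f n x - g x)" for n
    using sq_integrable_add_scale[OF f g, of n "-1"] by simp
  have q: "q \<ge> 0" unfolding q_def by (rule integral_nonneg_AE) auto
  have le: "(b n)\<^sup>2 \<le> c n * (q + 1)" for n
  proof (rule weak_discriminant[OF _ q])
    fix t :: real
    have "0 \<le> (LINT x|M. ((f n x - g x) - t * u x)\<^sup>2)" by (rule integral_nonneg_AE) auto
    also have "(\<lambda>x. ((f n x - g x) - t * u x)\<^sup>2) = (\<lambda>x. ((f n x - g x)\<^sup>2 - 2 * t * (u x * (f n x - g x))) + t\<^sup>2 * (u x)\<^sup>2)"
      by (rule ext) (simp add: power2_eq_square algebra_simps)
    also have "(LINT x|M. ((f n x - g x)\<^sup>2 - 2 * t * (u x * (f n x - g x))) + t\<^sup>2 * (u x)\<^sup>2)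
       = c n - 2 * t * b n + t\<^sup>2 * q"
    proof -
      have I: "integrable M (\<lambda>x. (f n x - g x)\<^sup>2)" "integrable M (\<lambda>x. (u x)\<^sup>2)"
        using d u by (auto simp: sq_integrable_def)
      have J: "integrable M (\<lambda>x. 2 * t * (u x * (f n x - g x)))"
        using sq_integrable_mult[OF u d] by (rule integrable_mult_right)
      have "(LINT x|M. ((f n x - g x)\<^sup>2 - 2 * t * (u x * (f n x - g x))) + t\<^sup>2 * (u x)\<^sup>2)
        = (LINT x|M. (f n x - g x)\<^sup>2) - (LINT x|M. 2 * t * (u x * (f n x - g x))) + (LINT x|M. t\<^sup>2 * (u x)\<^sup>2)"
        using I J by (subst Bochner_Integration.integral_add)
          (auto intro!: Bochner_Integration.integrable_diff Bochner_Integration.integral_diff)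
      then show ?thesis by (simp add: q_def c_def b_def)
    qed
    finally show "0 \<le> c n - 2 * t * b n + t\<^sup>2 * q" .
  qed
  have "(\<lambda>n. c n * (q + 1)) \<longlonglongrightarrow> 0"
    using tendsto_mult_right[OF lim, of "q + 1"] by (simp add: c_def)
  with le have "b \<longlonglongrightarrow> 0" by (rule tendsto_zero_of_square_le)
  moreover have "b = (\<lambda>n. (LINT x|M. u x * f n x) - (LINT x|M. u x * g x))"
    unfolding b_def right_diff_distrib
    by (rule ext, rule Bochner_Integration.integral_diff[OF sq_integrable_mult[OF u f] sq_integrable_mult[OF u g]])
  ultimately show ?thesis by (simp add: LIM_zero_iff)
qed

section \<open>Orthogonal projection in the Sobolev space\<close>

lemma form_add_scale_square:
  assumes u: "u \<in> H1" and v: "v \<in> H1"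
  shows "dirichlet_form_alpha \<alpha> (\<lambda>x. u x + c * v x) (\<lambda>x. u x + c * v x)
    = dirichlet_form_alpha \<alpha> u u + 2 * c * dirichlet_form_alpha \<alpha> u v + c\<^sup>2 * dirichlet_form_alpha \<alpha> v v"
proof -
  let ?w = "\<lambda>x. u x + c * v x"
  note w = H1_add_scale(1)[OF u v, of c]
  have "dirichlet_form_alpha \<alpha> ?w ?w = dirichlet_form_alpha \<alpha> u ?w + c * dirichlet_form_alpha \<alpha> v ?w"
    by (rule dirichlet_form_alpha_add_scale[OF u v w])
  also have "dirichlet_form_alpha \<alpha> u ?w = dirichlet_form_alpha \<alpha> u u + c * dirichlet_form_alpha \<alpha> v u"
    by (subst dirichlet_form_alpha_commute) (rule dirichlet_form_alpha_add_scale[OF u v u])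
  also have "dirichlet_form_alpha \<alpha> v ?w = dirichlet_form_alpha \<alpha> u v + c * dirichlet_form_alpha \<alpha> v v"
    by (subst dirichlet_form_alpha_commute) (rule dirichlet_form_alpha_add_scale[OF u v v])
  finally show ?thesis
    by (simp add: dirichlet_form_alpha_commute[of \<alpha> v u] algebra_simps power2_eq_square)
qed

text \<open>
  Functions and derivatives converge in mean square. Along a subsequence the functions converge at
  some point \<open>x0\<close>, and increments converge because they are integrals of the derivatives; so
  the subsequence converges everywhere, to a primitive of the limit of the derivatives.
\<close>

lemma H1_complete:
  assumes v: "\<And>n. v n \<in> H1" and \<alpha>: "\<alpha> > 0"
    and Cauchy: "\<And>e. e > 0 \<Longrightarrow> \<exists>N. \<forall>m\<ge>N. \<forall>n\<ge>N.
      dirichlet_form_alpha \<alpha> (\<lambda>x. v m x + (-1) * v n x) (\<lambda>x. v m x + (-1) * v n x) < e"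
  obtains w where "w \<in> H1" "(\<lambda>n. LINT x|lebesgue. (v n x - w x)\<^sup>2) \<longlonglongrightarrow> 0"
    "(\<lambda>n. LINT x|lebesgue. (deriv (v n) x - deriv w x)\<^sup>2) \<longlonglongrightarrow> 0"
proof -
  define Q where "Q = (\<lambda>m n. dirichlet_form_alpha \<alpha> (\<lambda>x. v m x + (-1) * v n x) (\<lambda>x. v m x + (-1) * v n x))"
  note [measurable] = sq_integrable_measurable[OF H1_D(2)[OF v]] sq_integrable_measurable[OF H1_D(1)[OF v]]
  have le1: "(LINT x|lebesgue. (v m x - v n x)\<^sup>2) \<le> Q m n / \<alpha>" for m n
    using L2_norms_le_form(3)[OF H1_add_scale(1)[OF v v] \<alpha>, of m "-1" n] by (simp add: Q_def)
  have le2: "(LINT x|lebesgue. (deriv (v m) x - deriv (v n) x)\<^sup>2) \<le> 2 * Q m n" for m n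
  proof -
    note H = H1_add_scale[OF v[of m] v[of n], of "-1"]
    note [measurable] = sq_integrable_measurable[OF H1_D(2)[OF H(1)]]
    have "(LINT x|lebesgue. (deriv (v m) x - deriv (v n) x)\<^sup>2)
      = (LINT x|lebesgue. (deriv (\<lambda>x. v m x + (-1) * v n x) x)\<^sup>2)"
    proof (rule integral_cong_AE)
      show "AE x in lebesgue. (deriv (v m) x - deriv (v n) x)\<^sup>2 = (deriv (\<lambda>x. v m x + (-1) * v n x) x)\<^sup>2"
        using H(2) by eventually_elim simp
    qed measurable
    then show ?thesis
      using L2_norms_le_form(2)[OF H(1) \<alpha>] by (simp add: Q_def)
  qed
  have C1: "\<exists>N. \<forall>m\<ge>N. \<forall>n\<ge>N. (LINT x|lebesgue. (v m x - v n x)\<^sup>2) < e" if "e > 0" for e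
  proof -
    have "e * \<alpha> > 0" using that \<alpha> by simp
    from Cauchy[OF this] obtain N where N: "\<forall>m\<ge>N. \<forall>n\<ge>N. Q m n < e * \<alpha>"
      unfolding Q_def by blast
    have "(LINT x|lebesgue. (v m x - v n x)\<^sup>2) < e" if "m \<ge> N" "n \<ge> N" for m n
    proof -
      have "Q m n / \<alpha> < e" using N that \<alpha> by (simp add: pos_divide_less_eq)
      with le1[of m n] show ?thesis by linarith
    qed
    then show ?thesis by blast
  qed
  have C2: "\<exists>N. \<forall>m\<ge>N. \<forall>n\<ge>N. (LINT x|lebesgue. (deriv (v m) x - deriv (v n) x)\<^sup>2) < e" if "e > 0" for e
  proof -
    have "e / 2 > 0" using that by simp
    from Cauchy[OF this] obtain N where N: "\<forall>m\<ge>N. \<forall>n\<ge>N. Q m n < e / 2"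
      unfolding Q_def by blast
    have "(LINT x|lebesgue. (deriv (v m) x - deriv (v n) x)\<^sup>2) < e" if "m \<ge> N" "n \<ge> N" for m n
    proof -
      have "Q m n < e / 2" using N that by simp
      with le2[of m n] show ?thesis by linarith
    qed
    then show ?thesis by blast
  qed
  obtain h r where h: "sq_integrable lebesgue h" "strict_mono r" "AE x in lebesgue. (\<lambda>k. v (r k) x) \<longlonglongrightarrow> h x"
    "(\<lambda>n. LINT x|lebesgue. (v n x - h x)\<^sup>2) \<longlonglongrightarrow> 0"
    by (rule L2_complete[OF H1_D(1)[OF v] C1])
  obtain g r' where g: "sq_integrable lebesgue g"
    "(\<lambda>n. LINT x|lebesgue. (deriv (v n) x - g x)\<^sup>2) \<longlonglongrightarrow> 0"
    by (rule L2_complete[OF H1_D(2)[OF v] C2])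
  have int: "(\<lambda>n. v n b - v n a) \<longlonglongrightarrow> (LINT x:{a..b}|lebesgue. g x)" if "a \<le> b" for a b
  proof -
    have "v n b - v n a = (LINT x|lebesgue. indicator {a..b} x * deriv (v n) x)" for n
      using H1_D(4)[OF v[of n]] that
      unfolding primitive_iff_lebesgue_integral[OF H1_D(2)[OF v]] set_lebesgue_integral_def by simp
    then show ?thesis
      using sq_integrable_weak_convergence[OF H1_D(2)[OF v] g(1) sq_integrable_indicator_interval g(2), of a b]
      by (simp add: set_lebesgue_integral_def)
  qed
  obtain x0 where x0: "(\<lambda>k. v (r k) x0) \<longlonglongrightarrow> h x0"
  proof -
    have "\<exists>x. (\<lambda>k. v (r k) x) \<longlonglongrightarrow> h x"
    proof (rule ccontr)
      assume "\<not> ?thesis"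
      then have "negligible (UNIV :: real set)"
        using h(3) unfolding AE_lebesgue_iff_negligible by simp
      then show False using open_not_negligible[of "UNIV :: real set"] by simp
    qed
    then show thesis using that by blast
  qed
  have conv: "convergent (\<lambda>k. v (r k) x)" for x
  proof (cases "x0 \<le> x")
    case True
    have "(\<lambda>k. v (r k) x0 + (v (r k) x - v (r k) x0)) \<longlonglongrightarrow> h x0 + (LINT x:{x0..x}|lebesgue. g x)"
      using LIMSEQ_subseq_LIMSEQ[OF int[OF True] h(2)] by (intro tendsto_add x0) (simp add: o_def)
    then show ?thesis by (auto simp: convergent_def)
  next
    case False
    then have "x \<le> x0" by simp
    have "(\<lambda>k. v (r k) x0 - (v (r k) x0 - v (r k) x)) \<longlonglongrightarrow> h x0 - (LINT x:{x..x0}|lebesgue. g x)"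
      using LIMSEQ_subseq_LIMSEQ[OF int[OF \<open>x \<le> x0\<close>] h(2)] by (intro tendsto_diff x0) (simp add: o_def)
    then show ?thesis by (auto simp: convergent_def)
  qed
  define w where "w = (\<lambda>x. lim (\<lambda>k. v (r k) x))"
  have w: "(\<lambda>k. v (r k) x) \<longlonglongrightarrow> w x" for x
    using conv[of x] unfolding w_def by (simp add: convergent_LIMSEQ_iff)
  have hw: "AE x in lebesgue. h x = w x"
    using h(3) by eventually_elim (rule LIMSEQ_unique[OF _ w])
  have wL2: "sq_integrable lebesgue w" by (rule sq_integrable_cong_AE[OF h(1) hw])
  have "primitive w g"
    unfolding primitive_iff_lebesgue_integral[OF g(1)]
  proof (intro allI impI)
    fix a b :: real assume ab: "a \<le> b"
    show "w b - w a = (LINT x:{a..b}|lebesgue. g x)"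
    proof (rule LIMSEQ_unique)
      show "(\<lambda>k. v (r k) b - v (r k) a) \<longlonglongrightarrow> w b - w a" by (intro tendsto_diff w)
      show "(\<lambda>k. v (r k) b - v (r k) a) \<longlonglongrightarrow> (LINT x:{a..b}|lebesgue. g x)"
        using LIMSEQ_subseq_LIMSEQ[OF int[OF ab] h(2)] by (simp add: o_def)
    qed
  qed
  note W = H1_I[OF wL2 g(1) this]
  note [measurable] = sq_integrable_measurable[OF h(1)] sq_integrable_measurable[OF g(1)]
    sq_integrable_measurable[OF wL2] sq_integrable_measurable[OF H1_D(2)[OF W(1)]]
  have "(LINT x|lebesgue. (v n x - h x)\<^sup>2) = (LINT x|lebesgue. (v n x - w x)\<^sup>2)" for n
  proof (rule integral_cong_AE)
    show "AE x in lebesgue. (v n x - h x)\<^sup>2 = (v n x - w x)\<^sup>2" using hw by eventually_elim simp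
  qed measurable
  moreover have "(LINT x|lebesgue. (deriv (v n) x - g x)\<^sup>2) = (LINT x|lebesgue. (deriv (v n) x - deriv w x)\<^sup>2)" for n
  proof (rule integral_cong_AE)
    show "AE x in lebesgue. (deriv (v n) x - g x)\<^sup>2 = (deriv (v n) x - deriv w x)\<^sup>2"
      using W(2) by eventually_elim simp
  qed measurable
  ultimately show thesis
    using h(4) g(2) by (intro that[OF W(1)]) simp_all
qed

lemma form_tendsto:
  assumes v: "\<And>n. v n \<in> H1" and w: "w \<in> H1" and u: "u \<in> H1"
    and "(\<lambda>n. LINT x|lebesgue. (v n x - w x)\<^sup>2) \<longlonglongrightarrow> 0"
    "(\<lambda>n. LINT x|lebesgue. (deriv (v n) x - deriv w x)\<^sup>2) \<longlonglongrightarrow> 0"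
  shows "(\<lambda>n. dirichlet_form_alpha \<alpha> u (v n)) \<longlonglongrightarrow> dirichlet_form_alpha \<alpha> u w"
  unfolding dirichlet_form_alpha_def dirichlet_form_def
  by (intro tendsto_intros sq_integrable_weak_convergence H1_D assms)

text \<open>
  This is the projection theorem: a sequence in \<open>V\<close> minimizing the energy of \<open>f - v\<close> is Cauchy, and its limit
  is the projection. Everything follows from the variational inequality \<open>var\<close>, which
  compares the energy at \<open>v n\<close> with that at \<open>v n + t * w\<close>.
\<close>

proposition form_projection_exists:
  assumes V: "V \<subseteq> H1" "(\<lambda>x. 0) \<in> V" "\<And>u v c. u \<in> V \<Longrightarrow> v \<in> V \<Longrightarrow> (\<lambda>x. u x + c * v x) \<in> V"
    and closed: "\<And>v w. (\<And>n. v n \<in> V) \<Longrightarrow> w \<in> H1 \<Longrightarrow>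
       (\<lambda>n. LINT x|lebesgue. (deriv (v n) x - deriv w x)\<^sup>2) \<longlonglongrightarrow> 0 \<Longrightarrow> w \<in> V"
    and f: "f \<in> H1" and \<alpha>: "\<alpha> > 0"
  shows "\<exists>v\<in>V. \<forall>w\<in>V. dirichlet_form_alpha \<alpha> (\<lambda>x. f x + (-1) * v x) w = 0"
proof -
  let ?B = "dirichlet_form_alpha \<alpha>"
  define p where "p = (\<lambda>v x. f x + (-1) * v x)"
  have pH: "p v \<in> H1" if "v \<in> V" for v
    using H1_add_scale(1)[OF f, of v "-1"] V(1) that by (auto simp: p_def)
  define d where "d = Inf ((\<lambda>v. ?B (p v) (p v)) ` V)"
  have bdd: "bdd_below ((\<lambda>v. ?B (p v) (p v)) ` V)"
    using L2_norms_le_form(1)[OF pH \<alpha>] by (intro bdd_belowI[of _ 0]) auto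
  have d: "d \<le> ?B (p v) (p v)" if "v \<in> V" for v
    unfolding d_def using that by (intro cInf_lower bdd) auto
  have "\<exists>v\<in>V. ?B (p v) (p v) < d + e" if "e > 0" for e
    using cInf_lessD[of "(\<lambda>v. ?B (p v) (p v)) ` V" "d + e"] V(2) that unfolding d_def by auto
  then have "\<forall>n. \<exists>v\<in>V. ?B (p v) (p v) < d + inverse (real (Suc n))" by simp
  then obtain v where v: "\<And>n. v n \<in> V" "\<And>n. ?B (p (v n)) (p (v n)) < d + inverse (real (Suc n))"
    by metis
  have var: "0 \<le> inverse (real (Suc n)) - 2 * t * ?B (p (v n)) w + t\<^sup>2 * ?B w w" if w: "w \<in> V" for n t w
  proof -
    have "d \<le> ?B (p (\<lambda>x. v n x + t * w x)) (p (\<lambda>x. v n x + t * w x))"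
      by (rule d) (rule V(3)[OF v(1) w])
    also have "p (\<lambda>x. v n x + t * w x) = (\<lambda>x. p (v n) x + (- t) * w x)"
      by (rule ext) (simp add: p_def algebra_simps)
    also have "?B (\<lambda>x. p (v n) x + (- t) * w x) (\<lambda>x. p (v n) x + (- t) * w x)
      = ?B (p (v n)) (p (v n)) + 2 * (- t) * ?B (p (v n)) w + (- t)\<^sup>2 * ?B w w"
      by (rule form_add_scale_square[OF pH[OF v(1)]]) (use V(1) w in auto)
    finally show ?thesis using v(2)[of n] by simp
  qed
  \<comment> \<open>The Cauchy estimate: the inequality \<open>var\<close> at \<open>v n\<close> and at \<open>v m\<close>, with steps \<open>1/2\<close> and \<open>-1/2\<close> in
    the direction \<open>w = v m - v n\<close>, so that both compare with the midpoint.\<close>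
  have Q: "?B (\<lambda>x. v m x + (-1) * v n x) (\<lambda>x. v m x + (-1) * v n x)
      \<le> 2 * (inverse (real (Suc m)) + inverse (real (Suc n)))" for m n
  proof -
    define w where "w = (\<lambda>x. v m x + (-1) * v n x)"
    have w: "w \<in> V" unfolding w_def by (rule V(3)[OF v(1) v(1)])
    then have wH: "w \<in> H1" using V(1) by auto
    have eq: "p (v n) = (\<lambda>x. p (v m) x + 1 * w x)"
      by (rule ext) (simp add: p_def w_def)
    have "?B (p (v n)) w = ?B (p (v m)) w + 1 * ?B w w"
      unfolding eq by (rule dirichlet_form_alpha_add_scale[OF pH[OF v(1)] wH wH])
    moreover have "0 \<le> inverse (real (Suc n)) - 2 * (1/2) * ?B (p (v n)) w + (1/2)\<^sup>2 * ?B w w"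
      by (rule var[OF w])
    moreover have "0 \<le> inverse (real (Suc m)) - 2 * (- (1/2)) * ?B (p (v m)) w + (- (1/2))\<^sup>2 * ?B w w"
      by (rule var[OF w])
    ultimately have "?B w w \<le> 2 * (inverse (real (Suc m)) + inverse (real (Suc n)))"
      by (simp add: power2_eq_square)
    then show ?thesis by (simp add: w_def)
  qed
  have vH: "v n \<in> H1" for n using v(1) V(1) by auto
  have "\<exists>N. \<forall>m\<ge>N. \<forall>n\<ge>N. ?B (\<lambda>x. v m x + (-1) * v n x) (\<lambda>x. v m x + (-1) * v n x) < e" if "e > 0" for e
  proof -
    have "e / 4 > 0" using that by simp
    from reals_Archimedean[OF this] obtain N where N: "inverse (real (Suc N)) < e / 4"
      by blast
    have "?B (\<lambda>x. v m x + (-1) * v n x) (\<lambda>x. v m x + (-1) * v n x) < e" if "m \<ge> N" "n \<ge> N" for m n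
    proof -
      have "inverse (real (Suc m)) \<le> inverse (real (Suc N))" "inverse (real (Suc n)) \<le> inverse (real (Suc N))"
        using that by (auto intro!: le_imp_inverse_le)
      with Q[of m n] N show ?thesis by argo
    qed
    then show ?thesis by blast
  qed
  note Cauchy = this
  obtain u where u: "u \<in> H1" "(\<lambda>n. LINT x|lebesgue. (v n x - u x)\<^sup>2) \<longlonglongrightarrow> 0"
    "(\<lambda>n. LINT x|lebesgue. (deriv (v n) x - deriv u x)\<^sup>2) \<longlonglongrightarrow> 0"
  proof (rule H1_complete[of v \<alpha>, OF vH \<alpha> Cauchy])
    fix w assume "w \<in> H1" "(\<lambda>n. LINT x|lebesgue. (v n x - w x)\<^sup>2) \<longlonglongrightarrow> 0"
      "(\<lambda>n. LINT x|lebesgue. (deriv (v n) x - deriv w x)\<^sup>2) \<longlonglongrightarrow> 0"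
    then show thesis by (rule that)
  qed
  have uV: "u \<in> V" by (rule closed[OF v(1) u(1,3)])
  have "?B (p u) w = 0" if w: "w \<in> V" for w
  proof -
    have wH: "w \<in> H1" using w V(1) by auto
    have eq: "?B (p v') w = ?B f w + (-1) * ?B w v'" if "v' \<in> H1" for v'
      unfolding p_def using dirichlet_form_alpha_add_scale[OF f that wH, of \<alpha> "-1"]
      by (simp add: dirichlet_form_alpha_commute[of \<alpha> w])
    have lim: "(\<lambda>n. ?B (p (v n)) w) \<longlonglongrightarrow> ?B (p u) w"
      unfolding eq[OF vH] eq[OF u(1)]
      by (intro tendsto_intros form_tendsto[OF vH u(1) wH u(2,3)])
    have "(?B (p (v n)) w)\<^sup>2 \<le> inverse (real (Suc n)) * (?B w w + 1)" for n
      by (rule weak_discriminant[OF var[OF w] L2_norms_le_form(1)[OF wH \<alpha>]])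
    then have "(\<lambda>n. ?B (p (v n)) w) \<longlonglongrightarrow> 0"
    proof (rule tendsto_zero_of_square_le)
      show "(\<lambda>n. inverse (real (Suc n)) * (?B w w + 1)) \<longlonglongrightarrow> 0"
        using tendsto_mult_right[OF LIMSEQ_inverse_real_of_nat, of "?B w w + 1"] by simp
    qed
    then show ?thesis using LIMSEQ_unique[OF lim] by blast
  qed
  then show ?thesis using uV unfolding p_def by blast
qed

text \<open>
  The differential hypotheses on the scale enter in integrated form: \<open>prim\<close> says that \<open>ds\<close> is Lebesgue
  measure on \<open>G\<close>.
\<close>

locale singular_scale =
  fixes s :: "real \<Rightarrow> real" and G :: "real set" and \<alpha> :: real
  assumes prim: "primitive s (indicator G)" and mono: "mono s" and G_open: "open G" and \<alpha>: "\<alpha> > 0"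
begin

lemma regular_iff: "u \<in> regular_subspace s \<longleftrightarrow> u \<in> H1 \<and> (AE x in lebesgue. x \<notin> G \<longrightarrow> deriv u x = 0)"
  using regular_subspace_eq[OF prim G_open mono] by auto

lemma regular_add_scale:
  assumes u: "u \<in> regular_subspace s" and v: "v \<in> regular_subspace s"
  shows "(\<lambda>x. u x + c * v x) \<in> regular_subspace s"
proof -
  have uv: "u \<in> H1" "v \<in> H1" using u v by (auto simp: regular_iff)
  have "AE x in lebesgue. x \<notin> G \<longrightarrow> deriv u x = 0" "AE x in lebesgue. x \<notin> G \<longrightarrow> deriv v x = 0"
    using u v by (auto simp: regular_iff)
  then have "AE x in lebesgue. x \<notin> G \<longrightarrow> deriv (\<lambda>x. u x + c * v x) x = 0"
    using H1_add_scale(2)[OF uv, of c] by eventually_elim simp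
  then show ?thesis using H1_add_scale(1)[OF uv] by (simp add: regular_iff)
qed

lemma regular_zero: "(\<lambda>x. 0) \<in> regular_subspace s"
proof -
  have "sq_integrable lebesgue (\<lambda>x::real. 0::real)" by (simp add: sq_integrable_def)
  moreover have "primitive (\<lambda>x. 0) (\<lambda>x. 0)" by (simp add: primitive_def)
  ultimately show ?thesis using H1_I(1) by (simp add: regular_iff)
qed

lemma regular_closed:
  assumes v: "\<And>n. v n \<in> regular_subspace s" and w: "w \<in> H1"
    and lim: "(\<lambda>n. LINT x|lebesgue. (deriv (v n) x - deriv w x)\<^sup>2) \<longlonglongrightarrow> 0"
  shows "w \<in> regular_subspace s"
proof -
  have vH: "v n \<in> H1" for n using v by (simp add: regular_iff)
  note [measurable] = sq_integrable_measurable[OF H1_D(2)[OF vH]] sq_integrable_measurable[OF H1_D(2)[OF w]]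
  have [measurable]: "- G \<in> sets lebesgue" using G_open by auto
  define c where "c = (LINT x|lebesgue. indicator (- G) x * (deriv w x)\<^sup>2)"
  have I: "integrable lebesgue (\<lambda>x. indicator (- G) x * (deriv w x)\<^sup>2)"
  proof (rule Bochner_Integration.integrable_bound[of _ "\<lambda>x. (deriv w x)\<^sup>2"])
    show "integrable lebesgue (\<lambda>x. (deriv w x)\<^sup>2)" using H1_D(2)[OF w] by (simp add: sq_integrable_def)
    show "(\<lambda>x. indicator (- G) x * (deriv w x)\<^sup>2) \<in> borel_measurable lebesgue" by measurable
  qed (auto simp: indicator_def intro!: AE_I2)
  have "c \<le> (LINT x|lebesgue. (deriv (v n) x - deriv w x)\<^sup>2)" for n
    unfolding c_def
  proof (rule integral_mono_AE[OF I])
    show "integrable lebesgue (\<lambda>x. (deriv (v n) x - deriv w x)\<^sup>2)"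
      using sq_integrable_add_scale[OF H1_D(2)[OF vH] H1_D(2)[OF w], of n "-1"] by (simp add: sq_integrable_def)
    have "AE x in lebesgue. x \<notin> G \<longrightarrow> deriv (v n) x = 0" using v[of n] by (simp add: regular_iff)
    then show "AE x in lebesgue. indicator (- G) x * (deriv w x)\<^sup>2 \<le> (deriv (v n) x - deriv w x)\<^sup>2"
      by eventually_elim (auto simp: indicator_def)
  qed
  then have "c \<le> 0" by (intro LIMSEQ_le_const[OF lim]) auto
  moreover have "0 \<le> c" unfolding c_def by (rule integral_nonneg_AE) auto
  ultimately have "(LINT x|lebesgue. indicator (- G) x * (deriv w x)\<^sup>2) = 0" unfolding c_def by linarith
  then have "AE x in lebesgue. indicator (- G) x * (deriv w x)\<^sup>2 = 0"
    by (subst (asm) integral_nonneg_eq_0_iff_AE[OF I]) auto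
  then have "AE x in lebesgue. x \<notin> G \<longrightarrow> deriv w x = 0"
    by eventually_elim (auto simp: indicator_def)
  with w show ?thesis by (simp add: regular_iff)
qed

lemma G_proj:
  assumes f: "f \<in> H1"
  obtains v where "G_proj s \<alpha> f \<in> G_space s \<alpha>" "v \<in> regular_subspace s" "f = (\<lambda>x. v x + G_proj s \<alpha> f x)"
proof -
  let ?P = "\<lambda>p. p \<in> G_space s \<alpha> \<and> (\<exists>v\<in>regular_subspace s. f = (\<lambda>x. v x + p x))"
  have "regular_subspace s \<subseteq> H1" by (auto simp: regular_iff)
  then have "\<exists>v\<in>regular_subspace s. \<forall>w\<in>regular_subspace s.
      dirichlet_form_alpha \<alpha> (\<lambda>x. f x + (-1) * v x) w = 0"
  proof (rule form_projection_exists[of "regular_subspace s" f \<alpha>])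
    show "(\<lambda>x. 0) \<in> regular_subspace s" by (rule regular_zero)
    show "f \<in> H1" by (rule f)
    show "\<alpha> > 0" by (rule \<alpha>)
    show "(\<lambda>x. u x + c * v x) \<in> regular_subspace s"
      if "u \<in> regular_subspace s" "v \<in> regular_subspace s" for u v c
      using that by (rule regular_add_scale)
    show "w \<in> regular_subspace s"
      if "\<And>n. v n \<in> regular_subspace s" "w \<in> H1"
        "(\<lambda>n. LINT x|lebesgue. (deriv (v n) x - deriv w x)\<^sup>2) \<longlonglongrightarrow> 0" for v w
      using that by (rule regular_closed)
  qed
  then obtain v where v: "v \<in> regular_subspace s"
    "\<And>w. w \<in> regular_subspace s \<Longrightarrow> dirichlet_form_alpha \<alpha> (\<lambda>x. f x + (-1) * v x) w = 0" by blast
  have vH: "v \<in> H1" using v by (simp add: regular_iff)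
  have "?P (\<lambda>x. f x + (-1) * v x)"
    using v H1_add_scale(1)[OF f vH, of "-1"] by (auto simp: G_space_def orth_compl_in_def intro!: bexI[of _ v])
  moreover have "p = q" if p: "?P p" and q: "?P q" for p q
  proof
    fix x
    obtain vp vq where vpq: "vp \<in> regular_subspace s" "f = (\<lambda>x. vp x + p x)" "vq \<in> regular_subspace s" "f = (\<lambda>x. vq x + q x)"
      using p q by blast
    have "p y + (-1) * q y = vq y + (-1) * vp y" for y
      using fun_cong[OF vpq(2), of y] fun_cong[OF vpq(4), of y] by linarith
    then have eq: "(\<lambda>x. p x + (-1) * q x) = (\<lambda>x. vq x + (-1) * vp x)" by blast
    have R: "(\<lambda>x. p x + (-1) * q x) \<in> regular_subspace s"
      unfolding eq by (rule regular_add_scale[OF vpq(3) vpq(1)])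
    then have H: "(\<lambda>x. p x + (-1) * q x) \<in> H1" by (simp add: regular_iff)
    have pq: "p \<in> H1" "q \<in> H1" using p q by (auto simp: G_space_def orth_compl_in_def)
    have "dirichlet_form_alpha \<alpha> (\<lambda>x. p x + (-1) * q x) (\<lambda>x. p x + (-1) * q x) = 0"
      using p q R by (subst dirichlet_form_alpha_add_scale[OF pq H]) (auto simp: G_space_def orth_compl_in_def)
    from H1_eq_zero_of_form_zero[OF H \<alpha> this, of x] show "p x = q x" by simp
  qed
  ultimately have "\<exists>!p. ?P p" by blast
  from theI'[OF this] have "?P (G_proj s \<alpha> f)" by (simp add: G_proj_def)
  then show thesis using that by blast
qed

end

section \<open>Primitives that are integrable over the line\<close>

lemma integrable_imp_set_integrable_interval:
  fixes h :: "real \<Rightarrow> real"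
  assumes "integrable lebesgue h"
  shows "set_integrable lebesgue {a..b} h"
  unfolding set_integrable_def by (rule integrable_mult_indicator[OF _ assms]) simp

lemma integral_window_tendsto_zero:
  fixes h :: "real \<Rightarrow> real" and p :: "nat \<Rightarrow> real"
  assumes h: "integrable lebesgue h" and p: "filterlim (\<lambda>n. \<bar>p n\<bar>) at_top sequentially"
  shows "(\<lambda>n. LINT x:{p n..p n + 1}|lebesgue. h x) \<longlonglongrightarrow> 0"
proof -
  have [measurable]: "h \<in> borel_measurable lebesgue" using h by auto
  have "(\<lambda>n. LINT x|lebesgue. indicator {p n..p n + 1} x * h x) \<longlonglongrightarrow> (LINT x::real|lebesgue. (0 :: real))"
  proof (rule integral_dominated_convergence[where w = "\<lambda>x. \<bar>h x\<bar>"])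
    show "AE x in lebesgue. (\<lambda>n. indicator {p n..p n + 1} x * h x) \<longlonglongrightarrow> 0"
    proof (rule AE_I2)
      fix x
      have "\<forall>\<^sub>F n in sequentially. \<bar>p n\<bar> > \<bar>x\<bar> + 1"
        using p unfolding filterlim_at_top_dense by blast
      then have "\<forall>\<^sub>F n in sequentially. indicator {p n..p n + 1} x * h x = 0"
        by eventually_elim (auto simp: indicator_def)
      then show "(\<lambda>n. indicator {p n..p n + 1} x * h x) \<longlonglongrightarrow> 0"
        by (rule tendsto_eventually)
    qed
    show "integrable lebesgue (\<lambda>x. \<bar>h x\<bar>)" using h by simp
    show "(\<lambda>x. indicator {p n..p n + 1} x * h x) \<in> borel_measurable lebesgue" for n
      using integrable_imp_set_integrable_interval[OF h, of "p n" "p n + 1"]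
      by (intro borel_measurable_integrable) (simp add: set_integrable_def)
    show "AE x in lebesgue. norm (indicator {p n..p n + 1} x * h x) \<le> \<bar>h x\<bar>" for n
      by (auto simp: indicator_def intro!: AE_I2)
  qed simp
  then show ?thesis by (simp add: set_lebesgue_integral_def)
qed

text \<open>
  For every \<open>t\<close> in the window, \<open>|\<Psi> y|\<close> is at most \<open>|\<Psi> t|\<close> plus the integral of \<open>|\<psi>|\<close> over the window. Averaging
  over \<open>t\<close> in the window of length one gives the claim.
\<close>

lemma primitive_bounded_by_window:
  assumes prim: "primitive \<Psi> \<psi>" and \<Psi>: "integrable lebesgue \<Psi>" and \<psi>: "integrable lebesgue \<psi>"
    and y: "y \<in> {p..p + 1}"
  shows "\<bar>\<Psi> y\<bar> \<le> (LINT x:{p..p + 1}|lebesgue. \<bar>\<Psi> x\<bar> + \<bar>\<psi> x\<bar>)"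
proof -
  define C where "C = integral {p..p + 1} (\<lambda>x. \<bar>\<psi> x\<bar>)"
  note sets = integrable_imp_set_integrable_interval[of _ p "p + 1"]
  have a\<psi>: "(\<lambda>x. \<bar>\<psi> x\<bar>) integrable_on {p..p + 1}"
    using set_lebesgue_integral_eq_integral(1)[OF sets[of "\<lambda>x. \<bar>\<psi> x\<bar>"]] \<psi> by simp
  have a\<Psi>: "(\<lambda>x. \<bar>\<Psi> x\<bar>) integrable_on {p..p + 1}"
    using set_lebesgue_integral_eq_integral(1)[OF sets[of "\<lambda>x. \<bar>\<Psi> x\<bar>"]] \<Psi> by simp
  have osc: "\<bar>\<Psi> d - \<Psi> c\<bar> \<le> C" if "p \<le> c" "c \<le> d" "d \<le> p + 1" for c d
  proof -
    have 1: "(\<psi> has_integral (\<Psi> d - \<Psi> c)) {c..d}" using prim that by (simp add: primitive_def)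
    have 2: "(\<lambda>x. \<bar>\<psi> x\<bar>) integrable_on {c..d}"
      by (rule integrable_on_subinterval[OF a\<psi>]) (use that in auto)
    have "\<bar>\<Psi> d - \<Psi> c\<bar> \<le> integral {c..d} (\<lambda>x. \<bar>\<psi> x\<bar>)"
      using integral_norm_bound_integral[of \<psi> "{c..d}" "\<lambda>x. \<bar>\<psi> x\<bar>"] 1 2
      by (auto simp: integral_unique has_integral_integrable)
    also have "\<dots> \<le> C"
      unfolding C_def by (rule integral_subset_le[OF _ 2 a\<psi>]) (use that in auto)
    finally show ?thesis .
  qed
  have "\<bar>\<Psi> y\<bar> \<le> \<bar>\<Psi> t\<bar> + C" if "t \<in> {p..p + 1}" for t
    using osc[of t y] osc[of y t] y that by (cases "t \<le> y") auto
  then have "integral {p..p + 1} (\<lambda>t. \<bar>\<Psi> y\<bar>) \<le> integral {p..p + 1} (\<lambda>t. \<bar>\<Psi> t\<bar> + C)"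
    by (intro integral_le integrable_add a\<Psi>) auto
  also have "\<dots> = integral {p..p + 1} (\<lambda>t. \<bar>\<Psi> t\<bar>) + C"
    by (subst integral_add[OF a\<Psi>]) auto
  also have "\<dots> = integral {p..p + 1} (\<lambda>x. \<bar>\<Psi> x\<bar> + \<bar>\<psi> x\<bar>)"
    unfolding C_def by (subst integral_add[OF a\<Psi> a\<psi>]) auto
  also have "\<dots> = (LINT x:{p..p + 1}|lebesgue. \<bar>\<Psi> x\<bar> + \<bar>\<psi> x\<bar>)"
    by (rule set_lebesgue_integral_eq_integral(2)[symmetric], rule sets) (use \<psi> \<Psi> in auto)
  finally show ?thesis by simp
qed

text \<open>
  The values \<open>\<Psi> n\<close> and \<open>\<Psi> (- n)\<close> tend to zero, being bounded by integrals of a fixed integrable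
  function over intervals that move off to infinity; their difference tends to the integral of \<open>\<psi>\<close>.
\<close>

lemma integral_of_integrable_primitive_eq_zero:
  assumes prim: "primitive \<Psi> \<psi>" and \<Psi>: "integrable lebesgue \<Psi>" and \<psi>: "integrable lebesgue \<psi>"
  shows "(LINT x|lebesgue. \<psi> x) = 0"
proof -
  have [measurable]: "\<psi> \<in> borel_measurable lebesgue" using \<psi> by auto
  have I: "integrable lebesgue (\<lambda>x. \<bar>\<Psi> x\<bar> + \<bar>\<psi> x\<bar>)" using \<Psi> \<psi> by simp
  have lim0: "(\<lambda>n. \<Psi> (y n)) \<longlonglongrightarrow> 0"
    if y: "\<And>n. y n \<in> {p n..p n + 1}" and p: "filterlim (\<lambda>n. \<bar>p n\<bar>) at_top sequentially" for y p :: "nat \<Rightarrow> real"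
    by (rule Lim_null_comparison[OF _ integral_window_tendsto_zero[OF I p]])
       (use primitive_bounded_by_window[OF prim \<Psi> \<psi> y] in auto)
  have "(\<lambda>n. \<Psi> (real n)) \<longlonglongrightarrow> 0"
    by (rule lim0[of _ "\<lambda>n. real n"]) (auto simp: filterlim_real_sequentially)
  moreover have "(\<lambda>n. \<Psi> (- real n)) \<longlonglongrightarrow> 0"
  proof (rule lim0[of _ "\<lambda>n. - real n - 1"])
    have "(\<lambda>n. \<bar>- real n - 1\<bar>) = (\<lambda>n. 1 + real n)" by auto
    then show "filterlim (\<lambda>n. \<bar>- real n - 1\<bar>) at_top sequentially"
      using filterlim_tendsto_add_at_top[OF tendsto_const filterlim_real_sequentially, of 1] by simp
  qed auto
  ultimately have "(\<lambda>n. \<Psi> (real n) - \<Psi> (- real n)) \<longlonglongrightarrow> 0"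
    using tendsto_diff by fastforce
  moreover have "\<Psi> (real n) - \<Psi> (- real n) = (LINT x|lebesgue. indicator {- real n..real n} x * \<psi> x)" for n
  proof -
    have "(\<psi> has_integral (\<Psi> (real n) - \<Psi> (- real n))) {- real n..real n}"
      using prim by (simp add: primitive_def)
    moreover have "(\<psi> has_integral (LINT x:{- real n..real n}|lebesgue. \<psi> x)) {- real n..real n}"
      by (rule has_integral_set_lebesgue[OF integrable_imp_set_integrable_interval[OF \<psi>]])
    ultimately show ?thesis
      by (simp add: has_integral_unique[of \<psi> _ "{- real n..real n}"] set_lebesgue_integral_def)
  qed
  moreover have "(\<lambda>n. LINT x|lebesgue. indicator {- real n..real n} x * \<psi> x) \<longlonglongrightarrow> (LINT x|lebesgue. \<psi> x)"
  proof (rule integral_dominated_convergence[where w = "\<lambda>x. \<bar>\<psi> x\<bar>"])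
    show "AE x in lebesgue. (\<lambda>n. indicator {- real n..real n} x * \<psi> x) \<longlonglongrightarrow> \<psi> x"
    proof (rule AE_I2)
      fix x
      have "\<forall>\<^sub>F n in sequentially. real n \<ge> \<bar>x\<bar>"
        using filterlim_real_sequentially unfolding filterlim_at_top by blast
      then have "\<forall>\<^sub>F n in sequentially. indicator {- real n..real n} x * \<psi> x = \<psi> x"
        by eventually_elim (auto simp: indicator_def abs_le_iff)
      then show "(\<lambda>n. indicator {- real n..real n} x * \<psi> x) \<longlonglongrightarrow> \<psi> x"
        by (rule tendsto_eventually)
    qed
    show "integrable lebesgue (\<lambda>x. \<bar>\<psi> x\<bar>)" using \<psi> by simp
    show "(\<lambda>x. indicator {- real n..real n} x * \<psi> x) \<in> borel_measurable lebesgue" for n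
      using integrable_imp_set_integrable_interval[OF \<psi>, of "- real n" "real n"]
      by (intro borel_measurable_integrable) (simp add: set_integrable_def)
    show "\<psi> \<in> borel_measurable lebesgue" using \<psi> by (rule borel_measurable_integrable)
    show "AE x in lebesgue. norm (indicator {- real n..real n} x * \<psi> x) \<le> \<bar>\<psi> x\<bar>" for n
      by (auto simp: indicator_def intro!: AE_I2)
  qed
  ultimately show ?thesis using LIMSEQ_unique by simp
qed

section \<open>Integration by parts and zero sets\<close>

lemma lipschitz_imp_ac:
  assumes L: "\<And>x y. x \<in> I \<Longrightarrow> y \<in> I \<Longrightarrow> \<bar>T (v x) - T (v y)\<bar> \<le> L * \<bar>v x - v y\<bar>"
    and v: "ac_wrt_on I (\<lambda>x. x) v"
  shows "ac_wrt_on I (\<lambda>x. x) (\<lambda>x. T (v x) :: real)"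
  unfolding ac_wrt_on_def
proof (intro allI impI)
  fix e :: real assume e: "e > 0"
  define M where "M = \<bar>L\<bar> + 1"
  have M: "M > 0" "L \<le> M" by (auto simp: M_def)
  have eM: "e / M > 0" using e M by simp
  from v[unfolded ac_wrt_on_def, THEN spec, THEN mp, OF eM]
  obtain \<delta> where \<delta>: "\<delta> > 0" "\<forall>D T. D division_of T \<and> T \<subseteq> I \<and> (\<Sum>K\<in>D. Sup K - Inf K) < \<delta>
      \<longrightarrow> (\<Sum>K\<in>D. \<bar>v (Sup K) - v (Inf K)\<bar>) < e / M"
    by blast
  show "\<exists>\<delta>>0. \<forall>D S. D division_of S \<and> S \<subseteq> I \<and> (\<Sum>K\<in>D. Sup K - Inf K) < \<delta> \<longrightarrow>
        (\<Sum>K\<in>D. \<bar>T (v (Sup K)) - T (v (Inf K))\<bar>) < e"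
  proof (intro exI[of _ \<delta>] conjI \<delta>(1) allI impI)
    fix D S assume "D division_of S \<and> S \<subseteq> I \<and> (\<Sum>K\<in>D. Sup K - Inf K) < \<delta>"
    then have D: "D division_of S" "S \<subseteq> I" "(\<Sum>K\<in>D. Sup K - Inf K) < \<delta>" by auto
    have "(\<Sum>K\<in>D. \<bar>T (v (Sup K)) - T (v (Inf K))\<bar>) \<le> (\<Sum>K\<in>D. M * \<bar>v (Sup K) - v (Inf K)\<bar>)"
    proof (rule sum_mono)
      fix K assume "K \<in> D"
      then obtain c d where K: "c \<le> d" "Inf K = c" "Sup K = d" "{c..d} \<subseteq> S"
        using division_interval_real[OF D(1)] by metis
      then have "c \<in> I" "d \<in> I" using D(2) by auto
      then have "\<bar>T (v d) - T (v c)\<bar> \<le> L * \<bar>v d - v c\<bar>" by (intro L)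
      also have "\<dots> \<le> M * \<bar>v d - v c\<bar>" using M by (intro mult_right_mono) auto
      finally show "\<bar>T (v (Sup K)) - T (v (Inf K))\<bar> \<le> M * \<bar>v (Sup K) - v (Inf K)\<bar>" using K by simp
    qed
    also have "\<dots> = M * (\<Sum>K\<in>D. \<bar>v (Sup K) - v (Inf K)\<bar>)" by (simp add: sum_distrib_left)
    also have "\<dots> < M * (e / M)"
    proof (rule mult_strict_left_mono)
      show "(\<Sum>K\<in>D. \<bar>v (Sup K) - v (Inf K)\<bar>) < e / M" using \<delta>(2) D by blast
    qed (use M in simp)
    finally show "(\<Sum>K\<in>D. \<bar>T (v (Sup K)) - T (v (Inf K))\<bar>) < e" using M by simp
  qed
qed

lemma ac_id: "ac_wrt_on I (\<lambda>x. x) (\<lambda>x. x)"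
  unfolding ac_wrt_on_def
proof (intro allI impI)
  fix e :: real assume e: "e > 0"
  show "\<exists>\<delta>>0. \<forall>D T. D division_of T \<and> T \<subseteq> I \<and> (\<Sum>K\<in>D. Sup K - Inf K) < \<delta> \<longrightarrow> (\<Sum>K\<in>D. \<bar>Sup K - Inf K\<bar>) < e"
  proof (intro exI[of _ e] conjI e allI impI)
    fix D T assume D: "D division_of T \<and> T \<subseteq> I \<and> (\<Sum>K\<in>D. Sup K - Inf K) < e"
    have "(\<Sum>K\<in>D. \<bar>Sup K - Inf K\<bar>) = (\<Sum>K\<in>D. Sup K - Inf K)"
    proof (rule sum.cong[OF refl])
      fix K assume "K \<in> D"
      then obtain c d where "c \<le> d" "Inf K = c" "Sup K = d"
        using division_interval_real D by metis
      then show "\<bar>Sup K - Inf K\<bar> = Sup K - Inf K" by simp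
    qed
    with D show "(\<Sum>K\<in>D. \<bar>Sup K - Inf K\<bar>) < e" by simp
  qed
qed

lemma continuous_derivative_imp_ac:
  assumes der: "\<And>x. x \<in> {a..b} \<Longrightarrow> (w has_real_derivative w' x) (at x)"
    and cont: "continuous_on {a..b} w'"
  shows "ac_wrt_on {a..b} (\<lambda>x. x) w"
proof -
  have "bounded (w' ` {a..b})"
    by (intro compact_imp_bounded compact_continuous_image cont) simp
  then obtain M where "\<forall>y\<in>w' ` {a..b}. norm y \<le> M" unfolding bounded_iff by blast
  then have M: "\<bar>w' x\<bar> \<le> M" if "x \<in> {a..b}" for x
    using that by simp
  have "\<bar>w x - w y\<bar> \<le> M * \<bar>x - y\<bar>" if "x \<in> {a..b}" "y \<in> {a..b}" for x y
    using field_differentiable_bound[of "{a..b}" w w' M y x] der M that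
    by (auto simp: has_field_derivative_at_within abs_minus_commute)
  then show ?thesis
    using lipschitz_imp_ac[of "{a..b}" w "\<lambda>x. x" M, OF _ ac_id] by blast
qed

lemma ac_mult:
  assumes u: "ac_wrt_on I (\<lambda>x. x) u" and v: "ac_wrt_on I (\<lambda>x. x) v"
    and M: "\<And>x. x \<in> I \<Longrightarrow> \<bar>u x\<bar> \<le> M" "\<And>x. x \<in> I \<Longrightarrow> \<bar>v x\<bar> \<le> M" and M0: "M > 0"
  shows "ac_wrt_on I (\<lambda>x. x) (\<lambda>x. u x * v x)"
  unfolding ac_wrt_on_def
proof (intro allI impI)
  fix e :: real assume e: "e > 0"
  have eM: "e / (2 * M) > 0" using e M0 by simp
  from u[unfolded ac_wrt_on_def, THEN spec, THEN mp, OF eM]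
  obtain \<delta>1 where \<delta>1: "\<delta>1 > 0" "\<forall>D T. D division_of T \<and> T \<subseteq> I \<and> (\<Sum>K\<in>D. Sup K - Inf K) < \<delta>1
      \<longrightarrow> (\<Sum>K\<in>D. \<bar>u (Sup K) - u (Inf K)\<bar>) < e / (2 * M)"
    by blast
  from v[unfolded ac_wrt_on_def, THEN spec, THEN mp, OF eM]
  obtain \<delta>2 where \<delta>2: "\<delta>2 > 0" "\<forall>D T. D division_of T \<and> T \<subseteq> I \<and> (\<Sum>K\<in>D. Sup K - Inf K) < \<delta>2
      \<longrightarrow> (\<Sum>K\<in>D. \<bar>v (Sup K) - v (Inf K)\<bar>) < e / (2 * M)"
    by blast
  show "\<exists>\<delta>>0. \<forall>D S. D division_of S \<and> S \<subseteq> I \<and> (\<Sum>K\<in>D. Sup K - Inf K) < \<delta> \<longrightarrow>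
        (\<Sum>K\<in>D. \<bar>u (Sup K) * v (Sup K) - u (Inf K) * v (Inf K)\<bar>) < e"
  proof (intro exI[of _ "min \<delta>1 \<delta>2"] conjI allI impI)
    show "min \<delta>1 \<delta>2 > 0" using \<delta>1 \<delta>2 by simp
    fix D S assume "D division_of S \<and> S \<subseteq> I \<and> (\<Sum>K\<in>D. Sup K - Inf K) < min \<delta>1 \<delta>2"
    then have D: "D division_of S" "S \<subseteq> I" and s: "(\<Sum>K\<in>D. Sup K - Inf K) < \<delta>1" "(\<Sum>K\<in>D. Sup K - Inf K) < \<delta>2" by auto
    have "(\<Sum>K\<in>D. \<bar>u (Sup K) * v (Sup K) - u (Inf K) * v (Inf K)\<bar>)
        \<le> (\<Sum>K\<in>D. M * \<bar>u (Sup K) - u (Inf K)\<bar> + M * \<bar>v (Sup K) - v (Inf K)\<bar>)"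
    proof (rule sum_mono)
      fix K assume "K \<in> D"
      then obtain c d where K: "c \<le> d" "Inf K = c" "Sup K = d" "{c..d} \<subseteq> S"
        using division_interval_real[OF D(1)] by metis
      then have cd: "c \<in> I" "d \<in> I" using D(2) by auto
      have eq: "u d * v d - u c * v c = v d * (u d - u c) + u c * (v d - v c)" by (simp add: algebra_simps)
      have "\<bar>u d * v d - u c * v c\<bar> \<le> \<bar>v d\<bar> * \<bar>u d - u c\<bar> + \<bar>u c\<bar> * \<bar>v d - v c\<bar>"
        unfolding eq abs_mult[symmetric] by (rule abs_triangle_ineq)
      also have "\<dots> \<le> M * \<bar>u d - u c\<bar> + M * \<bar>v d - v c\<bar>"
        using M cd by (intro add_mono mult_right_mono) auto
      finally show "\<bar>u (Sup K) * v (Sup K) - u (Inf K) * v (Inf K)\<bar>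
        \<le> M * \<bar>u (Sup K) - u (Inf K)\<bar> + M * \<bar>v (Sup K) - v (Inf K)\<bar>" using K by simp
    qed
    also have "\<dots> = M * (\<Sum>K\<in>D. \<bar>u (Sup K) - u (Inf K)\<bar>) + M * (\<Sum>K\<in>D. \<bar>v (Sup K) - v (Inf K)\<bar>)"
      by (simp add: sum.distrib sum_distrib_left)
    also have "\<dots> < M * (e / (2 * M)) + M * (e / (2 * M))"
    proof (intro add_strict_mono mult_strict_left_mono)
      show "(\<Sum>K\<in>D. \<bar>u (Sup K) - u (Inf K)\<bar>) < e / (2 * M)" using \<delta>1(2) D s by blast
      show "(\<Sum>K\<in>D. \<bar>v (Sup K) - v (Inf K)\<bar>) < e / (2 * M)" using \<delta>2(2) D s by blast
    qed (use M0 in simp_all)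
    also have "\<dots> = e" using M0 by simp
    finally show "(\<Sum>K\<in>D. \<bar>u (Sup K) * v (Sup K) - u (Inf K) * v (Inf K)\<bar>) < e" .
  qed
qed

text \<open>
  The product is absolutely continuous, so the product rule, which holds almost everywhere, can be integrated.
\<close>

lemma integration_by_parts_ac:
  assumes ab: "a \<le> b"
    and w: "\<And>x. x \<in> {a..b} \<Longrightarrow> (w has_real_derivative w' x) (at x)" "continuous_on {a..b} w'"
    and v: "ac_wrt_on {a..b} (\<lambda>x. x) v" "continuous_on {a..b} v"
      "AE x in lebesgue. (v has_real_derivative v' x) (at x)"
  shows "((\<lambda>x. w' x * v x + w x * v' x) has_integral (w b * v b - w a * v a)) {a..b}"
proof (rule fundamental_theorem_ac[OF ab])
  have "continuous_on {a..b} w"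
    by (rule DERIV_continuous_on, rule has_field_derivative_at_within, rule w(1))
  then have "bounded (w ` {a..b})" "bounded (v ` {a..b})"
    using v(2) by (auto intro!: compact_imp_bounded compact_continuous_image)
  then obtain M1 M2 where "\<forall>y\<in>w ` {a..b}. norm y \<le> M1" "\<forall>y\<in>v ` {a..b}. norm y \<le> M2"
    unfolding bounded_iff by blast
  then have M: "\<bar>w x\<bar> \<le> M1" "\<bar>v x\<bar> \<le> M2" if "x \<in> {a..b}" for x
    using that by simp_all
  show "ac_wrt_on {a..b} (\<lambda>x. x) (\<lambda>x. w x * v x)"
  proof (rule ac_mult[OF continuous_derivative_imp_ac[OF w] v(1), of "\<bar>M1\<bar> + \<bar>M2\<bar> + 1"])
    show "\<bar>w x\<bar> \<le> \<bar>M1\<bar> + \<bar>M2\<bar> + 1" if "x \<in> {a..b}" for x using M(1)[OF that] by linarith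
    show "\<bar>v x\<bar> \<le> \<bar>M1\<bar> + \<bar>M2\<bar> + 1" if "x \<in> {a..b}" for x using M(2)[OF that] by linarith
  qed auto
  show "AE x in lebesgue. x \<in> {a..b} \<longrightarrow> ((\<lambda>x. w x * v x) has_real_derivative w' x * v x + w x * v' x) (at x)"
    using v(3)
  proof eventually_elim
    case (elim x)
    show ?case
      using DERIV_mult[OF w(1) elim] by (auto simp: algebra_simps)
  qed
qed

text \<open>
  Choose for each such point a rational in the gap to its right; different points have disjoint gaps.
\<close>

lemma countable_right_isolated:
  fixes S :: "real set"
  shows "countable {x \<in> S. \<exists>r>0. S \<inter> {x<..<x + r} = {}}" (is "countable ?I")
proof -
  have "\<forall>x\<in>?I. \<exists>q::rat. x < of_rat q \<and> S \<inter> {x<..of_rat q} = {}"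
  proof
    fix x assume "x \<in> ?I"
    then obtain r where r: "r > 0" "S \<inter> {x<..<x + r} = {}" by blast
    obtain q where q: "x < of_rat q" "of_rat q < x + r"
      using of_rat_dense[of x "x + r"] r(1) by auto
    then have "{x<..of_rat q} \<subseteq> {x<..<x + r}" by auto
    then show "\<exists>q::rat. x < of_rat q \<and> S \<inter> {x<..of_rat q} = {}"
      using q(1) r(2) by blast
  qed
  from bchoice[OF this] obtain q :: "real \<Rightarrow> rat"
    where q: "\<forall>x\<in>?I. x < of_rat (q x) \<and> S \<inter> {x<..of_rat (q x)} = {}" by (rule exE)
  have "inj_on q ?I"
  proof (rule inj_onI)
    fix x y assume x: "x \<in> ?I" and y: "y \<in> ?I" and eq: "q x = q y"
    have no_less: False if "x < y" "x \<in> ?I" "y \<in> ?I" "q x = q y" for x y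
    proof -
      have "y \<in> S \<inter> {x<..of_rat (q x)}" using bspec[OF q that(3)] that(1,3,4) by simp
      with bspec[OF q that(2)] show False by blast
    qed
    show "x = y"
    proof (cases x y rule: linorder_cases)
      case less with no_less[OF _ x y eq] show ?thesis by simp
    next
      case greater with no_less[OF _ y x eq[symmetric]] show ?thesis by simp
    qed
  qed
  then show ?thesis by (rule countableI')
qed

text \<open>
  A zero with nonzero derivative is isolated in the zero set, and there are only countably many
  isolated points.
\<close>

lemma AE_derivative_zero_on_zero_set:
  assumes v: "AE x in lebesgue. (v has_real_derivative v' x) (at x)"
  shows "AE x in lebesgue. v x = 0 \<longrightarrow> v' x = 0"
proof -
  let ?I = "{x \<in> {x. v x = 0}. \<exists>r>0. {x. v x = 0} \<inter> {x<..<x + r} = {}}"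
  have "negligible ?I"
    unfolding negligible_iff_null_sets
    by (rule null_sets_completionI, rule countable_imp_null_set_lborel, rule countable_right_isolated)
  then have "AE x in lebesgue. x \<notin> ?I" by (simp add: AE_lebesgue_iff_negligible)
  with v show ?thesis
  proof eventually_elim
    case (elim x)
    show ?case
    proof (intro impI, rule ccontr)
      assume v0: "v x = 0" and ne: "v' x \<noteq> 0"
      have "\<exists>d>0. \<forall>h>0. h < d \<longrightarrow> v (x + h) \<noteq> 0"
      proof (cases "v' x > 0")
        case True
        with DERIV_pos_inc_right[OF elim(1)] v0 show ?thesis by fastforce
      next
        case False
        with ne have "v' x < 0" by simp
        with DERIV_neg_dec_right[OF elim(1)] v0 show ?thesis by fastforce
      qed
      then obtain d where d: "d > 0" "\<And>h. h > 0 \<Longrightarrow> h < d \<Longrightarrow> v (x + h) \<noteq> 0" by blast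
      have "v y \<noteq> 0" if "x < y" "y < x + d" for y
        using d(2)[of "y - x"] that by simp
      then have "{x. v x = 0} \<inter> {x<..<x + d} = {}" by auto
      with d(1) v0 elim(2) show False by blast
    qed
  qed
qed

section \<open>Weak solutions are classical\<close>

lemma open_contains_interval:
  fixes G :: "real set"
  assumes "open G" "x \<in> G"
  obtains a b where "a < x" "x < b" "{a..b} \<subseteq> G"
proof -
  obtain e where e: "e > 0" "cball x e \<subseteq> G"
    using assms open_contains_cball by blast
  then show thesis
    by (intro that[of "x - e" "x + e"]) (auto simp: cball_eq_atLeastAtMost)
qed

lemma antiderivative_interval:
  assumes u: "continuous_on UNIV u"
  obtains U where "\<And>x. x \<in> {a..b::real} \<Longrightarrow> (U has_real_derivative u x) (at x)"
proof -
  have "((\<lambda>y. integral {a - 1..y} u) has_real_derivative u x) (at x)" if x: "x \<in> {a..b}" for x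
  proof -
    have c: "continuous_on {a - 1..b + 1} u"
      by (rule continuous_on_subset[OF u]) auto
    have "((\<lambda>y. integral {a - 1..y} u) has_real_derivative u x) (at x within {a - 1..b + 1})"
      by (rule integral_has_real_derivative[OF c]) (use x in auto)
    moreover have "at x within {a - 1..b + 1} = at x"
      by (rule at_within_interior) (use x in auto)
    ultimately show ?thesis by simp
  qed
  then show thesis by (rule that)
qed

lemma primitive_of_integral:
  assumes g: "integrable lebesgue g"
  shows "primitive (\<lambda>x. LINT y:{..x}|lebesgue. g y) g"
  unfolding primitive_def
proof (intro allI impI)
  fix a b :: real assume ab: "a \<le> b"
  have S: "set_integrable lebesgue A g" if "A \<in> sets lebesgue" for A
    unfolding set_integrable_def by (rule integrable_mult_indicator[OF that g])
  have [measurable]: "g \<in> borel_measurable lebesgue" using g by (rule borel_measurable_integrable)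
  have I: "integrable lebesgue (\<lambda>x. indicator A x * g x)" if "A \<in> sets lebesgue" for A
    using S[OF that] by (simp add: set_integrable_def)
  have "(LINT y:{..b}|lebesgue. g y) - (LINT y:{..a}|lebesgue. g y)
    = (LINT y|lebesgue. indicator {..b} y * g y - indicator {..a} y * g y)"
    unfolding set_lebesgue_integral_def real_scaleR_def
    by (rule Bochner_Integration.integral_diff[symmetric]) (rule I, simp)+
  also have "\<dots> = (LINT y|lebesgue. indicator {a..b} y * g y)"
  proof (rule integral_cong_AE)
    have "negligible {a}" by simp
    then have "AE y in lebesgue. y \<noteq> a" by (simp add: AE_lebesgue_iff_negligible)
    then show "AE y in lebesgue. indicator {..b} y * g y - indicator {..a} y * g y = indicator {a..b} y * g y"
      by eventually_elim (use ab in \<open>auto simp: indicator_def\<close>)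
    show "(\<lambda>y. indicator {..b} y * g y - indicator {..a} y * g y) \<in> borel_measurable lebesgue"
      by (intro borel_measurable_diff borel_measurable_integrable I) auto
    show "(\<lambda>y. indicator {a..b} y * g y) \<in> borel_measurable lebesgue"
      by (intro borel_measurable_integrable I) auto
  qed
  finally have "(LINT y:{..b}|lebesgue. g y) - (LINT y:{..a}|lebesgue. g y) = (LINT y:{a..b}|lebesgue. g y)"
    by (simp add: set_lebesgue_integral_def)
  then show "(g has_integral (LINT y:{..b}|lebesgue. g y) - (LINT y:{..a}|lebesgue. g y)) {a..b}"
    using has_integral_set_lebesgue[OF S, of "{a..b}"] by simp
qed

context singular_scale
begin

text \<open>
  The lemma of du Bois-Reymond. With \<open>\<phi> = u'/2 - \<alpha> U\<close> and \<open>c\<close> the mean of \<open>\<phi>\<close> on \<open>[a,b]\<close>, the primitive \<open>v\<close>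
  of \<open>g = 1\<^bsub>[a,b]\<^esub> (\<phi> - c)\<close> vanishes off \<open>[a,b]\<close> and so is an admissible test function. Integration by parts
  turns the orthogonality of \<open>u\<close> and \<open>v\<close> into \<open>\<integral> \<phi> g = 0\<close>, that is \<open>\<integral> g\<^sup>2 = 0\<close>. Hence \<open>u' = 2 (\<alpha> U + c)\<close>
  almost everywhere on \<open>[a,b]\<close>; the right hand side is continuous, so \<open>u\<close> is differentiable with this
  derivative at every inner point.
\<close>

lemma weak_solution_derivative:
  assumes u: "u \<in> H1"
    and orth: "\<And>v. v \<in> regular_subspace_vanishing s (- G) \<Longrightarrow> dirichlet_form_alpha \<alpha> u v = 0"
    and ab: "a < b" "{a..b} \<subseteq> G"
  obtains W where "\<And>x. x \<in> {a<..<b} \<Longrightarrow> (u has_real_derivative W x) (at x)"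
    "\<And>x. x \<in> {a..b} \<Longrightarrow> (W has_real_derivative 2 * \<alpha> * u x) (at x)"
proof -
  have ucont: "continuous_on UNIV u" by (rule primitive_continuous[OF H1_D(4)[OF u]])
  obtain U where U: "\<And>x. x \<in> {a..b} \<Longrightarrow> (U has_real_derivative u x) (at x)"
    by (rule antiderivative_interval[OF ucont, of a b]) blast
  have Ucont: "continuous_on {a..b} U"
    by (rule DERIV_continuous_on, rule has_field_derivative_at_within, rule U)
  let ?I = "indicator {a..b} :: real \<Rightarrow> real"
  have I2: "?I x * ?I x = ?I x" for x by (simp add: indicator_def)
  have loc: "sq_integrable lebesgue (\<lambda>x. ?I x * k x)" if k: "continuous_on {a..b} k" for k
  proof -
    have "bounded (k ` {a..b})"
      by (intro compact_imp_bounded compact_continuous_image k) simp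
    then obtain M where "\<forall>y\<in>k ` {a..b}. norm y \<le> M" unfolding bounded_iff by blast
    then have M: "\<bar>k x\<bar> \<le> M" if "x \<in> {a..b}" for x using that by simp
    have "(\<lambda>x. ?I x *\<^sub>R k x) \<in> borel_measurable borel"
      by (rule borel_measurable_continuous_on_indicator[OF _ k]) simp
    then have meas: "(\<lambda>x. ?I x * k x) \<in> borel_measurable lebesgue"
      by (intro measurable_completion) simp
    have dom: "sq_integrable lebesgue (\<lambda>x. 0 + M * ?I x)"
      by (rule sq_integrable_add_scale) (auto simp: sq_integrable_indicator_interval, simp add: sq_integrable_def)
    show ?thesis
    proof (rule sq_integrable_bound[OF dom meas])
      fix x show "\<bar>?I x * k x\<bar> \<le> \<bar>0 + M * ?I x\<bar>"
        using M[of x] by (auto simp: indicator_def)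
    qed
  qed
  have du: "sq_integrable lebesgue (\<lambda>x. ?I x * deriv u x)"
  proof (rule sq_integrable_bound[OF H1_D(2)[OF u]])
    show "(\<lambda>x. ?I x * deriv u x) \<in> borel_measurable lebesgue"
      by (rule borel_measurable_integrable[OF sq_integrable_mult[OF sq_integrable_indicator_interval H1_D(2)[OF u]]])
  qed (auto simp: indicator_def)
  have IU: "sq_integrable lebesgue (\<lambda>x. ?I x * U x)" by (rule loc[OF Ucont])
  define g0 where "g0 = (\<lambda>x. (1/2) * (?I x * deriv u x) - \<alpha> * (?I x * U x))"
  have g0: "sq_integrable lebesgue g0"
  proof -
    have "sq_integrable lebesgue (\<lambda>x. (0 + (1/2) * (?I x * deriv u x)) + (- \<alpha>) * (?I x * U x))"
      by (intro sq_integrable_add_scale du IU) (simp add: sq_integrable_def)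
    then show ?thesis by (simp add: g0_def)
  qed
  have intI: "integrable lebesgue (\<lambda>x. ?I x * k x)" if "sq_integrable lebesgue k" for k
    by (rule sq_integrable_mult[OF sq_integrable_indicator_interval that])
  have g0I: "?I x * g0 x = g0 x" for x
    by (simp add: g0_def indicator_def)
  have g0int: "integrable lebesgue g0" using intI[OF g0] by (simp add: g0I)
  have Iint: "integrable lebesgue ?I" "(LINT x|lebesgue. ?I x) = b - a"
    using intI[OF sq_integrable_indicator_interval[of a b]] ab by (simp_all add: I2)
  define c where "c = (LINT x|lebesgue. g0 x) / (b - a)"
  define g where "g = (\<lambda>x. g0 x + (- c) * ?I x)"
  have g: "sq_integrable lebesgue g"
    unfolding g_def by (rule sq_integrable_add_scale[OF g0 sq_integrable_indicator_interval])
  have gI: "?I x * g x = g x" for x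
    by (simp add: g_def g0_def indicator_def)
  have gint: "integrable lebesgue g" using intI[OF g] by (simp add: gI)
  have g_zero: "(LINT x|lebesgue. g x) = 0"
  proof -
    have "(LINT x|lebesgue. g x) = (LINT x|lebesgue. g0 x) + (LINT x|lebesgue. (- c) * ?I x)"
      unfolding g_def by (rule Bochner_Integration.integral_add[OF g0int integrable_mult_right[OF Iint(1)]])
    then show ?thesis using ab Iint by (simp add: c_def)
  qed
  define v where "v = (\<lambda>x. LINT y:{..x}|lebesgue. g y)"
  have v: "primitive v g" unfolding v_def by (rule primitive_of_integral[OF gint])
  have v_left: "v x = 0" if "x \<le> a" for x
  proof -
    have "negligible {a}" by simp
    then have "AE y in lebesgue. y \<noteq> a" by (simp add: AE_lebesgue_iff_negligible)
    then have "AE y in lebesgue. indicator {..x} y *\<^sub>R g y = 0"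
    proof eventually_elim
      case (elim y)
      show ?case using gI[of y] that elim by (auto simp: indicator_def split: if_splits)
    qed
    then show ?thesis unfolding v_def set_lebesgue_integral_def by (rule integral_eq_zero_AE)
  qed
  have v_right: "v x = 0" if "x \<ge> b" for x
  proof -
    have "indicator {..x} y *\<^sub>R g y = g y" for y
      using gI[of y] that by (auto simp: indicator_def split: if_splits)
    then show ?thesis unfolding v_def set_lebesgue_integral_def using g_zero by presburger
  qed
  have vI: "?I x * v x = v x" for x
  proof (cases "x \<in> {a..b}")
    case False
    then have "x \<le> a \<or> b \<le> x" by auto
    then show ?thesis using v_left v_right by auto
  qed simp
  have vcont: "continuous_on UNIV v" by (rule primitive_continuous[OF v])
  have vL2: "sq_integrable lebesgue v"
    using loc[OF continuous_on_subset[OF vcont]] by (simp add: vI)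
  note vH = H1_I[OF vL2 g v]
  have "AE x in lebesgue. x \<notin> G \<longrightarrow> deriv v x = 0"
    using vH(2)
  proof eventually_elim
    case (elim x)
    show ?case using elim gI[of x] ab(2) by (auto simp: indicator_def split: if_splits)
  qed
  moreover have "v x = 0" if "x \<in> - G" for x
    using vI[of x] that ab(2) by (auto simp: indicator_def split: if_splits)
  ultimately have "v \<in> regular_subspace_vanishing s (- G)"
    using vH(1) by (simp add: regular_subspace_vanishing_def regular_iff)
  from orth[OF this] have B0: "dirichlet_form_alpha \<alpha> u v = 0" .
  have "(LINT x|lebesgue. deriv u x * deriv v x) = (LINT x|lebesgue. deriv u x * g x)"
  proof (rule integral_cong_AE)
    show "AE x in lebesgue. deriv u x * deriv v x = deriv u x * g x"
      using vH(2) by eventually_elim simp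
    show "(\<lambda>x. deriv u x * deriv v x) \<in> borel_measurable lebesgue"
      by (rule borel_measurable_integrable[OF sq_integrable_mult[OF H1_D(2)[OF u] H1_D(2)[OF vH(1)]]])
    show "(\<lambda>x. deriv u x * g x) \<in> borel_measurable lebesgue"
      by (rule borel_measurable_integrable[OF sq_integrable_mult[OF H1_D(2)[OF u] g]])
  qed
  with B0 have B: "(1/2) * (LINT x|lebesgue. deriv u x * g x) + \<alpha> * (LINT x|lebesgue. u x * v x) = 0"
    by (simp add: dirichlet_form_alpha_def dirichlet_form_def)
  have Uint: "integrable lebesgue (\<lambda>x. (?I x * U x) * g x)" by (rule sq_integrable_mult[OF IU g])
  have uv: "integrable lebesgue (\<lambda>x. u x * v x)" by (rule sq_integrable_mult[OF H1_D(1)[OF u] vL2])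
  have parts: "(LINT x|lebesgue. u x * v x) + (LINT x|lebesgue. (?I x * U x) * g x) = 0"
  proof -
    have "((\<lambda>x. u x * v x + U x * g x) has_integral (U b * v b - U a * v a)) {a..b}"
    proof (rule integration_by_parts_ac)
      show "continuous_on {a..b} u" "continuous_on {a..b} v"
        using ucont vcont by (auto intro: continuous_on_subset)
      show "ac_wrt_on {a..b} (\<lambda>x. x) v" using ab by (intro H1_D(5)[OF vH(1)]) simp
      show "AE x in lebesgue. (v has_real_derivative g x) (at x)" by (rule primitive_has_derivative_AE[OF v])
    qed (use ab U in auto)
    then have 1: "((\<lambda>x. u x * v x + U x * g x) has_integral 0) {a..b}"
      by (simp add: v_left v_right)
    have eq: "u x * v x + (?I x * U x) * g x = ?I x * (u x * v x + U x * g x)" for x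
      using vI[of x] by (auto simp: indicator_def split: if_splits)
    have "integrable lebesgue (\<lambda>x. u x * v x + (?I x * U x) * g x)"
      by (rule Bochner_Integration.integrable_add[OF uv Uint])
    then have "set_integrable lebesgue {a..b} (\<lambda>x. u x * v x + U x * g x)"
      by (simp add: set_integrable_def eq)
    from has_integral_unique[OF has_integral_set_lebesgue[OF this] 1]
    have "(LINT x|lebesgue. u x * v x + (?I x * U x) * g x) = 0"
      by (simp add: set_lebesgue_integral_def eq)
    then show ?thesis
      using Bochner_Integration.integral_add[OF uv Uint] by simp
  qed
  have dug: "integrable lebesgue (\<lambda>x. deriv u x * g x)" by (rule sq_integrable_mult[OF H1_D(2)[OF u] g])
  have "(LINT x|lebesgue. (g x)\<^sup>2) = (LINT x|lebesgue. ((1/2) * (deriv u x * g x) - \<alpha> * ((?I x * U x) * g x)) - c * g x)"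
  proof (rule Bochner_Integration.integral_cong[OF refl])
    fix x
    have "g x * g x = (1/2) * (deriv u x * (?I x * g x)) - \<alpha> * ((?I x * U x) * g x) - c * (?I x * g x)"
      by (subst g_def) (simp add: g0_def algebra_simps)
    then show "(g x)\<^sup>2 = ((1/2) * (deriv u x * g x) - \<alpha> * ((?I x * U x) * g x)) - c * g x"
      unfolding gI power2_eq_square .
  qed
  also have "\<dots> = ((1/2) * (LINT x|lebesgue. deriv u x * g x) - \<alpha> * (LINT x|lebesgue. (?I x * U x) * g x)) - c * (LINT x|lebesgue. g x)"
    using dug Uint gint by simp
  also have "\<dots> = 0"
  proof -
    have "(LINT x|lebesgue. (?I x * U x) * g x) = - (LINT x|lebesgue. u x * v x)" using parts by linarith
    then show ?thesis unfolding g_zero using B by simp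
  qed
  finally have "(LINT x|lebesgue. (g x)\<^sup>2) = 0" .
  then have "AE x in lebesgue. (g x)\<^sup>2 = 0"
    using g by (subst (asm) integral_nonneg_eq_0_iff_AE) (auto simp: sq_integrable_def)
  then have AEu: "AE x in lebesgue. x \<in> {a..b} \<longrightarrow> deriv u x = 2 * (\<alpha> * U x + c)"
    by eventually_elim (auto simp: g_def g0_def)
  define W where "W = (\<lambda>x. 2 * (\<alpha> * U x + c))"
  have Wc: "continuous_on {a..b} W" unfolding W_def by (intro continuous_intros Ucont)
  have repr: "u y = u a + integral {a..y} W" if y: "y \<in> {a..b}" for y
  proof -
    have "(deriv u has_integral (u y - u a)) {a..y}"
      using H1_D(4)[OF u] y by (simp add: primitive_def)
    moreover have "negligible {x. \<not> (x \<in> {a..b} \<longrightarrow> deriv u x = W x)}"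
      using AEu by (simp add: AE_lebesgue_iff_negligible W_def)
    ultimately have "(W has_integral (u y - u a)) {a..y}"
      by (rule has_integral_spike[rotated 2]) (use y in auto)
    then show ?thesis by (simp add: integral_unique)
  qed
  have "(u has_real_derivative W x) (at x)" if x: "x \<in> {a<..<b}" for x
  proof -
    have "((\<lambda>y. integral {a..y} W) has_real_derivative W x) (at x within {a..b})"
      by (rule integral_has_real_derivative[OF Wc]) (use x in auto)
    moreover have "at x within {a..b} = at x" by (rule at_within_interior) (use x in auto)
    ultimately have "((\<lambda>y. u a + integral {a..y} W) has_real_derivative W x) (at x)"
      using DERIV_add[OF DERIV_const, of "\<lambda>y. integral {a..y} W" "W x" x UNIV "u a"] by simp
    then show ?thesis
    proof (rule has_field_derivative_transform_within_open[of _ _ _ "{a<..<b}"])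
      show "u a + integral {a..y} W = u y" if "y \<in> {a<..<b}" for y
        by (rule repr[symmetric]) (use that in auto)
    qed (use x in auto)
  qed
  moreover have "(W has_real_derivative 2 * \<alpha> * u x) (at x)" if x: "x \<in> {a..b}" for x
    unfolding W_def using U[OF x] by (auto intro!: derivative_eq_intros)
  ultimately show thesis by (rule that)
qed

text \<open>
  By the previous lemma \<open>u\<close> is twice differentiable at every point of \<open>G\<close> with a continuous second
  derivative, so the pointwise derivative \<open>deriv u\<close> is itself the absolutely continuous version of \<open>u'\<close>.
\<close>

lemma weak_solution_imp_classical:
  assumes u: "u \<in> H1"
    and orth: "\<And>v. v \<in> regular_subspace_vanishing s (- G) \<Longrightarrow> dirichlet_form_alpha \<alpha> u v = 0"
  shows "\<And>x. x \<in> G \<Longrightarrow> (deriv u has_real_derivative 2 * \<alpha> * u x) (at x)"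
    and "locally_ac_on G (deriv u)"
proof -
  show der: "(deriv u has_real_derivative 2 * \<alpha> * u x) (at x)" if x: "x \<in> G" for x
  proof -
    obtain a b where ab: "a < x" "x < b" "{a..b} \<subseteq> G" by (rule open_contains_interval[OF G_open x])
    then have "a < b" by simp
    obtain W where W: "\<And>x. x \<in> {a<..<b} \<Longrightarrow> (u has_real_derivative W x) (at x)"
      "\<And>x. x \<in> {a..b} \<Longrightarrow> (W has_real_derivative 2 * \<alpha> * u x) (at x)"
      by (rule weak_solution_derivative[OF u orth \<open>a < b\<close> ab(3)]) (assumption, rule that, assumption+)
    have "(W has_real_derivative 2 * \<alpha> * u x) (at x)" using ab by (intro W) auto
    then show ?thesis
      by (rule has_field_derivative_transform_within_open[of _ _ _ "{a<..<b}"])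
         (use ab W(1)[THEN DERIV_imp_deriv] in auto)
  qed
  have ucont: "continuous_on UNIV u" by (rule primitive_continuous[OF H1_D(4)[OF u]])
  show "locally_ac_on G (deriv u)"
    unfolding locally_ac_on_def
  proof (intro allI impI)
    fix a b :: real assume ab: "a \<le> b \<and> {a..b} \<subseteq> G"
    have "continuous_on {a..b} (\<lambda>x. 2 * \<alpha> * u x)"
      by (intro continuous_intros continuous_on_subset[OF ucont]) auto
    then show "ac_wrt_on {a..b} (\<lambda>x. x) (deriv u)"
      by (intro continuous_derivative_imp_ac[of a b "deriv u" "\<lambda>x. 2 * \<alpha> * u x"] der) (use ab in auto)
  qed
qed

end

section \<open>A smooth truncation\<close>

text \<open>
  An odd function that vanishes for \<open>|t| \<le> e\<close>, is bounded by \<open>|t|\<close> and tends to \<open>t\<close> as \<open>e\<close> tends to zero.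
  Squaring \<open>max 0 (t\<^sup>2 - e\<^sup>2)\<close> makes it continuously differentiable, so the chain rule holds
  without exceptional levels; the denominator is never zero and bounds the derivative independently of \<open>e\<close>.
\<close>

definition cutoff :: "real \<Rightarrow> real \<Rightarrow> real" where
  "cutoff e t = t * (max 0 (t\<^sup>2 - e\<^sup>2))\<^sup>2 / (t\<^sup>2 + e\<^sup>2)\<^sup>2"

definition cutoff_deriv :: "real \<Rightarrow> real \<Rightarrow> real" where
  "cutoff_deriv e t = (let p = max 0 (t\<^sup>2 - e\<^sup>2); q = t\<^sup>2 + e\<^sup>2
     in p\<^sup>2 / q\<^sup>2 + 4 * t\<^sup>2 * p / q\<^sup>2 - 4 * t\<^sup>2 * p\<^sup>2 / q ^ 3)"

lemma DERIV_max_0_square: "((\<lambda>y. (max 0 y)\<^sup>2) has_real_derivative 2 * max 0 y) (at (y::real))"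
proof (cases y "0 :: real" rule: linorder_cases)
  case less
  have "((\<lambda>y. 0) has_real_derivative 0) (at y)" by simp
  then have "((\<lambda>y. (max 0 y)\<^sup>2) has_real_derivative 0) (at y)"
    by (rule has_field_derivative_transform_within_open[of _ _ _ "{..<0}"]) (use less in auto)
  with less show ?thesis by simp
next
  case greater
  have "((\<lambda>y. y\<^sup>2) has_real_derivative 2 * y) (at y)" by (auto intro!: derivative_eq_intros)
  then have "((\<lambda>y. (max 0 y)\<^sup>2) has_real_derivative 2 * y) (at y)"
    by (rule has_field_derivative_transform_within_open[of _ _ _ "{0<..}"]) (use greater in auto)
  with greater show ?thesis by simp
next
  case equal
  have "((\<lambda>h. ((max 0 (0 + h))\<^sup>2 - (max 0 0)\<^sup>2) / h) \<longlongrightarrow> 0) (at (0::real))"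
  proof (rule Lim_null_comparison)
    show "\<forall>\<^sub>F h in at (0::real). norm (((max 0 (0 + h))\<^sup>2 - (max 0 0)\<^sup>2) / h) \<le> \<bar>h\<bar>"
      by (rule always_eventually) (auto simp: max_def power2_eq_square)
    show "((\<lambda>h. \<bar>h\<bar>) \<longlongrightarrow> 0) (at (0::real))"
      using tendsto_rabs[OF tendsto_ident_at, of "0::real" UNIV] by simp
  qed
  with equal show ?thesis by (simp add: DERIV_def)
qed

lemma DERIV_cutoff:
  assumes e: "e > 0"
  shows "(cutoff e has_real_derivative cutoff_deriv e t) (at t)"
proof -
  define p where "p = max 0 (t\<^sup>2 - e\<^sup>2)"
  define q where "q = t\<^sup>2 + e\<^sup>2"
  have q: "q > 0" using e by (simp add: q_def add_nonneg_pos)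
  have 1: "((\<lambda>t. (max 0 (t\<^sup>2 - e\<^sup>2))\<^sup>2) has_real_derivative 2 * p * (2 * t)) (at t)"
    unfolding p_def
    by (rule DERIV_chain2[OF DERIV_max_0_square]) (auto intro!: derivative_eq_intros)
  have 2: "((\<lambda>t. (t\<^sup>2 + e\<^sup>2)\<^sup>2) has_real_derivative 4 * t * q) (at t)"
    unfolding q_def by (auto intro!: derivative_eq_intros)
  have 3: "((\<lambda>t. t * (max 0 (t\<^sup>2 - e\<^sup>2))\<^sup>2) has_real_derivative p\<^sup>2 + t * (2 * p * (2 * t))) (at t)"
    using DERIV_mult[OF DERIV_ident 1] by (simp add: p_def mult.commute add.commute)
  have "((\<lambda>t. t * (max 0 (t\<^sup>2 - e\<^sup>2))\<^sup>2 / (t\<^sup>2 + e\<^sup>2)\<^sup>2) has_real_derivative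
      ((p\<^sup>2 + t * (2 * p * (2 * t))) * q\<^sup>2 - (t * p\<^sup>2) * (4 * t * q)) / (q\<^sup>2 * q\<^sup>2)) (at t)"
    using DERIV_divide[OF 3 2] q unfolding p_def[symmetric] q_def[symmetric] by simp
  also have "((p\<^sup>2 + t * (2 * p * (2 * t))) * q\<^sup>2 - (t * p\<^sup>2) * (4 * t * q)) / (q\<^sup>2 * q\<^sup>2) = cutoff_deriv e t"
    using q unfolding cutoff_deriv_def Let_def p_def[symmetric] q_def[symmetric]
    by (simp add: field_simps power2_eq_square power3_eq_cube)
  finally show ?thesis by (simp add: cutoff_def[abs_def])
qed

text \<open>
  With \<open>a = p / q\<close> and \<open>b = t\<^sup>2 / q\<close>, both in \<open>[0,1]\<close>, the derivative is \<open>a\<^sup>2 + 4 b a - 4 b a\<^sup>2\<close>. The constant 9 is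
  crude; its independence of \<open>e\<close> provides the dominating function in the limit.
\<close>

lemma cutoff_bounds:
  assumes e: "e > 0"
  shows "\<bar>cutoff e t\<bar> \<le> \<bar>t\<bar>" "\<bar>cutoff_deriv e t\<bar> \<le> 9"
proof -
  define p where "p = max 0 (t\<^sup>2 - e\<^sup>2)"
  define q where "q = t\<^sup>2 + e\<^sup>2"
  have q: "q > 0" using e by (simp add: q_def add_nonneg_pos)
  have p: "0 \<le> p" "p \<le> q" by (auto simp: p_def q_def)
  have t: "0 \<le> t\<^sup>2" "t\<^sup>2 \<le> q" by (auto simp: q_def)
  define a where "a = p / q"
  define b where "b = t\<^sup>2 / q"
  have a: "0 \<le> a" "a \<le> 1" and b: "0 \<le> b" "b \<le> 1"
    using p t q by (auto simp: a_def b_def)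
  have a2: "0 \<le> a\<^sup>2" "a\<^sup>2 \<le> 1" using a by (auto simp: power_le_one)
  have ba: "0 \<le> b * a" "b * a \<le> 1" "0 \<le> b * a\<^sup>2" "b * a\<^sup>2 \<le> 1"
    using a b a2 by (auto intro!: mult_le_one)
  have "cutoff e t = t * a\<^sup>2"
    by (simp add: cutoff_def a_def p_def q_def power_divide)
  then show "\<bar>cutoff e t\<bar> \<le> \<bar>t\<bar>"
    using a2 by (simp add: abs_mult mult_left_le)
  have "cutoff_deriv e t = a\<^sup>2 + 4 * (b * a) - 4 * (b * a\<^sup>2)"
    using q unfolding cutoff_deriv_def Let_def p_def[symmetric] q_def[symmetric] a_def b_def
    by (simp add: field_simps power2_eq_square power3_eq_cube)
  then show "\<bar>cutoff_deriv e t\<bar> \<le> 9" using a2 ba by linarith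
qed

lemma cutoff_vanish:
  assumes e: "e > 0" and t: "\<bar>t\<bar> \<le> e"
  shows "cutoff e t = 0" "cutoff_deriv e t = 0"
proof -
  have "t\<^sup>2 \<le> e\<^sup>2" using t e by (metis abs_le_square_iff abs_of_pos)
  then show "cutoff e t = 0" "cutoff_deriv e t = 0"
    by (auto simp: cutoff_def cutoff_deriv_def max_def)
qed

lemma continuous_on_cutoff_deriv:
  assumes e: "e > 0"
  shows "continuous_on UNIV (cutoff_deriv e)"
proof -
  have "t\<^sup>2 + e\<^sup>2 \<noteq> 0" for t :: real
    using e by (simp add: add_nonneg_eq_0_iff)
  then show ?thesis
    unfolding cutoff_deriv_def[abs_def] Let_def by (intro continuous_intros ballI) auto
qed

lemma cutoff_tendsto:
  assumes e: "e \<longlonglongrightarrow> 0" and t: "t \<noteq> 0"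
  shows "(\<lambda>n. cutoff (e n) t) \<longlonglongrightarrow> t" "(\<lambda>n. cutoff_deriv (e n) t) \<longlonglongrightarrow> 1"
proof -
  have p: "(\<lambda>n. max 0 (t\<^sup>2 - (e n)\<^sup>2)) \<longlonglongrightarrow> max 0 (t\<^sup>2 - 0\<^sup>2)"
    by (intro tendsto_intros e)
  have q: "(\<lambda>n. t\<^sup>2 + (e n)\<^sup>2) \<longlonglongrightarrow> t\<^sup>2 + 0\<^sup>2"
    by (intro tendsto_intros e)
  have nz: "(t\<^sup>2 + 0\<^sup>2)\<^sup>2 \<noteq> 0" "(t\<^sup>2 + 0\<^sup>2) ^ 3 \<noteq> 0" using t by auto
  have "(\<lambda>n. cutoff (e n) t) \<longlonglongrightarrow> t * (max 0 (t\<^sup>2 - 0\<^sup>2))\<^sup>2 / (t\<^sup>2 + 0\<^sup>2)\<^sup>2"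
    unfolding cutoff_def by (intro tendsto_intros p q nz)
  then show "(\<lambda>n. cutoff (e n) t) \<longlonglongrightarrow> t" using t by simp
  have "(\<lambda>n. cutoff_deriv (e n) t) \<longlonglongrightarrow> (max 0 (t\<^sup>2 - 0\<^sup>2))\<^sup>2 / (t\<^sup>2 + 0\<^sup>2)\<^sup>2
      + 4 * t\<^sup>2 * (max 0 (t\<^sup>2 - 0\<^sup>2)) / (t\<^sup>2 + 0\<^sup>2)\<^sup>2 - 4 * t\<^sup>2 * (max 0 (t\<^sup>2 - 0\<^sup>2))\<^sup>2 / (t\<^sup>2 + 0\<^sup>2) ^ 3"
    unfolding cutoff_deriv_def Let_def by (intro tendsto_intros p q nz)
  then show "(\<lambda>n. cutoff_deriv (e n) t) \<longlonglongrightarrow> 1"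
    using t by (simp add: field_simps power2_eq_square power3_eq_cube)
qed

section \<open>Classical solutions are weak\<close>

text \<open>
  The difference to a global primitive of \<open>\<psi>\<close> is locally constant, and the line is connected.
\<close>

lemma primitive_of_locally_primitive:
  assumes \<psi>: "integrable lebesgue \<psi>"
    and loc: "\<And>x. \<exists>r>0. \<forall>a b. x - r < a \<and> a \<le> b \<and> b < x + r \<longrightarrow> (\<psi> has_integral (\<Phi> b - \<Phi> a)) {a..b}"
  shows "primitive \<Phi> \<psi>"
proof -
  define \<Psi> where "\<Psi> = (\<lambda>x. LINT y:{..x}|lebesgue. \<psi> y)"
  have \<Psi>: "primitive \<Psi> \<psi>" unfolding \<Psi>_def by (rule primitive_of_integral[OF \<psi>])
  have const: "\<Phi> x - \<Psi> x = \<Phi> y - \<Psi> y" for x y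
  proof (rule connected_local_const[of UNIV x y "\<lambda>x. \<Phi> x - \<Psi> x"])
    show "\<forall>x\<in>UNIV. \<forall>\<^sub>F y in at x within UNIV. \<Phi> x - \<Psi> x = \<Phi> y - \<Psi> y"
    proof
      fix x
      obtain r where r: "r > 0" "\<And>a b. x - r < a \<Longrightarrow> a \<le> b \<Longrightarrow> b < x + r \<Longrightarrow> (\<psi> has_integral (\<Phi> b - \<Phi> a)) {a..b}"
        using loc[of x] by blast
      have eq: "\<Phi> b - \<Phi> a = \<Psi> b - \<Psi> a" if "x - r < a" "a \<le> b" "b < x + r" for a b
        by (rule has_integral_unique[OF r(2)[OF that]]) (use \<Psi> that in \<open>simp add: primitive_def\<close>)
      have "\<Phi> x - \<Psi> x = \<Phi> y - \<Psi> y" if "dist y x < r" for y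
      proof (cases "x \<le> y")
        case True then show ?thesis using eq[of x y] that r(1) by (simp add: dist_real_def)
      next
        case False then show ?thesis using eq[of y x] that r(1) by (simp add: dist_real_def)
      qed
      then show "\<forall>\<^sub>F y in at x within UNIV. \<Phi> x - \<Psi> x = \<Phi> y - \<Psi> y"
        using r(1) unfolding eventually_at by blast
    qed
  qed auto
  have "\<Phi> b - \<Phi> a = \<Psi> b - \<Psi> a" for a b using const[of a b] by linarith
  with \<Psi> show ?thesis by (simp add: primitive_def)
qed

context singular_scale
begin

text \<open>
  For fixed \<open>e\<close> the function \<open>w * cutoff e v\<close> is a primitive of \<open>\<psi> e\<close>, which is twice the energy density of
  \<open>u\<close> and the truncated \<open>v\<close>. Both are integrable over the line, so the integral of \<open>\<psi> e\<close> is zero. As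
  \<open>e\<close> tends to zero this becomes the claim.
\<close>

lemma classical_solution_imp_weak:
  assumes u: "u \<in> H1"
    and wu: "AE x in lebesgue. x \<in> G \<longrightarrow> w x = deriv u x" and wac: "locally_ac_on G w"
    and ode: "AE x in lebesgue. x \<in> G \<longrightarrow> (w has_real_derivative 2 * \<alpha> * u x) (at x)"
    and v: "v \<in> regular_subspace_vanishing s (- G)"
  shows "dirichlet_form_alpha \<alpha> u v = 0"
proof -
  have vR: "v \<in> regular_subspace s" and v0: "\<And>x. x \<notin> G \<Longrightarrow> v x = 0"
    using v by (auto simp: regular_subspace_vanishing_def)
  have vH: "v \<in> H1" using vR by (simp add: regular_iff)
  have ucont: "continuous_on UNIV u" by (rule primitive_continuous[OF H1_D(4)[OF u]])
  have vcont: "continuous_on UNIV v" by (rule primitive_continuous[OF H1_D(4)[OF vH]])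
  have wder: "(w has_real_derivative 2 * \<alpha> * u x) (at x)" if x: "x \<in> G" for x
  proof -
    obtain a b where ab: "a < x" "x < b" "{a..b} \<subseteq> G" by (rule open_contains_interval[OF G_open x])
    have c: "continuous_on {a..b} (\<lambda>x. 2 * \<alpha> * u x)"
      by (intro continuous_intros continuous_on_subset[OF ucont]) auto
    have rep: "w y = w a + integral {a..y} (\<lambda>x. 2 * \<alpha> * u x)" if y: "y \<in> {a..b}" for y
    proof -
      have "((\<lambda>x. 2 * \<alpha> * u x) has_integral (w y - w a)) {a..y}"
      proof (rule fundamental_theorem_ac)
        have sub: "a \<le> y \<and> {a..y} \<subseteq> G" using y ab by auto
        then show "ac_wrt_on {a..y} (\<lambda>x. x) w" using wac unfolding locally_ac_on_def by blast
        show "AE x in lebesgue. x \<in> {a..y} \<longrightarrow> (w has_real_derivative 2 * \<alpha> * u x) (at x)"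
          using ode by eventually_elim (use sub in auto)
      qed (use y in auto)
      from integral_unique[OF this] show ?thesis by linarith
    qed
    have "((\<lambda>y. integral {a..y} (\<lambda>x. 2 * \<alpha> * u x)) has_real_derivative 2 * \<alpha> * u x) (at x within {a..b})"
      by (rule integral_has_real_derivative[OF c]) (use ab in auto)
    moreover have "at x within {a..b} = at x" by (rule at_within_interior) (use ab in auto)
    ultimately have "((\<lambda>y. w a + integral {a..y} (\<lambda>x. 2 * \<alpha> * u x)) has_real_derivative 2 * \<alpha> * u x) (at x)"
      using DERIV_add[OF DERIV_const, of "\<lambda>y. integral {a..y} (\<lambda>x. 2 * \<alpha> * u x)" "2 * \<alpha> * u x" x UNIV "w a"] by simp
    then show ?thesis
    proof (rule has_field_derivative_transform_within_open[of _ _ _ "{a<..<b}"])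
      show "w a + integral {a..y} (\<lambda>x. 2 * \<alpha> * u x) = w y" if "y \<in> {a<..<b}" for y
        by (rule rep[symmetric]) (use that in auto)
    qed (use ab in auto)
  qed
  note [measurable] = sq_integrable_measurable[OF H1_D(1)[OF u]] sq_integrable_measurable[OF H1_D(2)[OF u]]
    sq_integrable_measurable[OF H1_D(1)[OF vH]] sq_integrable_measurable[OF H1_D(2)[OF vH]]
  define \<psi> where "\<psi> = (\<lambda>e x. 2 * \<alpha> * (u x * cutoff e (v x)) + deriv u x * (cutoff_deriv e (v x) * deriv v x))"
  define dom where "dom = (\<lambda>x. 2 * \<alpha> * \<bar>u x * v x\<bar> + 9 * \<bar>deriv u x * deriv v x\<bar>)"
  have dom: "integrable lebesgue dom"
    unfolding dom_def using sq_integrable_mult[OF H1_D(1)[OF u] H1_D(1)[OF vH]] sq_integrable_mult[OF H1_D(2)[OF u] H1_D(2)[OF vH]]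
    by (intro Bochner_Integration.integrable_add integrable_mult_right integrable_abs)
  have cutm: "(\<lambda>x. cutoff e (v x)) \<in> borel_measurable lebesgue" "(\<lambda>x. cutoff_deriv e (v x)) \<in> borel_measurable lebesgue"
    if "e > 0" for e
  proof -
    have "continuous_on UNIV (cutoff e)"
      by (rule DERIV_continuous_on, rule has_field_derivative_at_within, rule DERIV_cutoff[OF that])
    then have [measurable]: "cutoff e \<in> borel_measurable borel" "cutoff_deriv e \<in> borel_measurable borel"
      using continuous_on_cutoff_deriv[OF that] by (auto intro: borel_measurable_continuous_onI)
    show "(\<lambda>x. cutoff e (v x)) \<in> borel_measurable lebesgue" "(\<lambda>x. cutoff_deriv e (v x)) \<in> borel_measurable lebesgue"
      by measurable
  qed
  have \<psi>m: "\<psi> e \<in> borel_measurable lebesgue" if "e > 0" for e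
  proof -
    note [measurable] = cutm[OF that]
    show ?thesis unfolding \<psi>_def by measurable
  qed
  have \<psi>dom: "\<bar>\<psi> e x\<bar> \<le> dom x" if e: "e > 0" for e x
  proof -
    have "\<bar>u x * cutoff e (v x)\<bar> \<le> \<bar>u x * v x\<bar>"
      using cutoff_bounds(1)[OF e] by (simp add: abs_mult mult_left_mono)
    moreover have "\<bar>deriv u x * (cutoff_deriv e (v x) * deriv v x)\<bar> \<le> 9 * \<bar>deriv u x * deriv v x\<bar>"
    proof -
      have "\<bar>cutoff_deriv e (v x)\<bar> * \<bar>deriv u x * deriv v x\<bar> \<le> 9 * \<bar>deriv u x * deriv v x\<bar>"
        by (rule mult_right_mono[OF cutoff_bounds(2)[OF e]]) simp
      then show ?thesis by (simp add: abs_mult mult.left_commute mult.commute)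
    qed
    moreover have "\<bar>\<psi> e x\<bar> \<le> 2 * \<alpha> * \<bar>u x * cutoff e (v x)\<bar> + \<bar>deriv u x * (cutoff_deriv e (v x) * deriv v x)\<bar>"
      unfolding \<psi>_def using \<alpha> by (intro order_trans[OF abs_triangle_ineq]) (simp add: abs_mult)
    ultimately show ?thesis unfolding dom_def using \<alpha>
      by (smt (verit, best) mult_left_mono)
  qed
  have \<psi>int: "integrable lebesgue (\<psi> e)" if e: "e > 0" for e
    by (rule Bochner_Integration.integrable_bound[OF dom \<psi>m[OF e]])
       (use \<psi>dom[OF e] in \<open>auto intro!: AE_I2 order_trans[OF _ abs_ge_self]\<close>)
  have zero: "(LINT x|lebesgue. \<psi> e x) = 0" if e: "e > 0" for e
  proof (rule integral_of_integrable_primitive_eq_zero[OF _ _ \<psi>int[OF e]])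
    let ?\<Phi> = "\<lambda>x. w x * cutoff e (v x)"
    \<comment> \<open>Off \<open>G\<close> both sides vanish with \<open>v\<close>, whatever the values of \<open>w\<close> there.\<close>
    have AE_eq: "AE x in lebesgue. deriv u x * cutoff e (v x) = ?\<Phi> x"
      using wu by eventually_elim (use v0 cutoff_vanish(1)[OF e, of 0] e in fastforce)
    have I: "integrable lebesgue (\<lambda>x. deriv u x * cutoff e (v x))"
    proof (rule sq_integrable_mult[OF H1_D(2)[OF u]])
      show "sq_integrable lebesgue (\<lambda>x. cutoff e (v x))"
        by (rule sq_integrable_bound[OF H1_D(1)[OF vH] cutm(1)[OF e] cutoff_bounds(1)[OF e]])
    qed
    show "integrable lebesgue ?\<Phi>"
      by (rule integrable_cong_AE_imp[OF I _ AE_eq])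
         (rule borel_measurable_AE[OF borel_measurable_integrable[OF I] AE_eq])
    show "primitive ?\<Phi> (\<psi> e)"
    proof (rule primitive_of_locally_primitive[OF \<psi>int[OF e]])
      fix x0
      show "\<exists>r>0. \<forall>a b. x0 - r < a \<and> a \<le> b \<and> b < x0 + r \<longrightarrow> (\<psi> e has_integral (?\<Phi> b - ?\<Phi> a)) {a..b}"
      proof (cases "x0 \<in> G")
        case True
        then obtain r where r: "r > 0" "ball x0 r \<subseteq> G" using G_open openE by blast
        show ?thesis
        proof (intro exI[of _ r] conjI r(1) allI impI)
          fix a b assume ab: "x0 - r < a \<and> a \<le> b \<and> b < x0 + r"
          then have sub: "{a..b} \<subseteq> G" using r(2) by (auto simp: dist_real_def subset_iff)
          have lip: "\<bar>cutoff e s - cutoff e t\<bar> \<le> 9 * \<bar>s - t\<bar>" for s t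
            using field_differentiable_bound[of UNIV "cutoff e" "cutoff_deriv e" 9 t s]
              DERIV_cutoff[OF e] cutoff_bounds(2)[OF e]
            by (auto simp: abs_minus_commute)
          have "((\<lambda>x. 2 * \<alpha> * u x * cutoff e (v x) + w x * (cutoff_deriv e (v x) * deriv v x))
              has_integral (w b * cutoff e (v b) - w a * cutoff e (v a))) {a..b}"
          proof (rule integration_by_parts_ac)
            show "ac_wrt_on {a..b} (\<lambda>x. x) (\<lambda>x. cutoff e (v x))"
            proof (rule lipschitz_imp_ac[of "{a..b}" "cutoff e" v 9])
              show "ac_wrt_on {a..b} (\<lambda>x. x) v" using ab by (intro H1_D(5)[OF vH]) simp
            qed (rule lip)
            show "continuous_on {a..b} (\<lambda>x. 2 * \<alpha> * u x)"
              by (intro continuous_intros continuous_on_subset[OF ucont]) auto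
            have "continuous_on UNIV (cutoff e)"
              by (rule DERIV_continuous_on, rule has_field_derivative_at_within, rule DERIV_cutoff[OF e])
            then show "continuous_on {a..b} (\<lambda>x. cutoff e (v x))"
              by (rule continuous_on_compose2) (auto intro: continuous_on_subset[OF vcont])
            show "AE x in lebesgue. ((\<lambda>x. cutoff e (v x)) has_real_derivative cutoff_deriv e (v x) * deriv v x) (at x)"
              using H1_D(3)[OF vH] by eventually_elim (rule DERIV_chain2[OF DERIV_cutoff[OF e]])
            show "(w has_real_derivative 2 * \<alpha> * u x) (at x)" if "x \<in> {a..b}" for x
              using that sub by (intro wder) auto
          qed (use ab in auto)
          moreover have "negligible {x. \<not> (x \<in> G \<longrightarrow> w x = deriv u x)}"
            using wu by (simp add: AE_lebesgue_iff_negligible)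
          ultimately show "(\<psi> e has_integral (?\<Phi> b - ?\<Phi> a)) {a..b}"
            by (rule has_integral_spike[rotated 2]) (use sub in \<open>auto simp: \<psi>_def\<close>)
        qed
      next
        case False
        then have "v x0 = 0" by (rule v0)
        have "isCont v x0" using vcont by (simp add: continuous_on_eq_continuous_at)
        then obtain r where r: "r > 0" "\<And>x. dist x x0 < r \<Longrightarrow> dist (v x) (v x0) < e"
          unfolding continuous_at_eps_delta using e by blast
        have small: "cutoff e (v x) = 0" "cutoff_deriv e (v x) = 0" if "x0 - r < x" "x < x0 + r" for x
        proof -
          have "dist x x0 < r" using that by (simp add: dist_real_def abs_less_iff)
          then have "\<bar>v x\<bar> \<le> e" using r(2)[of x] \<open>v x0 = 0\<close> by (simp add: dist_real_def)
          then show "cutoff e (v x) = 0" "cutoff_deriv e (v x) = 0" by (rule cutoff_vanish[OF e])+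
        qed
        show ?thesis
        proof (intro exI[of _ r] conjI r(1) allI impI)
          fix a b assume ab: "x0 - r < a \<and> a \<le> b \<and> b < x0 + r"
          have "(\<psi> e has_integral 0) {a..b}"
            by (rule has_integral_is_0) (use ab small in \<open>auto simp: \<psi>_def\<close>)
          then show "(\<psi> e has_integral (?\<Phi> b - ?\<Phi> a)) {a..b}"
            using small ab by simp
        qed
      qed
    qed
  qed
  define e where "e = (\<lambda>n. inverse (real (Suc n)))"
  have e: "e n > 0" "e \<longlonglongrightarrow> 0" for n
    unfolding e_def by (simp, rule LIMSEQ_inverse_real_of_nat)
  have "(\<lambda>n. LINT x|lebesgue. \<psi> (e n) x) \<longlonglongrightarrow> (LINT x|lebesgue. 2 * \<alpha> * (u x * v x) + deriv u x * deriv v x)"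
  proof (rule integral_dominated_convergence[where w = dom])
    show "(\<lambda>x. 2 * \<alpha> * (u x * v x) + deriv u x * deriv v x) \<in> borel_measurable lebesgue" by measurable
    show "AE x in lebesgue. (\<lambda>n. \<psi> (e n) x) \<longlonglongrightarrow> 2 * \<alpha> * (u x * v x) + deriv u x * deriv v x"
      \<comment> \<open>Where \<open>v = 0\<close> the truncated derivatives are all zero, and so is the limit \<open>v'\<close>, up to a null set.\<close>
      using AE_derivative_zero_on_zero_set[OF H1_D(3)[OF vH]]
    proof eventually_elim
      case (elim x)
      show ?case
      proof (cases "v x = 0")
        case True
        then show ?thesis using elim e(1) by (simp add: \<psi>_def cutoff_vanish less_imp_le)
      next
        case False
        have "(\<lambda>n. \<psi> (e n) x) \<longlonglongrightarrow> 2 * \<alpha> * (u x * v x) + deriv u x * (1 * deriv v x)"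
          unfolding \<psi>_def by (intro tendsto_intros cutoff_tendsto[OF e(2) False])
        then show ?thesis by simp
      qed
    qed
  qed (use dom \<psi>m e \<psi>dom in auto)
  then have "(\<lambda>n::nat. 0) \<longlonglongrightarrow> (LINT x|lebesgue. 2 * \<alpha> * (u x * v x) + deriv u x * deriv v x)"
    by (simp add: zero[OF e(1)])
  from LIMSEQ_unique[OF this tendsto_const]
  have "(LINT x|lebesgue. 2 * \<alpha> * (u x * v x) + deriv u x * deriv v x) = 0" .
  moreover have "(LINT x|lebesgue. 2 * \<alpha> * (u x * v x) + deriv u x * deriv v x)
     = 2 * \<alpha> * (LINT x|lebesgue. u x * v x) + (LINT x|lebesgue. deriv u x * deriv v x)"
    using sq_integrable_mult[OF H1_D(1)[OF u] H1_D(1)[OF vH]] sq_integrable_mult[OF H1_D(2)[OF u] H1_D(2)[OF vH]]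
    by (subst Bochner_Integration.integral_add) auto
  ultimately show ?thesis
    by (simp add: dirichlet_form_alpha_def dirichlet_form_def)
qed

section \<open>The set of solutions\<close>

lemma is_solution_iff_weak:
  "is_solution \<alpha> G f u \<longleftrightarrow> u \<in> H1 \<and> (AE x in lebesgue. x \<notin> G \<longrightarrow> deriv u x = deriv f x) \<and>
     (\<forall>v\<in>regular_subspace_vanishing s (- G). dirichlet_form_alpha \<alpha> u v = 0)"
proof
  assume sol: "is_solution \<alpha> G f u"
  then obtain w where u: "u \<in> H1" and w: "AE x in lebesgue. x \<in> G \<longrightarrow> w x = deriv u x" "locally_ac_on G w"
    "AE x in lebesgue. x \<in> G \<longrightarrow> (\<exists>z. (w has_real_derivative z) (at x) \<and> (1/2) * z = \<alpha> * u x)"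
    unfolding is_solution_def by blast
  have "AE x in lebesgue. x \<in> G \<longrightarrow> (w has_real_derivative 2 * \<alpha> * u x) (at x)"
    using w(3)
  proof eventually_elim
    case (elim x)
    show ?case
    proof
      assume "x \<in> G"
      with elim obtain z where z: "(w has_real_derivative z) (at x)" "(1/2) * z = \<alpha> * u x" by blast
      from z(2) have "z = 2 * \<alpha> * u x" by simp
      with z(1) show "(w has_real_derivative 2 * \<alpha> * u x) (at x)" by simp
    qed
  qed
  then show "u \<in> H1 \<and> (AE x in lebesgue. x \<notin> G \<longrightarrow> deriv u x = deriv f x) \<and>
     (\<forall>v\<in>regular_subspace_vanishing s (- G). dirichlet_form_alpha \<alpha> u v = 0)"
    using classical_solution_imp_weak[OF u w(1,2)] u sol by (auto simp: is_solution_def)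
next
  assume "u \<in> H1 \<and> (AE x in lebesgue. x \<notin> G \<longrightarrow> deriv u x = deriv f x) \<and>
     (\<forall>v\<in>regular_subspace_vanishing s (- G). dirichlet_form_alpha \<alpha> u v = 0)"
  then have u: "u \<in> H1" and F: "AE x in lebesgue. x \<notin> G \<longrightarrow> deriv u x = deriv f x"
    and orth: "\<And>v. v \<in> regular_subspace_vanishing s (- G) \<Longrightarrow> dirichlet_form_alpha \<alpha> u v = 0" by auto
  note W = weak_solution_imp_classical[OF u orth]
  have "\<exists>z. (deriv u has_real_derivative z) (at x) \<and> (1/2) * z = \<alpha> * u x" if "x \<in> G" for x
    using W(1)[OF _ that] by (intro exI[of _ "2 * \<alpha> * u x"]) simp
  then show "is_solution \<alpha> G f u"
    unfolding is_solution_def using u F W(2) by (intro conjI exI[of _ "deriv u"]) auto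
qed

text \<open>
  Subtracting the fixed component \<open>p\<close> of \<open>f\<close> turns both conditions on \<open>u\<close> into homogeneous ones on \<open>h = u - p\<close>.
\<close>

proposition solution_set:
  assumes f: "f \<in> H1"
  shows "{u. is_solution \<alpha> G f u} = {(\<lambda>x. G_proj s \<alpha> f x + h x) | h. h \<in> H_space s \<alpha> (- G)}"
proof -
  define p where "p = G_proj s \<alpha> f"
  obtain v where p: "p \<in> G_space s \<alpha>" and v: "v \<in> regular_subspace s" and fvp: "f = (\<lambda>x. v x + p x)"
    using G_proj[OF f] unfolding p_def by metis
  have pH: "p \<in> H1" and porth: "\<And>w. w \<in> regular_subspace s \<Longrightarrow> dirichlet_form_alpha \<alpha> p w = 0"
    using p by (auto simp: G_space_def orth_compl_in_def)
  have vH: "v \<in> H1" and vF: "AE x in lebesgue. x \<notin> G \<longrightarrow> deriv v x = 0" using v by (auto simp: regular_iff)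
  have f1: "f = (\<lambda>x. v x + 1 * p x)" using fvp by simp
  have "AE x in lebesgue. deriv f x = deriv v x + 1 * deriv p x"
    using H1_add_scale(2)[OF vH pH, of 1] unfolding f1[symmetric] .
  with vF have pF: "AE x in lebesgue. x \<notin> G \<longrightarrow> deriv p x = deriv f x"
    by eventually_elim simp
  have decomp: "is_solution \<alpha> G f (\<lambda>x. p x + h x) \<longleftrightarrow> h \<in> H_space s \<alpha> (- G)" if h: "h \<in> H1" for h
  proof -
    note S = H1_add_scale[OF pH h, of 1, simplified]
    have F: "(AE x in lebesgue. x \<notin> G \<longrightarrow> deriv (\<lambda>x. p x + h x) x = deriv f x)
      \<longleftrightarrow> (AE x in lebesgue. x \<notin> G \<longrightarrow> deriv h x = 0)" (is "?L \<longleftrightarrow> ?R")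
    proof
      assume ?L with S(2) pF show ?R by eventually_elim simp
    next
      assume ?R with S(2) pF show ?L by eventually_elim simp
    qed
    have B: "dirichlet_form_alpha \<alpha> (\<lambda>x. p x + h x) w = dirichlet_form_alpha \<alpha> h w"
      if "w \<in> regular_subspace_vanishing s (- G)" for w
    proof -
      have w: "w \<in> regular_subspace s" using that by (simp add: regular_subspace_vanishing_def)
      then have "w \<in> H1" by (simp add: regular_iff)
      from dirichlet_form_alpha_add_scale[OF pH h this, of \<alpha> 1] porth[OF w] show ?thesis by simp
    qed
    show ?thesis
      unfolding is_solution_iff_weak F using S(1) h B
      by (auto simp: H_space_def orth_compl_in_def regular_iff)
  qed
  show ?thesis
    unfolding p_def[symmetric]
  proof (intro set_eqI iffI)
    fix u assume "u \<in> {u. is_solution \<alpha> G f u}"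
    then have sol: "is_solution \<alpha> G f u" by simp
    then have u: "u \<in> H1" by (simp add: is_solution_def)
    define h where "h = (\<lambda>x. u x + (-1) * p x)"
    have h: "h \<in> H1" unfolding h_def by (rule H1_add_scale(1)[OF u pH])
    have eq: "u = (\<lambda>x. p x + h x)" by (rule ext) (simp add: h_def)
    from sol have "h \<in> H_space s \<alpha> (- G)"
      using decomp[OF h] unfolding eq[symmetric] by simp
    with eq show "u \<in> {(\<lambda>x. p x + h x) | h. h \<in> H_space s \<alpha> (- G)}" by blast
  next
    fix u assume "u \<in> {(\<lambda>x. p x + h x) | h. h \<in> H_space s \<alpha> (- G)}"
    then obtain h where h: "h \<in> H_space s \<alpha> (- G)" "u = (\<lambda>x. p x + h x)" by blast
    have "h \<in> H1" using h(1) by (simp add: H_space_def orth_compl_in_def regular_iff)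
    from decomp[OF this] h show "u \<in> {u. is_solution \<alpha> G f u}" by simp
  qed
qed

end

text \<open>
  The derivative of \<open>s\<close> is almost everywhere the indicator of \<open>G\<close>, so this is the fundamental theorem for \<open>s\<close>.
\<close>

lemma primitive_scale:
  assumes ac: "locally_ac_on UNIV s"
    and d: "AE x in lebesgue. (s has_real_derivative 0) (at x) \<or> (s has_real_derivative 1) (at x)"
    and G: "AE x in lebesgue. x \<in> G \<longleftrightarrow> (s has_real_derivative 1) (at x)"
  shows "primitive s (indicator G)"
  unfolding primitive_def
proof (intro allI impI)
  fix a b :: real assume ab: "a \<le> b"
  show "(indicator G has_integral (s b - s a)) {a..b}"
  proof (rule fundamental_theorem_ac[OF ab])
    show "ac_wrt_on {a..b} (\<lambda>x. x) s" using ac ab by (simp add: locally_ac_on_def)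
    show "AE x in lebesgue. x \<in> {a..b} \<longrightarrow> (s has_real_derivative indicator G x) (at x)"
      using d G by eventually_elim (auto simp: indicator_def)
  qed
qed

theorem theorem3p1:
  fixes s f :: "real \<Rightarrow> real" and G F :: "real set" and \<alpha> :: real
  assumes "strict_mono s"
    and "locally_ac_on UNIV s"
    and "AE x in lebesgue. (s has_real_derivative 0) (at x) \<or> (s has_real_derivative 1) (at x)"
    and "open G"
    and "AE x in lebesgue. x \<in> G \<longleftrightarrow> (s has_real_derivative 1) (at x)"
    and "F = - G"
    and "\<alpha> > 0"
    and "f \<in> H1"
  shows "{u. is_solution \<alpha> G f u} = {(\<lambda>x. G_proj s \<alpha> f x + h x) | h. h \<in> H_space s \<alpha> F}"
proof -
  interpret singular_scale s G \<alpha>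
    using assms primitive_scale[OF assms(2,3,5)] by unfold_locales (auto intro: strict_mono_mono)
  show ?thesis using solution_set[OF assms(8)] assms(6) by simp
qed

end
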